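(* Let $V$ be an $n$-graded vector space. Then $A(V)$, with the bracket $[\ ,\ ]^{\wedge}$, is a final object in the category $\mathcal E(V)$: for each $E\in\mathcal E(V)$ there exists a unique morphism $\varepsilon:E\to A(V)$ in $\mathcal E(V)$. Consequently $A(V)$ is unique up to isomorphism (as an object of $\mathcal E(V)$ with this property).
   Context: All vector spaces are over a field $\mathbb K$ of characteristic $0$. For $x,y\in\mathbb Z^n$ put $\langle x,y\rangle=\sum_{i=1}^n x^iy^i$. An $n$-graded vector space is $V=\bigoplus_{x\in\mathbb Z^n}V^x$; the degree of a homogeneous element $X_i$ is denoted $x_i$. An $n$-graded Lie algebra is an $n$-graded vector space with a bilinear bracket such that $[\mathcal E^x,\mathcal E^y]\subseteq\mathcal E^{x+y}$ and, for homogeneous elements, $[X,Y]=-(-1)^{\langle x,y\rangle}[Y,X]$ and $[X,[Y,Z]]=[[X,Y],Z]+(-1)^{\langle x,y\rangle}[Y,[X,Z]]$. Homomorphisms of multigraded Lie algebras are linear, preserve degrees and brackets. Category $\mathcal E(V)$: objects are the $(n+1)$-graded Lie algebras $E=\bigoplus_{(k,\kappa)\in\mathbb Z\times\mathbb Z^n}E^{(k,\kappa)}$ such that $E^{(k,\kappa)}=0$ for all $k<-1$ and $E^{(-1,* )}=V$ (i.e. $E^{(-1,x)}=V^x$ for all $x$). A morphism $\varphi:E\to F$ is a homomorphism of multigraded Lie algebras with $\varphi|E^{(-1,* )}=\operatorname{id}_V$. $A(V)$ is the following object. $M^{(k,\kappa)}(V)$ is the space of $(k+1)$-linear maps $K:V\times\dots\times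 V\to V$ with $K(V^{x_0}\times\dots\times V^{x_k})\subseteq V^{x_0+\dots+x_k+\kappa}$ ($M^{(-1,\kappa)}(V)=V^\kappa$; $M^{(k,\kappa)}(V)=0$ for $k<-1$). For $K_i\in M^{(k_i,\kappa_i)}(V)$, $$(j(K_1)K_2)(X_0,\dots,X_{k_1+k_2})=\sum_{i=0}^{k_2}(-1)^{k_1i+\langle\kappa_1,\kappa_2+x_0+\dots+x_{i-1}\rangle}K_2(X_0,\dots,K_1(X_i,\dots,X_{i+k_1}),\dots,X_{k_1+k_2})$$ (zero if $k_2=-1$). For $\mathbf x=(x_0,\dots,x_k)\in(\mathbb Z^n)^{k+1}$ and a permutation $\sigma$ of $\{0,\dots,k\}$, $\operatorname{sign}(\sigma,\mathbf x)=\prod_{i<j,\ \sigma i>\sigma j}\bigl(-(-1)^{\langle x_{\sigma i},x_{\sigma j}\rangle}\bigr)$. The alternator is $(\alpha K)(X_0,\dots,X_k)=\frac1{(k+1)!}\sum_{\sigma\in\mathcal S_{k+1}}\operatorname{sign}(\sigma,\mathbf x)K(X_{\sigma0},\dots,X_{\sigma k})$ for $K\in M^{(k,\kappa)}(V)$. Then $A^{(k,\kappa)}(V)=\alpha(M^{(k,\kappa)}(V))$, $A(V)=\bigoplus_{(k,\kappa)}A^{(k,\kappa)}(V)$, and for $K_i\in A^{(k_i,\kappa_i)}(V)$, $$i(K_1)K_2=\frac{(k_1+k_2+1)!}{(k_1+1)!(k_2+1)!}\,\alpha(j(K_1)K_2),\qquad [K_1,K_2]^{\wedge}=i(K_1)K_2-(-1)^{k_1k_2+\langle\kappa_1,\kappa_2\rangle}i(K_2)K_1,$$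 where $i(K_1)K_2=0$ if $k_2=-1$. With this bracket $A(V)$ is an $(n+1)$-graded Lie algebra (degree $(k,\kappa)$ on $A^{(k,\kappa)}(V)$) with $A^{(-1,* )}(V)=V$. *)

theory Defs
  imports
    Complex_Main
    "HOL-Library.FuncSet"
    "HOL-Library.Function_Algebras"
    "HOL-Combinatorics.Permutations"
begin

section \<open>Degrees\<close>

text \<open>
  \<open>\<int>\<^sup>n\<close> is the set of integer sequences vanishing from index \<open>n\<close> on (so \<open>n = 0\<close> is allowed), with
  the pointwise addition of \<^theory>\<open>HOL-Library.Function_Algebras\<close>.  The degree \<open>(k, \<kappa>)\<close> in
  \<open>\<int> \<times> \<int>\<^sup>n = \<int>\<^bsup>n+1\<^esup>\<close> is the sequence \<open>k, \<kappa> 0, \<kappa> 1, \<dots>\<close>.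
\<close>

type_synonym deg = "nat \<Rightarrow> int"

definition Zn :: "nat \<Rightarrow> deg set" where
  "Zn n = {x. \<forall>i\<ge>n. x i = 0}"

definition ip :: "nat \<Rightarrow> deg \<Rightarrow> deg \<Rightarrow> int" where
  "ip n x y = (\<Sum>i<n. x i * y i)"

definition dpair :: "int \<Rightarrow> deg \<Rightarrow> deg" where
  "dpair k \<kappa> = case_nat k \<kappa>"

definition dfst :: "deg \<Rightarrow> int" where
  "dfst d = d 0"

definition dsnd :: "deg \<Rightarrow> deg" where
  "dsnd d = (\<lambda>i. d (Suc i))"


section \<open>Graded vector spaces\<close>

text \<open>
  A graded vector space is given by its homogeneous pieces, which are independent subspaces of an
  ambient vector space; the space itself is their (internal direct) sum \<open>total\<close>, which
  need not be the whole ambient type.  Pieces at indices outside \<open>\<int>\<^sup>n\<close> are zero by convention.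
\<close>

record ('k, 'v) graded_vs =
  smul :: "'k \<Rightarrow> 'v \<Rightarrow> 'v"
  piece :: "deg \<Rightarrow> 'v set"

definition total :: "('k::field_char_0, 'v::ab_group_add, 'z) graded_vs_scheme \<Rightarrow> 'v set" where
  "total V = module.span (smul V) (\<Union>x. piece V x)"

definition graded_space ::
  "nat \<Rightarrow> ('k::field_char_0, 'v::ab_group_add, 'z) graded_vs_scheme \<Rightarrow> bool" where
  "graded_space n V \<longleftrightarrow>
     vector_space (smul V) \<and>
     (\<forall>x. module.subspace (smul V) (piece V x)) \<and>
     (\<forall>x. x \<notin> Zn n \<longrightarrow> piece V x = {0}) \<and>
     (\<forall>I f. finite I \<and> (\<forall>x\<in>I. f x \<in> piece V x) \<and> (\<Sum>x\<in>I. f x) = 0 \<longrightarrow> (\<forall>x\<in>I. f x = 0))"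

definition hcomp ::
  "('k::field_char_0, 'v::ab_group_add, 'z) graded_vs_scheme \<Rightarrow> deg \<Rightarrow> 'v \<Rightarrow> 'v" where
  "hcomp V x v =
     (THE f. finite {y. f y \<noteq> 0} \<and> (\<forall>y. f y \<in> piece V y) \<and> v = (\<Sum>y | f y \<noteq> 0. f y)) x"

definition linear_total ::
  "('k::field_char_0, 'v::ab_group_add, 'y) graded_vs_scheme \<Rightarrow>
   ('k, 'w::ab_group_add, 'z) graded_vs_scheme \<Rightarrow> ('v \<Rightarrow> 'w) \<Rightarrow> bool" where
  "linear_total V W f \<longleftrightarrow>
     f \<in> total V \<rightarrow> total W \<and>
     (\<forall>X\<in>total V. \<forall>Y\<in>total V. f (X + Y) = f X + f Y) \<and>
     (\<forall>c. \<forall>X\<in>total V. f (smul V c X) = smul W c (f X))"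


section \<open>Multigraded Lie algebras\<close>

record ('k, 'v) graded_lie = "('k, 'v) graded_vs" +
  brk :: "'v \<Rightarrow> 'v \<Rightarrow> 'v"

definition graded_lie_algebra ::
  "nat \<Rightarrow> ('k::field_char_0, 'v::ab_group_add, 'z) graded_lie_scheme \<Rightarrow> bool" where
  "graded_lie_algebra n L \<longleftrightarrow>
     graded_space n L \<and>
     (\<forall>X\<in>total L. linear_total L L (\<lambda>Y. brk L X Y) \<and> linear_total L L (\<lambda>Y. brk L Y X)) \<and>
     (\<forall>x\<in>Zn n. \<forall>y\<in>Zn n. \<forall>X\<in>piece L x. \<forall>Y\<in>piece L y. brk L X Y \<in> piece L (x + y)) \<and>
     (\<forall>x\<in>Zn n. \<forall>y\<in>Zn n. \<forall>X\<in>piece L x. \<forall>Y\<in>piece L y.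
        brk L X Y = - smul L ((-1) powi ip n x y) (brk L Y X)) \<and>
     (\<forall>x\<in>Zn n. \<forall>y\<in>Zn n. \<forall>z\<in>Zn n. \<forall>X\<in>piece L x. \<forall>Y\<in>piece L y. \<forall>Z\<in>piece L z.
        brk L X (brk L Y Z) =
          brk L (brk L X Y) Z + smul L ((-1) powi ip n x y) (brk L Y (brk L X Z)))"

definition graded_lie_hom ::
  "('k::field_char_0, 'e::ab_group_add, 'y) graded_lie_scheme \<Rightarrow>
   ('k, 'f::ab_group_add, 'z) graded_lie_scheme \<Rightarrow> ('e \<Rightarrow> 'f) \<Rightarrow> bool" where
  "graded_lie_hom E F \<phi> \<longleftrightarrow>
     linear_total E F \<phi> \<and>
     (\<forall>x. \<forall>X\<in>piece E x. \<phi> X \<in> piece F x) \<and>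
     (\<forall>X\<in>total E. \<forall>Y\<in>total E. \<phi> (brk E X Y) = brk F (\<phi> X) (\<phi> Y))"


section \<open>The category \<open>\<E>(V)\<close>\<close>

text \<open>
  Since \<open>V\<close> and \<open>E\<close> live in different types, the equality \<open>E\<^bsup>(-1,*)\<^esup> = V\<close> is given by an
  identification \<open>emb\<close>, carrying \<open>V\<^sup>x\<close> isomorphically onto \<open>E\<^bsup>(-1,x)\<^esup>\<close>; the condition
  \<open>\<phi>|E\<^bsup>(-1,*)\<^esup> = id\<^sub>V\<close> then says that \<open>\<phi>\<close> commutes with the identifications.  Morphisms are
  extensional functions on \<open>total E\<close>, so that equality of morphisms is equality in HOL.
\<close>

record ('k, 'v, 'e) lie_over = "('k, 'e) graded_lie" +
  emb :: "'v \<Rightarrow> 'e"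

definition obj_E ::
  "nat \<Rightarrow> ('k::field_char_0, 'v::ab_group_add) graded_vs \<Rightarrow>
   ('k, 'v, 'e::ab_group_add) lie_over \<Rightarrow> bool" where
  "obj_E n V E \<longleftrightarrow>
     graded_lie_algebra (Suc n) E \<and>
     (\<forall>k. k < -1 \<longrightarrow> (\<forall>\<kappa>\<in>Zn n. piece E (dpair k \<kappa>) = {0})) \<and>
     linear_total V E (emb E) \<and>
     (\<forall>x\<in>Zn n. bij_betw (emb E) (piece V x) (piece E (dpair (-1) x)))"

definition mor_E ::
  "('k::field_char_0, 'v::ab_group_add) graded_vs \<Rightarrow> ('k, 'v, 'e::ab_group_add) lie_over \<Rightarrow>
   ('k, 'v, 'f::ab_group_add) lie_over \<Rightarrow> ('e \<Rightarrow> 'f) \<Rightarrow> bool" where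
  "mor_E V E F \<phi> \<longleftrightarrow>
     \<phi> \<in> extensional (total E) \<and>
     graded_lie_hom E F \<phi> \<and>
     (\<forall>v\<in>total V. \<phi> (emb E v) = emb F v)"

definition iso_E ::
  "('k::field_char_0, 'v::ab_group_add) graded_vs \<Rightarrow> ('k, 'v, 'e::ab_group_add) lie_over \<Rightarrow>
   ('k, 'v, 'f::ab_group_add) lie_over \<Rightarrow> ('e \<Rightarrow> 'f) \<Rightarrow> bool" where
  "iso_E V E F \<phi> \<longleftrightarrow>
     mor_E V E F \<phi> \<and>
     (\<exists>\<psi>. mor_E V F E \<psi> \<and>
       compose (total E) \<psi> \<phi> = restrict id (total E) \<and>
       compose (total F) \<phi> \<psi> = restrict id (total F))"

text \<open>
  HOL cannot quantify over types inside a formula, so finality is relative to the objects whose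
  ambient type is \<open>'e\<close>.
\<close>

definition final_E ::
  "'e::ab_group_add itself \<Rightarrow> nat \<Rightarrow> ('k::field_char_0, 'v::ab_group_add) graded_vs \<Rightarrow>
   ('k, 'v, 'f::ab_group_add) lie_over \<Rightarrow> bool" where
  "final_E (_ :: 'e itself) n V F \<longleftrightarrow>
     obj_E n V F \<and>
     (\<forall>E :: ('k, 'v, 'e) lie_over. obj_E n V E \<longrightarrow> (\<exists>!\<epsilon>. mor_E V E F \<epsilon>))"


section \<open>The algebra \<open>A(V)\<close>\<close>

text \<open>
  An \<open>m\<close>-linear map on \<open>V\<close> is a function on lists, normalised to be zero on everything that is
  not a list of \<open>m\<close> elements of \<open>V\<close>.  A \<open>0\<close>-linear map is thus a constant, its value at \<open>[]\<close>;
  this is the identification \<open>M\<^bsup>(-1,\<kappa>)\<^esup>(V) = V\<^sup>\<kappa>\<close>.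
\<close>

definition args :: "('k::field_char_0, 'v::ab_group_add) graded_vs \<Rightarrow> nat \<Rightarrow> 'v list set" where
  "args V m = {Xs. length Xs = m \<and> set Xs \<subseteq> total V}"

definition multilinear ::
  "('k::field_char_0, 'v::ab_group_add) graded_vs \<Rightarrow> nat \<Rightarrow> ('v list \<Rightarrow> 'v) \<Rightarrow> bool" where
  "multilinear V m K \<longleftrightarrow>
     (\<forall>Xs. Xs \<notin> args V m \<longrightarrow> K Xs = 0) \<and>
     (\<forall>Xs\<in>args V m. K Xs \<in> total V) \<and>
     (\<forall>Xs\<in>args V m. \<forall>i<m. linear_total V V (\<lambda>X. K (Xs[i := X])))"

definition Mpiece ::
  "nat \<Rightarrow> ('k::field_char_0, 'v::ab_group_add) graded_vs \<Rightarrow> int \<Rightarrow> deg \<Rightarrow> ('v list \<Rightarrow> 'v) set" where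
  "Mpiece n V k \<kappa> =
     (if k < -1 then {0}
      else {K. multilinear V (nat (k + 1)) K \<and>
        (\<forall>xs Xs. length xs = nat (k + 1) \<and> set xs \<subseteq> Zn n \<and>
                 list_all2 (\<lambda>x X. X \<in> piece V x) xs Xs \<longrightarrow>
           K Xs \<in> piece V (sum_list xs + \<kappa>))})"

text \<open>
  The formulas for \<open>j\<close> and for the alternator involve the degrees of the arguments, hence define
  multilinear maps through their values on homogeneous arguments.  \<open>hom_extend V m f\<close> is the
  \<open>m\<close>-linear map with value \<open>f [x\<^sub>1, \<dots>, x\<^sub>m] [X\<^sub>1, \<dots>, X\<^sub>m]\<close> at homogeneous \<open>X\<^sub>i\<close> of degree \<open>x\<^sub>i\<close>.
\<close>

definition hom_extend ::
  "('k::field_char_0, 'v::ab_group_add) graded_vs \<Rightarrow> nat \<Rightarrow>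
   (deg list \<Rightarrow> 'v list \<Rightarrow> 'v) \<Rightarrow> 'v list \<Rightarrow> 'v" where
  "hom_extend V m f Xs =
     (if Xs \<in> args V m
      then \<Sum>xs | length xs = m \<and> (\<forall>i<m. hcomp V (xs ! i) (Xs ! i) \<noteq> 0). f xs (map2 (hcomp V) xs Xs)
      else 0)"

definition jop ::
  "nat \<Rightarrow> ('k::field_char_0, 'v::ab_group_add) graded_vs \<Rightarrow>
   int \<Rightarrow> deg \<Rightarrow> ('v list \<Rightarrow> 'v) \<Rightarrow> int \<Rightarrow> deg \<Rightarrow> ('v list \<Rightarrow> 'v) \<Rightarrow> 'v list \<Rightarrow> 'v" where
  "jop n V k1 \<kappa>1 K1 k2 \<kappa>2 K2 =
     (if k1 < -1 \<or> k2 \<le> -1 then 0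
      else hom_extend V (nat (k1 + k2 + 1)) (\<lambda>xs Xs.
        \<Sum>i\<le>nat k2.
          smul V ((-1) powi (k1 * int i + ip n \<kappa>1 (\<kappa>2 + sum_list (take i xs))))
            (K2 (take i Xs @ [K1 (take (nat (k1 + 1)) (drop i Xs))] @ drop (i + nat (k1 + 1)) Xs))))"

definition msign :: "nat \<Rightarrow> (nat \<Rightarrow> nat) \<Rightarrow> deg list \<Rightarrow> 'k::field_char_0" where
  "msign n \<sigma> xs =
     (\<Prod>(i, j) | i < j \<and> j < length xs \<and> \<sigma> i > \<sigma> j.
        - ((-1) powi ip n (xs ! \<sigma> i) (xs ! \<sigma> j)))"

text \<open>In \<open>alternator n V m\<close>, \<open>m = k + 1\<close> is the number of arguments.\<close>

definition alternator ::
  "nat \<Rightarrow> ('k::field_char_0, 'v::ab_group_add) graded_vs \<Rightarrow> nat \<Rightarrow>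
   ('v list \<Rightarrow> 'v) \<Rightarrow> 'v list \<Rightarrow> 'v" where
  "alternator n V m K =
     hom_extend V m (\<lambda>xs Xs.
       smul V (1 / fact m)
         (\<Sum>\<sigma> | \<sigma> permutes {..<m}. smul V (msign n \<sigma> xs) (K (permute_list \<sigma> Xs))))"

definition Apiece ::
  "nat \<Rightarrow> ('k::field_char_0, 'v::ab_group_add) graded_vs \<Rightarrow> int \<Rightarrow> deg \<Rightarrow> ('v list \<Rightarrow> 'v) set" where
  "Apiece n V k \<kappa> = alternator n V (nat (k + 1)) ` Mpiece n V k \<kappa>"

definition iop ::
  "nat \<Rightarrow> ('k::field_char_0, 'v::ab_group_add) graded_vs \<Rightarrow>
   int \<Rightarrow> deg \<Rightarrow> ('v list \<Rightarrow> 'v) \<Rightarrow> int \<Rightarrow> deg \<Rightarrow> ('v list \<Rightarrow> 'v) \<Rightarrow> 'v list \<Rightarrow> 'v" where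
  "iop n V k1 \<kappa>1 K1 k2 \<kappa>2 K2 =
     (if k1 < -1 \<or> k2 \<le> -1 then 0
      else (\<lambda>Xs. smul V
        (fact (nat (k1 + k2 + 1)) / (fact (nat (k1 + 1)) * fact (nat (k2 + 1))))
        (alternator n V (nat (k1 + k2 + 1)) (jop n V k1 \<kappa>1 K1 k2 \<kappa>2 K2) Xs)))"

definition wedge_brk ::
  "nat \<Rightarrow> ('k::field_char_0, 'v::ab_group_add) graded_vs \<Rightarrow>
   int \<Rightarrow> deg \<Rightarrow> ('v list \<Rightarrow> 'v) \<Rightarrow> int \<Rightarrow> deg \<Rightarrow> ('v list \<Rightarrow> 'v) \<Rightarrow> 'v list \<Rightarrow> 'v" where
  "wedge_brk n V k1 \<kappa>1 K1 k2 \<kappa>2 K2 =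
     (\<lambda>Xs. iop n V k1 \<kappa>1 K1 k2 \<kappa>2 K2 Xs
        - smul V ((-1) powi (k1 * k2 + ip n \<kappa>1 \<kappa>2)) (iop n V k2 \<kappa>2 K2 k1 \<kappa>1 K1 Xs))"

text \<open>
  Elements of the direct sum \<open>A(V)\<close> are finitely supported families indexed by the degrees
  \<open>(k, \<kappa>)\<close>, with the bracket extended bilinearly from the homogeneous elements.  The copy of
  \<open>V\<close> in degrees \<open>(-1, *)\<close> sends \<open>v\<close> to the family of its homogeneous components, as constants.
\<close>

type_synonym 'v multimaps = "deg \<Rightarrow> 'v list \<Rightarrow> 'v"

definition A_alg ::
  "nat \<Rightarrow> ('k::field_char_0, 'v::ab_group_add) graded_vs \<Rightarrow> ('k, 'v, 'v multimaps) lie_over" where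
  "A_alg n V =
     \<lparr> smul = (\<lambda>c P d Xs. smul V c (P d Xs)),
       piece = (\<lambda>d. {(\<lambda>_. 0)(d := K) |K. K \<in> Apiece n V (dfst d) (dsnd d)}),
       brk = (\<lambda>P Q d. \<Sum>(d1, d2) | P d1 \<noteq> 0 \<and> Q d2 \<noteq> 0 \<and> d1 + d2 = d.
                wedge_brk n V (dfst d1) (dsnd d1) (P d1) (dfst d2) (dsnd d2) (Q d2)),
       emb = (\<lambda>v d Xs. if dfst d = -1 \<and> Xs = [] then hcomp V (dsnd d) v else 0) \<rparr>"

end

theory Submission
  imports Defs
begin

text \<open>
  \<open>A(V)\<close> is final because its elements of degree \<open>(k, \<kappa>)\<close>, \<open>k \<ge> 0\<close>, are determined by their brackets with
  \<open>V\<close>.  For \<open>X \<in> V\<^sup>x\<close> the bracket \<open>[X, K]\<close> is, up to the sign \<open>(-1)\<^bsup>\<langle>x,\<kappa>\<rangle>\<^esup>\<close>, the map \<open>K(X, \<dots>)\<close> (\<open>br_V\<close>), so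
  \<open>K = L\<close> as soon as \<open>[X, K] = [X, L]\<close> for all homogeneous \<open>X\<close> (\<open>A_eqI_ad\<close>).  A morphism \<open>\<epsilon> : E \<rightarrow> A(V)\<close>
  is the identity on \<open>V\<close> and preserves brackets, hence by induction on \<open>k\<close> its value at \<open>e\<close> can only be
  the map \<open>(X\<^sub>0, \<dots>, X\<^sub>k) \<mapsto> \<plusminus> [X\<^sub>k, [\<dots>, [X\<^sub>0, e]]]\<close> (\<open>mor_piece\<close>).  Conversely this map is alternating:
  \<open>[X, Y]\<close> lies in \<open>E\<^bsup>(-2,*)\<^esup> = 0\<close>, so that by the Jacobi identity the operators \<open>[X, _]\<close> and \<open>[Y, _]\<close>
  commute up to the required sign (\<open>contract_swap\<close>).  It is compatible with the brackets by
  induction on the total degree: \<open>[X, _]\<close> is a derivation on both sides, which reduces the claim for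
  \<open>P\<close>, \<open>Q\<close> to those for \<open>[X, P]\<close>, \<open>Q\<close> and for \<open>P\<close>, \<open>[X, Q]\<close> (\<open>comp_brk\<close>).
  
  The Jacobi identity of \<open>A(V)\<close> has the same proof.  Once \<open>[X, _]\<close> is known to be a derivation of the
  bracket (\<open>ad_br\<close>), contracting a Jacobi identity with \<open>X\<close> leaves a combination of three Jacobi
  identities of smaller total degree (\<open>jacobi_all\<close>); the induction starts with the identities that have
  an entry in \<open>V\<close>, and these are the derivation property again.
  
  The derivation property itself is a computation on homogeneous arguments, for which all sums are
  written by recursion on the list of arguments.  Grouping permutations by the position to which the
  first argument moves gives \<open>altsum (z # zs) F = altsum zs (\<lambda>l. ins z l F)\<close>, where \<open>ins z l F\<close> adds up the
  values of \<open>F\<close> at the lists that arise from \<open>l\<close> by inserting \<open>z\<close> at some position, with signs; up to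
  the factor \<open>m!\<close> this is the alternator (\<open>altsum_eq_permutations\<close>).  So contracting an alternated map
  is the operator \<open>j(X)\<close> before alternation, and what is needed is the Leibniz rule
  \<open>j(X) j(K\<^sub>1) K\<^sub>2 = j(j(X) K\<^sub>1) K\<^sub>2 \<plusminus> j(K\<^sub>1) j(X) K\<^sub>2\<close> (\<open>ins_plugsum\<close>), which holds for all multilinear maps, by
  induction on the argument list.  For alternating \<open>K\<close> with \<open>m\<close> arguments \<open>j(X) K\<close> is \<open>\<plusminus> m K(X, \<dots>)\<close>, and
  the factors \<open>m\<close> cancel against the factorials in the definition of \<open>i(K\<^sub>1) K\<^sub>2\<close> (\<open>circ_Cons\<close>).
\<close>

section \<open>Signs and degrees\<close>

text \<open>
  The operator \<open>(-1)\<^sup>a\<close>.  It makes sense in every abelian group, so the same sign calculus serves for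
  elements of \<open>V\<close> and of \<open>E\<close>, for multilinear maps and for families of them, and identities between
  signs reduce to case distinctions on parities.
\<close>
definition sg :: "int \<Rightarrow> 'a::ab_group_add \<Rightarrow> 'a" where
  "sg a v = (if even a then v else - v)"

lemma sg_add: "sg a (u + v) = sg a u + sg a v"
  and sg_diff: "sg a (u - v) = sg a u - sg a v"
  and sg_zero [simp]: "sg a 0 = 0"
  and sg_0 [simp]: "sg 0 v = v"
  and sg_sg: "sg a (sg b v) = sg (a + b) v"
  and sg_apply: "sg a F t = sg a (F t :: 'a)"
  for u v :: "'a::ab_group_add" and F :: "'b \<Rightarrow> 'a"
  by (auto simp: sg_def)

lemma sg_sum: "sg a (sum f S) = (\<Sum>x\<in>S. sg a (f x))"
  by (simp add: sg_def sum_negf)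

lemma sg_cong: "even (a + b) \<Longrightarrow> sg a v = sg b v"
  by (auto simp: sg_def)

lemma ip_commute: "ip n x y = ip n y x"
  by (simp add: ip_def mult.commute)

lemma ip_add_left: "ip n (x + y) z = ip n x z + ip n y z"
  and ip_add_right: "ip n z (x + y) = ip n z x + ip n z y"
  by (simp_all add: ip_def algebra_simps sum.distrib)

lemma ip_zero [simp]: "ip n 0 x = 0" "ip n x 0 = 0"
  by (simp_all add: ip_def)

lemma Zn_add: "x \<in> Zn n \<Longrightarrow> y \<in> Zn n \<Longrightarrow> x + y \<in> Zn n"
  and Zn_0 [simp]: "0 \<in> Zn n"
  by (simp_all add: Zn_def)

text \<open>
  Degrees are manipulated as elements of an abelian group.  Unfolding their pointwise sums would
  destroy the shape \<open>x + y\<close> that the rules about degrees match.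
\<close>

declare plus_fun_apply [simp del] zero_fun_apply [simp del]

section \<open>Homogeneous components\<close>

locale graded =
  fixes n :: nat and V :: "('k::field_char_0, 'v::ab_group_add, 'z) graded_vs_scheme"
  assumes graded: "graded_space n V"
begin

sublocale vs: vector_space "smul V"
  using graded by (simp add: graded_space_def)

lemma subspace_piece: "vs.subspace (piece V x)"
  using graded by (simp add: graded_space_def)

lemmas piece_0 [simp, intro] = vs.subspace_0[OF subspace_piece]
  and piece_add [simp, intro] = vs.subspace_add[OF subspace_piece]
  and piece_diff [intro] = vs.subspace_diff[OF subspace_piece]
  and piece_minus [intro] = vs.subspace_neg[OF subspace_piece]
  and piece_scale [simp, intro] = vs.subspace_scale[OF subspace_piece]

lemma piece_outside: "x \<notin> Zn n \<Longrightarrow> X \<in> piece V x \<Longrightarrow> X = 0"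
  using graded by (auto simp: graded_space_def)

lemma piece_sg [intro]: "X \<in> piece V x \<Longrightarrow> sg a X \<in> piece V x"
  by (auto simp: sg_def)

lemma smul_sign: "smul V ((-1) powi a) v = sg a v"
  by (cases "even a") (auto simp: sg_def power_int_minus_left)

lemma sg_smul: "sg a (smul V c v) = smul V c (sg a v)"
  by (simp add: sg_def)

lemma subspace_total: "vs.subspace (total V)"
  by (simp add: total_def)

lemmas total_0 [simp, intro] = vs.subspace_0[OF subspace_total]
  and total_add [intro] = vs.subspace_add[OF subspace_total]
  and total_scale [intro] = vs.subspace_scale[OF subspace_total]
  and total_sum [intro] = vs.subspace_sum[OF subspace_total]

lemma piece_total [intro]: "X \<in> piece V x \<Longrightarrow> X \<in> total V"
  by (auto simp: total_def intro: vs.span_base)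

lemma total_induct [consumes 1, case_names piece add]:
  assumes "v \<in> total V"
    and piece: "\<And>x X. X \<in> piece V x \<Longrightarrow> P X"
    and add: "\<And>u v. u \<in> total V \<Longrightarrow> v \<in> total V \<Longrightarrow> P u \<Longrightarrow> P v \<Longrightarrow> P (u + v)"
  shows "P v"
proof -
  have "v \<in> vs.span (\<Union>x. piece V x)"
    using assms(1) by (simp add: total_def)
  then have "v \<in> total V \<and> P v"
  proof (induction rule: vs.span_induct_alt)
    case base
    show ?case using piece[OF piece_0] by simp
  next
    case (step c u v)
    then obtain x where "smul V c u \<in> piece V x" by auto
    with step show ?case by (auto intro: piece add)
  qed
  then show ?thesis ..
qed

lemma independent:
  "finite I \<Longrightarrow> \<forall>x\<in>I. f x \<in> piece V x \<Longrightarrow> sum f I = 0 \<Longrightarrow> \<forall>x\<in>I. f x = 0"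
  using graded unfolding graded_space_def by blast

definition decomposition :: "(deg \<Rightarrow> 'v) \<Rightarrow> 'v \<Rightarrow> bool" where
  "decomposition f v \<longleftrightarrow>
     finite {y. f y \<noteq> 0} \<and> (\<forall>y. f y \<in> piece V y) \<and> v = (\<Sum>y | f y \<noteq> 0. f y)"

text \<open>
  The support of a family is awkward under addition.  A sum over any finite superset of the support
  does as well, and two families can be given a common one.
\<close>
lemma decomposition_on:
  assumes "finite S" "\<And>y. y \<notin> S \<Longrightarrow> f y = 0" "\<And>y. f y \<in> piece V y"
  shows "decomposition f v \<longleftrightarrow> v = sum f S"
proof -
  have "{y. f y \<noteq> 0} \<subseteq> S" using assms(2) by auto
  then have "sum f {y. f y \<noteq> 0} = sum f S" "finite {y. f y \<noteq> 0}"
    using assms(1) by (auto intro: sum.mono_neutral_left finite_subset)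
  then show ?thesis using assms(3) by (auto simp: decomposition_def)
qed

lemma decomposition_unique:
  assumes "decomposition f v" "decomposition g v"
  shows "f = g"
proof -
  define S where "S = {y. f y \<noteq> 0} \<union> {y. g y \<noteq> 0}"
  have S: "finite S" "\<And>y. y \<notin> S \<Longrightarrow> f y = 0" "\<And>y. y \<notin> S \<Longrightarrow> g y = 0"
    using assms by (auto simp: S_def decomposition_def)
  have p: "\<And>y. f y \<in> piece V y" "\<And>y. g y \<in> piece V y"
    using assms by (auto simp: decomposition_def)
  have "(\<Sum>y\<in>S. f y - g y) = 0"
    using assms S p by (simp add: decomposition_on[of S] sum_subtractf)
  moreover have "\<forall>y\<in>S. f y - g y \<in> piece V y" using p by auto
  ultimately have "\<forall>y\<in>S. f y - g y = 0"
    using independent[of S "\<lambda>y. f y - g y"] S(1) by blast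
  then have "f y = g y" for y using S by (cases "y \<in> S") auto
  then show ?thesis by blast
qed

lemma decomposition_add:
  assumes "decomposition f u" "decomposition g v"
  shows "decomposition (\<lambda>y. f y + g y) (u + v)"
proof -
  define S where "S = {y. f y \<noteq> 0} \<union> {y. g y \<noteq> 0}"
  have S: "finite S" "\<And>y. y \<notin> S \<Longrightarrow> f y = 0" "\<And>y. y \<notin> S \<Longrightarrow> g y = 0"
    and p: "\<And>y. f y \<in> piece V y" "\<And>y. g y \<in> piece V y"
    using assms by (auto simp: S_def decomposition_def)
  have "decomposition (\<lambda>y. f y + g y) (u + v) \<longleftrightarrow> u + v = (\<Sum>y\<in>S. f y + g y)"
    by (rule decomposition_on) (use S p in auto)
  then show ?thesis
    using assms S p by (simp add: decomposition_on[of S] sum.distrib)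
qed

lemma decomposition_piece:
  assumes "X \<in> piece V x"
  shows "decomposition (\<lambda>y. if y = x then X else 0) X"
  using assms by (subst decomposition_on[where S = "{x}"]) auto

lemma decomposition_scale:
  assumes "decomposition f v"
  shows "decomposition (\<lambda>y. smul V c (f y)) (smul V c v)"
proof -
  have "decomposition (\<lambda>y. smul V c (f y)) (smul V c v) \<longleftrightarrow>
      smul V c v = (\<Sum>y | f y \<noteq> 0. smul V c (f y))"
    by (rule decomposition_on) (use assms in \<open>auto simp: decomposition_def\<close>)
  then show ?thesis
    using assms by (simp add: decomposition_def vs.scale_sum_right)
qed

lemma decomposition_exists: "v \<in> total V \<Longrightarrow> \<exists>f. decomposition f v"
  by (induction rule: total_induct) (blast intro: decomposition_piece decomposition_add)+

lemma hcomp_eq: "decomposition f v \<Longrightarrow> hcomp V y v = f y"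
  unfolding hcomp_def decomposition_def[symmetric]
  using the_equality[of "\<lambda>f. decomposition f v" f] decomposition_unique by metis

lemma decomposition_hcomp: "v \<in> total V \<Longrightarrow> decomposition (\<lambda>y. hcomp V y v) v"
  using decomposition_exists[of v] by (auto simp: hcomp_eq)

lemma hcomp_piece [simp, intro]: "v \<in> total V \<Longrightarrow> hcomp V y v \<in> piece V y"
  and finite_hcomp: "v \<in> total V \<Longrightarrow> finite {y. hcomp V y v \<noteq> 0}"
  using decomposition_hcomp by (auto simp: decomposition_def)

lemma hcomp_homogeneous: "X \<in> piece V x \<Longrightarrow> hcomp V y X = (if y = x then X else 0)"
  by (rule hcomp_eq[OF decomposition_piece])

lemma hcomp_add:
  "u \<in> total V \<Longrightarrow> v \<in> total V \<Longrightarrow> hcomp V y (u + v) = hcomp V y u + hcomp V y v"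
  by (rule hcomp_eq) (intro decomposition_add decomposition_hcomp)

lemma hcomp_smul: "v \<in> total V \<Longrightarrow> hcomp V y (smul V c v) = smul V c (hcomp V y v)"
  by (rule hcomp_eq) (intro decomposition_scale decomposition_hcomp)

lemma hcomp_0 [simp]: "hcomp V y 0 = 0"
  by (simp add: hcomp_homogeneous[of 0 y])

text \<open>
  In this way a function that is defined through the degree of an argument becomes linear in that
  argument.
\<close>
lemma linear_extension:
  assumes add: "\<And>x A B. A \<in> piece V x \<Longrightarrow> B \<in> piece V x \<Longrightarrow> f x (A + B) = f x A + f x B"
    and scale: "\<And>x c A. A \<in> piece V x \<Longrightarrow> f x (smul V c A) = smul V c (f x A)"
    and range: "\<And>x A. A \<in> piece V x \<Longrightarrow> f x A \<in> total V"
  shows "linear_total V V (\<lambda>v. \<Sum>x | hcomp V x v \<noteq> 0. f x (hcomp V x v))"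
proof -
  have f0: "f x 0 = 0" for x using scale[of 0 x 0] by simp
  let ?S = "\<lambda>v. {x. hcomp V x v \<noteq> 0}"
  have on: "(\<Sum>x | hcomp V x v \<noteq> 0. f x (hcomp V x v)) = (\<Sum>x\<in>S. f x (hcomp V x v))"
    if "finite S" "?S v \<subseteq> S" for S v
    using that by (intro sum.mono_neutral_left) (auto simp: f0)
  show ?thesis
    unfolding linear_total_def
  proof (intro conjI ballI allI)
    show "(\<lambda>v. \<Sum>x | hcomp V x v \<noteq> 0. f x (hcomp V x v)) \<in> total V \<rightarrow> total V"
      by (auto intro!: total_sum range)
  next
    fix u v assume uv: "u \<in> total V" "v \<in> total V"
    define S where "S = ?S u \<union> ?S v"
    have S: "finite S" "?S u \<subseteq> S" "?S v \<subseteq> S" "?S (u + v) \<subseteq> S"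
      using uv by (auto simp: S_def finite_hcomp hcomp_add)
    show "(\<Sum>x | hcomp V x (u + v) \<noteq> 0. f x (hcomp V x (u + v))) =
        (\<Sum>x | hcomp V x u \<noteq> 0. f x (hcomp V x u)) + (\<Sum>x | hcomp V x v \<noteq> 0. f x (hcomp V x v))"
      unfolding on[OF S(1) S(2)] on[OF S(1) S(3)] on[OF S(1) S(4)]
      using uv by (simp add: hcomp_add add sum.distrib)
  next
    fix c v assume v: "v \<in> total V"
    have S: "finite (?S v)" "?S (smul V c v) \<subseteq> ?S v"
      using v by (auto simp: finite_hcomp hcomp_smul)
    show "(\<Sum>x | hcomp V x (smul V c v) \<noteq> 0. f x (hcomp V x (smul V c v))) =
        smul V c (\<Sum>x | hcomp V x v \<noteq> 0. f x (hcomp V x v))"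
      unfolding on[OF S]
      using v by (simp add: hcomp_smul scale vs.scale_sum_right)
  qed
qed

end

context graded begin

section \<open>Functions of homogeneous arguments\<close>

definition homs :: "nat \<Rightarrow> (deg \<times> 'v) list set" where
  "homs m = {zs. length zs = m \<and> (\<forall>(x, X)\<in>set zs. X \<in> piece V x)}"

lemma homs_0 [simp]: "zs \<in> homs 0 \<longleftrightarrow> zs = []"
  by (auto simp: homs_def)

lemma Nil_homs [simp]: "[] \<in> homs m \<longleftrightarrow> m = 0"
  by (auto simp: homs_def)

lemma Cons_homs [simp]: "(x, X) # zs \<in> homs (Suc m) \<longleftrightarrow> X \<in> piece V x \<and> zs \<in> homs m"
  by (auto simp: homs_def)

lemma homs_Suc: "zs \<in> homs (Suc m) \<longleftrightarrow> (\<exists>x X ys. zs = (x, X) # ys \<and> X \<in> piece V x \<and> ys \<in> homs m)"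
  by (cases zs) (auto simp: homs_def)

lemma homs_length: "zs \<in> homs m \<Longrightarrow> length zs = m"
  by (simp add: homs_def)

text \<open>
  The functions that are linear in each of \<open>m\<close> homogeneous arguments and of degree \<open>\<kappa>\<close>.  The recursion
  fixes the first argument and adds its degree to \<open>\<kappa>\<close>; it is adapted to the operators below, which are
  defined by recursion on the argument list.
\<close>
primrec homlin :: "nat \<Rightarrow> deg \<Rightarrow> ((deg \<times> 'v) list \<Rightarrow> 'v) \<Rightarrow> bool" where
  "homlin 0 \<kappa> F \<longleftrightarrow> F [] \<in> piece V \<kappa>"
| "homlin (Suc m) \<kappa> F \<longleftrightarrow>
     (\<forall>x. \<forall>X\<in>piece V x. homlin m (\<kappa> + x) (\<lambda>zs. F ((x, X) # zs))) \<and>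
     (\<forall>x c. \<forall>A\<in>piece V x. \<forall>B\<in>piece V x. \<forall>zs\<in>homs m.
        F ((x, A + smul V c B) # zs) = F ((x, A) # zs) + smul V c (F ((x, B) # zs)))"

lemma homlin_cong: "(\<And>zs. zs \<in> homs m \<Longrightarrow> F zs = G zs) \<Longrightarrow> homlin m \<kappa> F = homlin m \<kappa> G"
proof (induction m arbitrary: \<kappa> F G)
  case (Suc m)
  have "homlin m (\<kappa> + x) (\<lambda>zs. F ((x, X) # zs)) = homlin m (\<kappa> + x) (\<lambda>zs. G ((x, X) # zs))"
    if "X \<in> piece V x" for x X
    by (rule Suc.IH) (use that Suc.prems in auto)
  then show ?case using Suc.prems[of "(x, X) # zs" for x X zs] by auto
qed simp

lemma homlin_Cons: "homlin (Suc m) \<kappa> F \<Longrightarrow> X \<in> piece V x \<Longrightarrow> homlin m (\<kappa> + x) (\<lambda>zs. F ((x, X) # zs))"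
  by simp

lemma homlin_first_add:
  assumes "homlin (Suc m) \<kappa> F" "A \<in> piece V x" "B \<in> piece V x" "zs \<in> homs m"
  shows "F ((x, A + B) # zs) = F ((x, A) # zs) + F ((x, B) # zs)"
proof -
  have "F ((x, A + smul V 1 B) # zs) = F ((x, A) # zs) + smul V 1 (F ((x, B) # zs))"
    using assms unfolding homlin.simps(2) by blast
  then show ?thesis by simp
qed

lemma homlin_first_smul:
  assumes "homlin (Suc m) \<kappa> F" "A \<in> piece V x" "zs \<in> homs m"
  shows "F ((x, smul V c A) # zs) = smul V c (F ((x, A) # zs))"
proof -
  have "F ((x, A + smul V (c - 1) A) # zs) = F ((x, A) # zs) + smul V (c - 1) (F ((x, A) # zs))"
    using assms unfolding homlin.simps(2) by blast
  then show ?thesis by (simp add: vs.scale_left_diff_distrib)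
qed

text \<open>
  Induction on the number of arguments: fixing the first one moves its degree into \<open>\<kappa>\<close>, and after
  all of them the recursion ends with a constant of degree \<open>\<kappa>\<close> plus the sum of the degrees.
\<close>
lemma homlin_piece:
  "homlin m \<kappa> F \<Longrightarrow> zs \<in> homs m \<Longrightarrow> F zs \<in> piece V (sum_list (map fst zs) + \<kappa>)"
proof (induction m arbitrary: \<kappa> F zs)
  case (Suc m)
  from Suc.prems(2) obtain x X ys where zs: "zs = (x, X) # ys" "X \<in> piece V x" "ys \<in> homs m"
    by (auto simp: homs_Suc)
  have "F zs \<in> piece V (sum_list (map fst ys) + (\<kappa> + x))"
    unfolding zs(1) by (rule Suc.IH) (use Suc.prems zs in auto)
  then show ?case by (simp add: zs ac_simps)
qed simp

lemma homlin_add: "homlin m \<kappa> F \<Longrightarrow> homlin m \<kappa> G \<Longrightarrow> homlin m \<kappa> (\<lambda>zs. F zs + G zs)"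
  by (induction m arbitrary: \<kappa> F G) (auto simp: algebra_simps vs.scale_right_distrib)

lemma homlin_smul: "homlin m \<kappa> F \<Longrightarrow> homlin m \<kappa> (\<lambda>zs. smul V c (F zs))"
  by (induction m arbitrary: \<kappa> F) (auto simp: vs.scale_right_distrib vs.scale_left_commute)

lemma homlin_sg: "homlin m \<kappa> F \<Longrightarrow> homlin m \<kappa> (\<lambda>zs. sg a (F zs))"
  by (induction m arbitrary: \<kappa> F) (auto simp: sg_add sg_smul)

lemma homlin_0: "homlin m \<kappa> (\<lambda>zs. 0)"
  by (induction m arbitrary: \<kappa>) auto

section \<open>Inserting an argument\<close>

text \<open>
  This is \<open>j(X) F\<close> for an element \<open>a = (x, X)\<close> of degree \<open>(-1, x)\<close>, up to the global sign \<open>(-1)\<^bsup>\<langle>x,\<kappa>\<rangle>\<^esup>\<close>: the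
  signed sum over all positions at which \<open>a\<close> can be inserted, each passed argument contributing its sign
  of transposition with \<open>a\<close>.
\<close>
primrec ins :: "deg \<times> 'v \<Rightarrow> (deg \<times> 'v) list \<Rightarrow> ((deg \<times> 'v) list \<Rightarrow> 'v) \<Rightarrow> 'v" where
  "ins a [] F = F [a]"
| "ins a (z # zs) F = F (a # z # zs) + sg (1 + ip n (fst a) (fst z)) (ins a zs (\<lambda>l. F (z # l)))"

lemma ins_cong:
  assumes "X \<in> piece V x" "zs \<in> homs m" "\<And>l. l \<in> homs (Suc m) \<Longrightarrow> F l = G l"
  shows "ins (x, X) zs F = ins (x, X) zs G"
  using assms(2,3)
proof (induction zs arbitrary: m F G)
  case Nil then show ?case using assms(1) by simp
next
  case (Cons z zs)
  from Cons.prems(1) obtain k y Y where z: "z = (y, Y)" "m = Suc k" "Y \<in> piece V y" "zs \<in> homs k"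
    by (cases m; cases z) auto
  have "ins (x, X) zs (\<lambda>l. F (z # l)) = ins (x, X) zs (\<lambda>l. G (z # l))"
    by (rule Cons.IH[OF z(4)]) (use z Cons.prems in auto)
  then show ?case using z assms(1) Cons.prems by simp
qed

lemma ins_add: "ins a zs (\<lambda>l. F l + G l) = ins a zs F + ins a zs G"
  by (induction zs arbitrary: F G) (auto simp: sg_add)

lemma ins_smul: "ins a zs (\<lambda>l. smul V c (F l)) = smul V c (ins a zs F)"
  by (induction zs arbitrary: F) (auto simp: sg_smul vs.scale_right_distrib)

lemma ins_sg: "ins a zs (\<lambda>l. sg c (F l)) = sg c (ins a zs F)"
  by (induction zs arbitrary: F) (auto simp: sg_sg sg_add add.commute)

lemma ins_0 [simp]: "ins a zs (\<lambda>l. 0) = 0"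
  by (induction zs) auto

lemma ins_eq_0: "(\<And>l. length l = Suc (length zs) \<Longrightarrow> F l = 0) \<Longrightarrow> ins a zs F = 0"
  by (induction zs arbitrary: F) auto

lemma ins_arg_linear:
  assumes "homlin (Suc m) \<kappa> F" "A \<in> piece V x" "B \<in> piece V x" "zs \<in> homs m"
  shows "ins (x, A + smul V c B) zs F = ins (x, A) zs F + smul V c (ins (x, B) zs F)"
  using assms(1,4)
proof (induction zs arbitrary: m \<kappa> F)
  case Nil then show ?case using assms(2,3) by auto
next
  case (Cons z zs)
  from Cons.prems(2) obtain k y Y where z: "z = (y, Y)" "m = Suc k" "Y \<in> piece V y" "zs \<in> homs k"
    by (cases m; cases z) auto
  have "ins (x, A + smul V c B) zs (\<lambda>l. F (z # l)) =
      ins (x, A) zs (\<lambda>l. F (z # l)) + smul V c (ins (x, B) zs (\<lambda>l. F (z # l)))"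
    by (rule Cons.IH[OF _ z(4), of "\<kappa> + y"]) (use z Cons.prems in auto)
  then show ?case
    using z assms(2,3) Cons.prems by (simp add: sg_add sg_smul vs.scale_right_distrib)
qed

text \<open>
  In the induction on the number of arguments, fixing the first argument \<open>z\<close> of \<open>ins a (z # zs) F\<close> leaves
  one term in which \<open>a\<close> stands before \<open>z\<close> and an insertion into the function \<open>F(z, \<dots>)\<close> of one argument less.
\<close>
lemma homlin_ins:
  assumes "homlin (Suc m) \<kappa> F" "X \<in> piece V x"
  shows "homlin m (\<kappa> + x) (\<lambda>zs. ins (x, X) zs F)"
  using assms(1)
proof (induction m arbitrary: \<kappa> F)
  case 0 then show ?case using assms(2) by auto
next
  case (Suc m)
  have 1: "homlin m (\<kappa> + x + y) (\<lambda>zs. ins (x, X) ((y, Y) # zs) F)" if Y: "Y \<in> piece V y" for y Y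
  proof -
    have "homlin m (\<kappa> + y + x) (\<lambda>zs. ins (x, X) zs (\<lambda>l. F ((y, Y) # l)))"
      by (rule Suc.IH) (use Suc.prems Y in auto)
    moreover have "homlin m (\<kappa> + x + y) (\<lambda>zs. F ((x, X) # (y, Y) # zs))"
      using Suc.prems Y assms(2) by auto
    ultimately show ?thesis by (auto intro!: homlin_add homlin_sg simp: ac_simps)
  qed
  have 2: "ins (x, X) zs (\<lambda>l. F ((y, A + smul V c B) # l)) =
      ins (x, X) zs (\<lambda>l. F ((y, A) # l)) + smul V c (ins (x, X) zs (\<lambda>l. F ((y, B) # l)))"
    if "A \<in> piece V y" "B \<in> piece V y" "zs \<in> homs m" for y c A B zs
    unfolding ins_smul[symmetric] ins_add[symmetric]
    by (rule ins_cong[OF assms(2) that(3)]) (use Suc.prems that in auto)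
  have 3: "homlin (Suc m) (\<kappa> + x) (\<lambda>zs. F ((x, X) # zs))"
    using Suc.prems assms(2) by (rule homlin_Cons)
  show ?case
    unfolding homlin.simps(2)
  proof (intro conjI allI ballI)
    fix y c A B zs assume "A \<in> piece V y" "B \<in> piece V y" "zs \<in> homs m"
    with 2 3 show "ins (x, X) ((y, A + smul V c B) # zs) F =
        ins (x, X) ((y, A) # zs) F + smul V c (ins (x, X) ((y, B) # zs) F)"
      by (simp add: sg_add sg_smul vs.scale_right_distrib)
  qed (use 1 in auto)
qed

text \<open>
  Insertions anticommute in the graded sense: every pair of positions occurs on both sides, and the
  two insertions differ by the sign of transposing \<open>a\<close> and \<open>b\<close>.
\<close>
lemma ins_ins:
  "ins a zs (\<lambda>l. ins b l F) = sg (1 + ip n (fst a) (fst b)) (ins b zs (\<lambda>l. ins a l F))"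
proof (induction zs arbitrary: F)
  case Nil
  show ?case by (simp add: sg_def ip_commute[of n "fst b" "fst a"])
next
  case (Cons z zs)
  have signs: "A + sg (1 + r) (B + sg (1 + t) C) + sg (1 + s) (D + sg (1 + t) (sg (1 + r) E)) =
      sg (1 + r) (B + sg (1 + r) (A + sg (1 + s) D) + sg (1 + t) (C + sg (1 + s) E))"
    for A B C D E :: 'v and r s t :: int
    by (cases "even r"; cases "even s"; cases "even t"; simp add: sg_def)
  show ?case
    unfolding ins.simps list.case ins_add ins_sg Cons.IH[of "\<lambda>l. F (z # l)"]
      ip_commute[of n "fst b" "fst a"]
    by (rule signs)
qed

definition alternating :: "nat \<Rightarrow> ((deg \<times> 'v) list \<Rightarrow> 'v) \<Rightarrow> bool" where
  "alternating m F \<longleftrightarrow> (\<forall>us a b vs. us @ a # b # vs \<in> homs m \<longrightarrow>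
     F (us @ a # b # vs) = sg (1 + ip n (fst a) (fst b)) (F (us @ b # a # vs)))"

lemma alternating_Cons:
  "alternating (Suc m) F \<Longrightarrow> X \<in> piece V x \<Longrightarrow> alternating m (\<lambda>zs. F ((x, X) # zs))"
  unfolding alternating_def
proof (intro allI impI)
  fix us a b vs
  assume A: "\<forall>us a b vs. us @ a # b # vs \<in> homs (Suc m) \<longrightarrow>
     F (us @ a # b # vs) = sg (1 + ip n (fst a) (fst b)) (F (us @ b # a # vs))"
    and "X \<in> piece V x" "us @ a # b # vs \<in> homs m"
  then show "F ((x, X) # us @ a # b # vs) = sg (1 + ip n (fst a) (fst b)) (F ((x, X) # us @ b # a # vs))"
    using A[rule_format, of "(x, X) # us" a b vs] by simp
qed

text \<open>
  Moving the inserted argument to the front restores exactly the sign with which it was inserted, so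
  all \<open>m + 1\<close> positions contribute the same value.
\<close>
lemma ins_alternating:
  assumes "alternating (Suc m) F" "X \<in> piece V x" "zs \<in> homs m"
  shows "ins (x, X) zs F = smul V (of_nat (Suc m)) (F ((x, X) # zs))"
  using assms(1,3)
proof (induction zs arbitrary: m F)
  case (Cons z zs)
  from Cons.prems(2) obtain k y Y where z: "z = (y, Y)" "m = Suc k" "Y \<in> piece V y" "zs \<in> homs k"
    by (cases m; cases z) auto
  have "ins (x, X) zs (\<lambda>l. F (z # l)) = smul V (of_nat (Suc k)) (F (z # (x, X) # zs))"
    by (rule Cons.IH) (use Cons.prems z in \<open>auto intro: alternating_Cons\<close>)
  moreover have "F ((x, X) # z # zs) = sg (1 + ip n x y) (F (z # (x, X) # zs))"
    using Cons.prems z assms(2) unfolding alternating_def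
    by (metis Cons_homs append_Nil fst_conv)
  moreover have "smul V (of_nat (Suc m)) v = v + smul V (of_nat m) v" for v
    by (simp add: vs.scale_left_distrib)
  ultimately show ?case
    by (simp add: z(1,2) sg_smul sg_sg sg_def del: of_nat_Suc)
qed simp

section \<open>The alternation sum\<close>

text \<open>
  The sum over all permutations of the arguments, with signs, built up by inserting the arguments one
  after the other.
\<close>
primrec altsum :: "(deg \<times> 'v) list \<Rightarrow> ((deg \<times> 'v) list \<Rightarrow> 'v) \<Rightarrow> 'v" where
  "altsum [] F = F []"
| "altsum (z # zs) F = altsum zs (\<lambda>l. ins z l F)"

lemma altsum_cong:
  assumes "zs \<in> homs m" "\<And>l. l \<in> homs m \<Longrightarrow> F l = G l"
  shows "altsum zs F = altsum zs G"
  using assms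
proof (induction zs arbitrary: m F G)
  case (Cons z zs)
  from Cons.prems(1) obtain k y Y where z: "z = (y, Y)" "m = Suc k" "Y \<in> piece V y" "zs \<in> homs k"
    by (cases m; cases z) auto
  have "altsum zs (\<lambda>l. ins z l F) = altsum zs (\<lambda>l. ins z l G)"
    by (rule Cons.IH[OF z(4)]) (use Cons.prems z in \<open>auto intro: ins_cong\<close>)
  then show ?case by simp
qed simp

lemma altsum_add: "altsum zs (\<lambda>l. F l + G l) = altsum zs F + altsum zs G"
  by (induction zs arbitrary: F G) (auto simp: ins_add)

lemma altsum_smul: "altsum zs (\<lambda>l. smul V c (F l)) = smul V c (altsum zs F)"
  by (induction zs arbitrary: F) (auto simp: ins_smul)

lemma altsum_sg: "altsum zs (\<lambda>l. sg c (F l)) = sg c (altsum zs F)"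
  by (induction zs arbitrary: F) (auto simp: ins_sg)

lemma altsum_0 [simp]: "altsum zs (\<lambda>l. 0) = 0"
  by (induction zs) auto

lemma homlin_altsum: "homlin m \<kappa> F \<Longrightarrow> homlin m \<kappa> (\<lambda>zs. altsum zs F)"
proof (induction m arbitrary: \<kappa> F)
  case (Suc m)
  show ?case
    unfolding homlin.simps(2)
  proof (intro conjI allI ballI)
    fix x X assume "X \<in> piece V x"
    then show "homlin m (\<kappa> + x) (\<lambda>zs. altsum ((x, X) # zs) F)"
      using Suc.IH[OF homlin_ins[OF Suc.prems]] by simp
  next
    fix x c A B zs assume AB: "A \<in> piece V x" "B \<in> piece V x" "zs \<in> homs m"
    show "altsum ((x, A + smul V c B) # zs) F =
        altsum ((x, A) # zs) F + smul V c (altsum ((x, B) # zs) F)"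
      unfolding altsum.simps altsum_smul[symmetric] altsum_add[symmetric]
      by (rule altsum_cong[OF AB(3)]) (use AB Suc.prems in \<open>auto intro: ins_arg_linear\<close>)
  qed
qed simp

text \<open>
  Two neighbouring arguments of the sum turn into two successive insertions, and these anticommute.
\<close>
lemma alternating_altsum: "alternating m (\<lambda>zs. altsum zs F)"
proof -
  have "altsum (us @ a # b # vs) F = sg (1 + ip n (fst a) (fst b)) (altsum (us @ b # a # vs) F)"
    for us a b vs
  proof (induction us arbitrary: F)
    case Nil
    show ?case
      unfolding append_Nil altsum.simps altsum_sg[symmetric]
      by (subst ins_ins) (simp only: ip_commute[of n "fst b" "fst a"])
  next
    case (Cons u us)
    show ?case unfolding append_Cons altsum.simps by (rule Cons.IH)
  qed
  then show ?thesis unfolding alternating_def by blast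
qed

text \<open>
  Each of the \<open>m\<close> insertions that build up the sum multiplies an alternating function by the number of
  positions available at that stage.
\<close>
lemma altsum_alternating:
  assumes "alternating m F" "zs \<in> homs m"
  shows "altsum zs F = smul V (fact m) (F zs)"
  using assms
proof (induction zs arbitrary: m F)
  case (Cons z zs)
  from Cons.prems(2) obtain k y Y where z: "z = (y, Y)" "m = Suc k" "Y \<in> piece V y" "zs \<in> homs k"
    by (cases m; cases z) auto
  have "altsum (z # zs) F = altsum zs (\<lambda>l. smul V (of_nat (Suc k)) (F (z # l)))"
    unfolding altsum.simps
    by (rule altsum_cong[OF z(4)]) (use Cons.prems z ins_alternating in auto)
  also have "\<dots> = smul V (of_nat (Suc k)) (smul V (fact k) (F (z # zs)))"
    unfolding altsum_smul using Cons.IH[OF alternating_Cons z(4)] Cons.prems z by auto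
  finally show ?case by (simp add: z(2))
qed simp

section \<open>Inserting a multilinear map\<close>

text \<open>
  The first \<open>p\<close> arguments are handed to \<open>F\<close>, and the value, which has the degree \<open>\<kappa>\<close> of \<open>F\<close> plus those of
  the consumed arguments, becomes the first argument of \<open>G\<close>.  Consuming one argument turns a map of degree
  \<open>\<kappa>\<close> into one of degree \<open>\<kappa> + x\<close>, which the recursion records.  The value at lists with less than \<open>p\<close>
  elements is \<open>0\<close>, so that \<open>plugsum\<close> below runs over those positions only at which \<open>F\<close> finds
  enough arguments.
\<close>
primrec plug :: "nat \<Rightarrow> deg \<Rightarrow> ((deg \<times> 'v) list \<Rightarrow> 'v) \<Rightarrow> ((deg \<times> 'v) list \<Rightarrow> 'v) \<Rightarrow>
    (deg \<times> 'v) list \<Rightarrow> 'v" where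
  "plug 0 \<kappa> F G zs = G ((\<kappa>, F []) # zs)"
| "plug (Suc p) \<kappa> F G zs =
     (case zs of [] \<Rightarrow> 0 | z # zs \<Rightarrow> plug p (\<kappa> + fst z) (\<lambda>l. F (z # l)) G zs)"

text \<open>
  This is \<open>j(F) G\<close> without its global sign \<open>(-1)\<^bsup>\<langle>\<kappa>,\<kappa>'\<rangle>\<^esup>\<close>, where \<open>\<kappa>'\<close> is the degree of \<open>G\<close>.  As \<open>F\<close> has
  \<open>p = k + 1\<close> arguments, the sign for passing an argument of degree \<open>x\<close>, namely \<open>(-1)\<^bsup>k + \<langle>\<kappa>,x\<rangle>\<^esup>\<close>, is
  written \<open>(-1)\<^bsup>p + 1 + \<langle>\<kappa>,x\<rangle>\<^esup>\<close>.
\<close>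
primrec plugsum :: "nat \<Rightarrow> deg \<Rightarrow> ((deg \<times> 'v) list \<Rightarrow> 'v) \<Rightarrow> (deg \<times> 'v) list \<Rightarrow>
    ((deg \<times> 'v) list \<Rightarrow> 'v) \<Rightarrow> 'v" where
  "plugsum p \<kappa> F [] G = plug p \<kappa> F G []"
| "plugsum p \<kappa> F (z # zs) G = plug p \<kappa> F G (z # zs) +
     sg (int p + 1 + ip n \<kappa> (fst z)) (plugsum p \<kappa> F zs (\<lambda>l. G (z # l)))"

lemma plug_short: "length zs < p \<Longrightarrow> plug p \<kappa> F G zs = 0"
  by (induction p arbitrary: \<kappa> F zs) (auto split: list.split)

lemma plugsum_short: "length zs < p \<Longrightarrow> plugsum p \<kappa> F zs G = 0"
  by (induction zs arbitrary: G) (auto simp: plug_short)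

lemma plug_cong_right:
  assumes "homlin p \<kappa> F" "zs \<in> homs (p + q)" "\<And>l. l \<in> homs (Suc q) \<Longrightarrow> G l = H l"
  shows "plug p \<kappa> F G zs = plug p \<kappa> F H zs"
  using assms(1,2)
proof (induction p arbitrary: \<kappa> F zs)
  case 0 then show ?case using assms(3) by simp
next
  case (Suc p) then show ?case by (auto simp: homs_Suc)
qed

lemma plug_linear_left:
  assumes "homlin p \<kappa> F" "homlin p \<kappa> F'" "homlin (Suc q) \<kappa>' G" "zs \<in> homs (p + q)"
  shows "plug p \<kappa> (\<lambda>l. F l + smul V c (F' l)) G zs = plug p \<kappa> F G zs + smul V c (plug p \<kappa> F' G zs)"
  using assms(1,2,4)
proof (induction p arbitrary: \<kappa> F F' zs)
  case 0 then show ?case using assms(3) by simp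
next
  case (Suc p) then show ?case by (auto simp: homs_Suc)
qed

lemma plug_cong_left:
  "(\<And>l. l \<in> homs p \<Longrightarrow> F l = F' l) \<Longrightarrow> zs \<in> homs (p + q) \<Longrightarrow> plug p \<kappa> F G zs = plug p \<kappa> F' G zs"
proof (induction p arbitrary: \<kappa> F F' zs)
  case (Suc p)
  from Suc.prems(2) obtain x X ys where zs: "zs = (x, X) # ys" "X \<in> piece V x" "ys \<in> homs (p + q)"
    by (auto simp: homs_Suc)
  show ?case unfolding zs plug.simps list.case
    by (rule Suc.IH) (use zs Suc.prems in auto)
qed simp

lemma homlin_plug:
  assumes "homlin p \<kappa> F" "homlin (Suc q) \<kappa>' G"
  shows "homlin (p + q) (\<kappa> + \<kappa>') (plug p \<kappa> F G)"
  using assms(1)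
proof (induction p arbitrary: \<kappa> F)
  case 0
  then have "homlin q (\<kappa>' + \<kappa>) (\<lambda>zs. G ((\<kappa>, F []) # zs))"
    using assms(2) by (intro homlin_Cons) auto
  then show ?case by (simp add: add.commute)
next
  case (Suc p)
  note F = homlin_Cons[OF Suc.prems]
  show ?case
    unfolding homlin.simps(2) add_Suc
  proof (intro conjI allI ballI)
    fix x X assume "X \<in> piece V x"
    from Suc.IH[OF F[OF this]]
    show "homlin (p + q) (\<kappa> + \<kappa>' + x) (\<lambda>zs. plug (Suc p) \<kappa> F G ((x, X) # zs))"
      by (simp add: ac_simps)
  next
    fix x c A B zs assume AB: "A \<in> piece V x" "B \<in> piece V x" "zs \<in> homs (p + q)"
    show "plug (Suc p) \<kappa> F G ((x, A + smul V c B) # zs) =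
        plug (Suc p) \<kappa> F G ((x, A) # zs) + smul V c (plug (Suc p) \<kappa> F G ((x, B) # zs))"
      using AB Suc.prems
      by (simp add: plug_linear_left[OF _ _ assms(2) AB(3), symmetric] del: plug.simps(1))
        (auto intro!: plug_cong_left)
  qed
qed

lemma plug_add_right: "plug p \<kappa> F (\<lambda>l. G l + H l) zs = plug p \<kappa> F G zs + plug p \<kappa> F H zs"
  by (induction p arbitrary: \<kappa> F zs) (auto split: list.split)

lemma plug_sg_right: "plug p \<kappa> F (\<lambda>l. sg c (G l)) zs = sg c (plug p \<kappa> F G zs)"
  by (induction p arbitrary: \<kappa> F zs) (auto split: list.split)

lemma plug_smul_right: "plug p \<kappa> F (\<lambda>l. smul V c (G l)) zs = smul V c (plug p \<kappa> F G zs)"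
  by (induction p arbitrary: \<kappa> F zs) (auto split: list.split)

lemma plugsum_add_right:
  "plugsum p \<kappa> F zs (\<lambda>l. G l + H l) = plugsum p \<kappa> F zs G + plugsum p \<kappa> F zs H"
  by (induction zs arbitrary: G H) (auto simp: plug_add_right sg_add)

lemma plugsum_sg_right: "plugsum p \<kappa> F zs (\<lambda>l. sg c (G l)) = sg c (plugsum p \<kappa> F zs G)"
  by (induction zs arbitrary: G) (auto simp: plug_sg_right sg_add sg_sg add.commute)

lemma plugsum_smul_right:
  "plugsum p \<kappa> F zs (\<lambda>l. smul V c (G l)) = smul V c (plugsum p \<kappa> F zs G)"
  by (induction zs arbitrary: G) (auto simp: plug_smul_right sg_smul vs.scale_right_distrib)

lemma plugsum_cong_right:
  assumes "homlin p \<kappa> F" "zs \<in> homs (p + q)" "\<And>l. l \<in> homs (Suc q) \<Longrightarrow> G l = H l"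
  shows "plugsum p \<kappa> F zs G = plugsum p \<kappa> F zs H"
  using assms(2,3)
proof (induction zs arbitrary: q G H)
  case Nil
  then show ?case using plug_cong_right[OF assms(1) Nil] by simp
next
  case (Cons z zs)
  have "plugsum p \<kappa> F zs (\<lambda>l. G (z # l)) = plugsum p \<kappa> F zs (\<lambda>l. H (z # l))"
  proof (cases q)
    case 0
    then show ?thesis using Cons.prems(1) by (auto simp: homs_def plugsum_short)
  next
    case (Suc k)
    show ?thesis
      by (rule Cons.IH[of k]) (use Cons.prems in \<open>auto simp: Suc homs_Suc\<close>)
  qed
  then show ?case using plug_cong_right[OF assms(1) Cons.prems] by simp
qed

lemma plugsum_cong_left:
  assumes "\<And>l. l \<in> homs p \<Longrightarrow> F l = F' l" "zs \<in> homs (p + q)"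
  shows "plugsum p \<kappa> F zs G = plugsum p \<kappa> F' zs G"
  using assms(2)
proof (induction zs arbitrary: q G)
  case Nil
  then show ?case using plug_cong_left[OF assms(1) Nil] by simp
next
  case (Cons z zs)
  have "plugsum p \<kappa> F zs (\<lambda>l. G (z # l)) = plugsum p \<kappa> F' zs (\<lambda>l. G (z # l))"
  proof (cases q)
    case 0
    then show ?thesis using Cons.prems(1) by (auto simp: homs_def plugsum_short)
  next
    case (Suc k)
    show ?thesis
      by (rule Cons.IH[of k]) (use Cons.prems in \<open>auto simp: Suc homs_Suc\<close>)
  qed
  then show ?case using plug_cong_left[OF assms(1) Cons.prems] by simp
qed

lemma plugsum_linear_left:
  assumes "homlin p \<kappa> F" "homlin p \<kappa> F'" "homlin (Suc q) \<kappa>' G" "zs \<in> homs (p + q)"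
  shows "plugsum p \<kappa> (\<lambda>l. F l + smul V c (F' l)) zs G =
    plugsum p \<kappa> F zs G + smul V c (plugsum p \<kappa> F' zs G)"
  using assms(3,4)
proof (induction zs arbitrary: q \<kappa>' G)
  case Nil
  then show ?case using plug_linear_left[OF assms(1,2) Nil] by simp
next
  case (Cons z zs)
  have "plugsum p \<kappa> (\<lambda>l. F l + smul V c (F' l)) zs (\<lambda>l. G (z # l)) =
      plugsum p \<kappa> F zs (\<lambda>l. G (z # l)) + smul V c (plugsum p \<kappa> F' zs (\<lambda>l. G (z # l)))"
  proof (cases q)
    case 0
    then show ?thesis using Cons.prems(2) by (auto simp: homs_def plugsum_short)
  next
    case (Suc k)
    show ?thesis
      by (rule Cons.IH[of k "\<kappa>' + fst z"]) (use Cons.prems in \<open>auto simp: Suc homs_Suc\<close>)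
  qed
  then show ?case
    using plug_linear_left[OF assms(1,2) Cons.prems]
    by (simp add: sg_add sg_smul vs.scale_right_distrib)
qed

lemma plugsum_smul_left:
  assumes "homlin p \<kappa> F" "homlin (Suc q) \<kappa>' G" "zs \<in> homs (p + q)"
  shows "plugsum p \<kappa> (\<lambda>l. smul V c (F l)) zs G = smul V c (plugsum p \<kappa> F zs G)"
  using plugsum_linear_left[OF assms(1,1,2,3), of "c - 1"] by (simp add: vs.scale_left_diff_distrib)

lemma homlin_plugsum:
  assumes "homlin p \<kappa> F" "homlin (Suc q) \<kappa>' G"
  shows "homlin (p + q) (\<kappa> + \<kappa>') (\<lambda>zs. plugsum p \<kappa> F zs G)"
  using assms(2)
proof (induction q arbitrary: \<kappa>' G)
  case 0
  have "plugsum p \<kappa> F zs G = plug p \<kappa> F G zs" if "zs \<in> homs (p + 0)" for zs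
    using that by (cases zs) (auto simp: homs_def plugsum_short)
  then have "homlin (p + 0) (\<kappa> + \<kappa>') (\<lambda>zs. plugsum p \<kappa> F zs G) =
      homlin (p + 0) (\<kappa> + \<kappa>') (plug p \<kappa> F G)"
    by (rule homlin_cong)
  then show ?case using homlin_plug[OF assms(1) 0] by blast
next
  case (Suc q)
  note plug = homlin_plug[OF assms(1) Suc.prems]
  show ?case
    unfolding homlin.simps(2) add_Suc_right
  proof (intro conjI allI ballI)
    fix x X assume X: "X \<in> piece V x"
    have "homlin (p + q) (\<kappa> + (\<kappa>' + x)) (\<lambda>zs. plugsum p \<kappa> F zs (\<lambda>l. G ((x, X) # l)))"
      by (rule Suc.IH) (use Suc.prems X in auto)
    then show "homlin (p + q) (\<kappa> + \<kappa>' + x) (\<lambda>zs. plugsum p \<kappa> F ((x, X) # zs) G)"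
      using plug X by (auto intro!: homlin_add homlin_sg simp: add.assoc)
  next
    fix x c A B zs assume AB: "A \<in> piece V x" "B \<in> piece V x" "zs \<in> homs (p + q)"
    have "plugsum p \<kappa> F zs (\<lambda>l. G ((x, A + smul V c B) # l)) =
        plugsum p \<kappa> F zs (\<lambda>l. G ((x, A) # l)) + smul V c (plugsum p \<kappa> F zs (\<lambda>l. G ((x, B) # l)))"
      unfolding plugsum_smul_right[symmetric] plugsum_add_right[symmetric]
      by (rule plugsum_cong_right[OF assms(1) AB(3)]) (use AB Suc.prems in auto)
    then show "plugsum p \<kappa> F ((x, A + smul V c B) # zs) G =
        plugsum p \<kappa> F ((x, A) # zs) G + smul V c (plugsum p \<kappa> F ((x, B) # zs) G)"
      using plug AB by (simp add: sg_add sg_smul vs.scale_right_distrib)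
  qed
qed

text \<open>
  The Leibniz rule for one fixed position of \<open>F\<close>, in front of the remaining arguments: \<open>X\<close> is inserted
  either among the arguments of \<open>F\<close> or behind them.  In the second case \<open>X\<close> runs over all positions in \<open>G\<close>
  except the first one, which accounts for the difference on the right.  Passing the value of \<open>F\<close>
  instead of its \<open>p\<close> arguments costs the sign in front of it.
\<close>
lemma ins_plug:
  assumes "homlin p \<kappa> F" "homlin (Suc q) \<kappa>' G" "X \<in> piece V x"
    and "zs \<in> homs k" "p + q = Suc k"
  shows "ins (x, X) zs (plug p \<kappa> F G) =
     (if p = 0 then 0 else plug (p - 1) (\<kappa> + x) (\<lambda>l. ins (x, X) l F) G zs)
     + sg (int p + 1 + ip n \<kappa> x)
         (plug p \<kappa> F (\<lambda>l. ins (x, X) l G) zs - plug p \<kappa> F (\<lambda>l. G ((x, X) # l)) zs)"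
  using assms(1,4,5)
proof (induction p arbitrary: \<kappa> F zs k)
  case 0
  show ?case
    by (simp add: sg_diff sg_add sg_sg ip_commute[of n x]) (simp add: sg_def)
next
  case (Suc p)
  show ?case
  proof (cases zs)
    case Nil
    then show ?thesis using Suc.prems by simp
  next
    case (Cons z ys)
    then obtain y Y j where z: "z = (y, Y)" "Y \<in> piece V y" "k = Suc j" "ys \<in> homs j"
      using Suc.prems(2) by (cases k; cases z) auto
    define a where "a = (x, X)"
    have Fz: "homlin p (\<kappa> + y) (\<lambda>l. F (z # l))"
      using Suc.prems(1) z by auto
    have IH: "ins a ys (plug p (\<kappa> + y) (\<lambda>l. F (z # l)) G) =
       (if p = 0 then 0 else plug (p - 1) (\<kappa> + y + x) (\<lambda>l. ins a l (\<lambda>l. F (z # l))) G ys)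
     + sg (int p + 1 + ip n (\<kappa> + y) x)
         (plug p (\<kappa> + y) (\<lambda>l. F (z # l)) (\<lambda>l. ins a l G) ys
          - plug p (\<kappa> + y) (\<lambda>l. F (z # l)) (\<lambda>l. G (a # l)) ys)"
      unfolding a_def by (rule Suc.IH) (use Fz z Suc.prems in auto)
    have inner: "plug p (\<kappa> + x) (\<lambda>l. ins a l F) G (z # ys) =
        plug p (\<kappa> + x) (\<lambda>l. F (a # l)) G (z # ys) +
        sg (1 + ip n x y)
          (if p = 0 then 0 else plug (p - 1) (\<kappa> + y + x) (\<lambda>l. ins a l (\<lambda>l. F (z # l))) G ys)"
    proof (cases p)
      case 0 then show ?thesis by (simp add: a_def)
    next
      case (Suc r)
      have r: "ys \<in> homs (r + q)" using z Suc.prems Suc by simp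
      have h1: "homlin r (\<kappa> + x + y) (\<lambda>l. F (a # z # l))"
        using Suc.prems(1) z(1,2) assms(3) Suc by (simp add: a_def)
      have h2: "homlin r (\<kappa> + x + y) (\<lambda>l. ins a l (\<lambda>l. F (z # l)))"
        using homlin_ins[of r "\<kappa> + y" "\<lambda>l. F (z # l)" X x] Fz assms(3) Suc
        by (simp add: a_def ac_simps)
      show ?thesis
        using plug_linear_left[OF h1 h2 assms(2) r, of "(-1) powi (1 + ip n x y)"]
        by (simp add: Suc z(1) a_def smul_sign ac_simps)
    qed
    have signs: "A + sg (1 + r) (B + sg (P + 1 + (t + r)) (C - D)) =
        A + sg (1 + r) B + sg (P + 1 + 1 + t) (C - D)"
      for A B C D :: 'v and P r t :: int
      by (cases "even P"; cases "even r"; cases "even t"; simp add: sg_def)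
    have "ins a zs (plug (Suc p) \<kappa> F G) =
        plug p (\<kappa> + x) (\<lambda>l. F (a # l)) G (z # ys)
        + sg (1 + ip n x y) (ins a ys (plug p (\<kappa> + y) (\<lambda>l. F (z # l)) G))"
      by (simp add: Cons z(1) a_def)
    also have "\<dots> = plug p (\<kappa> + x) (\<lambda>l. ins a l F) G (z # ys)
        + sg (int p + 1 + 1 + ip n \<kappa> x)
         (plug p (\<kappa> + y) (\<lambda>l. F (z # l)) (\<lambda>l. ins a l G) ys
          - plug p (\<kappa> + y) (\<lambda>l. F (z # l)) (\<lambda>l. G (a # l)) ys)"
      unfolding IH inner ip_add_left ip_commute[of n y x] by (rule signs)
    finally show ?thesis
      by (simp add: Cons z(1) a_def add.commute)
  qed
qed

text \<open>
  The Leibniz rule \<open>j(X) j(F) G = j(j(X) F) G \<plusminus> j(F) j(X) G\<close>.  The positions of \<open>X\<close> directly in front of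
  \<open>F\<close>, which are subtracted in \<open>ins_plug\<close>, are those in which the recursion of \<open>plugsum\<close> has just passed \<open>X\<close>
  itself.
\<close>
lemma ins_plugsum:
  assumes "homlin p \<kappa> F" "homlin (Suc q) \<kappa>' G" "X \<in> piece V x"
    and "zs \<in> homs k" "p + q = Suc k"
  shows "ins (x, X) zs (\<lambda>l. plugsum p \<kappa> F l G) =
     (if p = 0 then 0 else plugsum (p - 1) (\<kappa> + x) (\<lambda>l. ins (x, X) l F) zs G)
     + sg (int p + 1 + ip n \<kappa> x) (plugsum p \<kappa> F zs (\<lambda>l. ins (x, X) l G))"
  using assms(2,4,5)
proof (induction zs arbitrary: q k \<kappa>' G)
  case Nil
  show ?case
    using ins_plug[OF assms(1) Nil.prems(1) assms(3) Nil.prems(2,3)]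
    by (simp add: sg_diff)
next
  case (Cons z zs)
  from Cons.prems(2) obtain j y Y where z: "z = (y, Y)" "k = Suc j" "Y \<in> piece V y" "zs \<in> homs j"
    by (cases k; cases z) auto
  define a where "a = (x, X)"
  have IH: "ins a zs (\<lambda>l. plugsum p \<kappa> F l (\<lambda>l. G (z # l))) =
     (if p = 0 then 0 else plugsum (p - 1) (\<kappa> + x) (\<lambda>l. ins a l F) zs (\<lambda>l. G (z # l)))
     + sg (int p + 1 + ip n \<kappa> x) (plugsum p \<kappa> F zs (\<lambda>l. ins a l (\<lambda>l. G (z # l))))"
  proof (cases q)
    case 0
    have "length zs = j" using z by (simp add: homs_length)
    then show ?thesis
      using Cons.prems(3) z(2) 0 by (auto simp: plugsum_short intro: ins_eq_0)
  next
    case (Suc r)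
    show ?thesis
      unfolding a_def
      by (rule Cons.IH[of r "\<kappa>' + y" _ j]) (use Cons.prems z Suc in auto)
  qed
  note step = ins_plug[OF assms(1) Cons.prems(1) assms(3) Cons.prems(2,3), folded a_def]
  have "ins a (z # zs) (\<lambda>l. plugsum p \<kappa> F l G) =
      (plug p \<kappa> F G (a # z # zs) + sg (1 + ip n x y) (ins a zs (\<lambda>l. plug p \<kappa> F G (z # l))))
      + sg (int p + 1 + ip n \<kappa> x) (plug p \<kappa> F (\<lambda>l. G (a # l)) (z # zs)
        + sg (int p + 1 + ip n \<kappa> y) (plugsum p \<kappa> F zs (\<lambda>l. G (a # z # l))))
      + sg (int p + ip n x y + ip n \<kappa> y) (ins a zs (\<lambda>l. plugsum p \<kappa> F l (\<lambda>l. G (z # l))))"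
    by (simp add: z(1) a_def ins_add ins_sg)
      (cases "even p"; cases "even (ip n \<kappa> y)"; cases "even (ip n x y)"; simp add: sg_def)
  also have "plug p \<kappa> F G (a # z # zs) + sg (1 + ip n x y) (ins a zs (\<lambda>l. plug p \<kappa> F G (z # l))) =
      (if p = 0 then 0 else plug (p - 1) (\<kappa> + x) (\<lambda>l. ins a l F) G (z # zs))
      + sg (int p + 1 + ip n \<kappa> x)
          (plug p \<kappa> F (\<lambda>l. ins a l G) (z # zs) - plug p \<kappa> F (\<lambda>l. G (a # l)) (z # zs))"
    using step by (simp add: z(1) a_def)
  also note IH
  finally have lhs: "ins a (z # zs) (\<lambda>l. plugsum p \<kappa> F l G) =
     (if p = 0 then 0 else plug (p - 1) (\<kappa> + x) (\<lambda>l. ins a l F) G (z # zs))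
     + sg (int p + 1 + ip n \<kappa> x)
         (plug p \<kappa> F (\<lambda>l. ins a l G) (z # zs) - plug p \<kappa> F (\<lambda>l. G (a # l)) (z # zs))
     + sg (int p + 1 + ip n \<kappa> x) (plug p \<kappa> F (\<lambda>l. G (a # l)) (z # zs)
         + sg (int p + 1 + ip n \<kappa> y) (plugsum p \<kappa> F zs (\<lambda>l. G (a # z # l))))
     + sg (int p + ip n x y + ip n \<kappa> y)
         ((if p = 0 then 0 else plugsum (p - 1) (\<kappa> + x) (\<lambda>l. ins a l F) zs (\<lambda>l. G (z # l)))
          + sg (int p + 1 + ip n \<kappa> x) (plugsum p \<kappa> F zs (\<lambda>l. ins a l (\<lambda>l. G (z # l)))))" .
  have rhs1: "(if p = 0 then 0 else plugsum (p - 1) (\<kappa> + x) (\<lambda>l. ins a l F) (z # zs) G) =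
      (if p = 0 then 0 else plug (p - 1) (\<kappa> + x) (\<lambda>l. ins a l F) G (z # zs))
      + sg (int p + ip n x y + ip n \<kappa> y)
        (if p = 0 then 0 else plugsum (p - 1) (\<kappa> + x) (\<lambda>l. ins a l F) zs (\<lambda>l. G (z # l)))"
    by (cases p) (auto simp: z(1) ip_add_left intro: sg_cong)
  have rhs2: "plugsum p \<kappa> F (z # zs) (\<lambda>l. ins a l G) =
      plug p \<kappa> F (\<lambda>l. ins a l G) (z # zs)
      + sg (int p + 1 + ip n \<kappa> y) (plugsum p \<kappa> F zs (\<lambda>l. G (a # z # l))
        + sg (1 + ip n x y) (plugsum p \<kappa> F zs (\<lambda>l. ins a l (\<lambda>l. G (z # l)))))"
    by (simp add: z(1) a_def plugsum_add_right plugsum_sg_right)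
  \<comment> \<open>with the terms generalized to arbitrary vectors only the parities of the exponents matter\<close>
  have signs: "T + sg (P + 1 + s) (A - B) + sg (P + 1 + s) (B + sg (P + 1 + t) C)
      + sg (P + r + t) (D + sg (P + 1 + s) E) =
      T + sg (P + r + t) D + sg (P + 1 + s) (A + sg (P + 1 + t) (C + sg (1 + r) E))"
    for T A B C D E :: 'v and P r s t :: int
    by (cases "even P"; cases "even r"; cases "even s"; cases "even t"; simp add: sg_def)
  show ?case
    unfolding a_def[symmetric] lhs rhs1 rhs2 by (rule signs)
qed

end

section \<open>The alternation sum as a sum over permutations\<close>

text \<open>
  The permutation of \<open>{0, \<dots>, m}\<close> that takes \<open>0\<close> to position \<open>p\<close> and arranges the other elements as \<open>\<tau>\<close> does.
\<close>
definition cycle_perm :: "nat \<Rightarrow> (nat \<Rightarrow> nat) \<Rightarrow> nat \<Rightarrow> nat" where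
  "cycle_perm p \<tau> i = (if i < p then Suc (\<tau> i) else if i = p then 0 else Suc (\<tau> (i - 1)))"

lemma cycle_perm_permutes:
  assumes "\<tau> permutes {..<m}" "p \<le> m"
  shows "cycle_perm p \<tau> permutes {..<Suc m}"
proof (rule bij_imp_permutes)
  have lt: "\<tau> i < m \<longleftrightarrow> i < m" for i
    using permutes_in_image[OF assms(1)] by simp
  have inj: "\<tau> i = \<tau> j \<longleftrightarrow> i = j" for i j
    using permutes_inj[OF assms(1)] by (simp add: inj_eq)
  have "inj_on (cycle_perm p \<tau>) {..<Suc m}"
    by (rule inj_onI) (auto simp: cycle_perm_def inj split: if_splits)
  moreover have "cycle_perm p \<tau> ` {..<Suc m} \<subseteq> {..<Suc m}"
    using assms(2) by (auto simp: cycle_perm_def lt)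
  ultimately show "bij_betw (cycle_perm p \<tau>) {..<Suc m} {..<Suc m}"
    by (simp add: bij_betw_def endo_inj_surj)
next
  fix i assume "i \<notin> {..<Suc m}"
  then show "cycle_perm p \<tau> i = i"
    using assms permutes_not_in[OF assms(1), of "i - 1"] by (simp add: cycle_perm_def)
qed

text \<open>
  The position \<open>p\<close> is where the permutation vanishes, and removing it leaves \<open>\<tau>\<close>; surjectivity then
  follows by counting, as \<open>(m + 1) \<cdot> m! = (m + 1)!\<close>.
\<close>
lemma bij_cycle_perm:
  "bij_betw (\<lambda>(p, \<tau>). cycle_perm p \<tau>) ({..m} \<times> {\<tau>. \<tau> permutes {..<m}}) {\<sigma>. \<sigma> permutes {..<Suc m}}"
proof -
  let ?A = "{..m} \<times> {\<tau>. \<tau> permutes {..<m}}" and ?f = "\<lambda>(p, \<tau>). cycle_perm p \<tau>"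
  have inj: "inj_on ?f ?A"
  proof (rule inj_onI, clarify)
    fix p q \<tau> \<rho> assume eq: "cycle_perm p \<tau> = cycle_perm q \<rho>"
    have z: "cycle_perm r \<sigma> i = 0 \<longleftrightarrow> i = r" for r \<sigma> i
      by (simp add: cycle_perm_def)
    have pq: "p = q" using z[of p \<tau> p] z[of q \<rho> p] eq by simp
    have "\<tau> i = \<rho> i" for i
    proof (cases "i < p")
      case True
      then show ?thesis using fun_cong[OF eq, of i] pq by (simp add: cycle_perm_def)
    next
      case False
      then show ?thesis using fun_cong[OF eq, of "Suc i"] pq by (simp add: cycle_perm_def)
    qed
    with pq show "p = q \<and> \<tau> = \<rho>" by blast
  qed
  have sub: "?f ` ?A \<subseteq> {\<sigma>. \<sigma> permutes {..<Suc m}}"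
    using cycle_perm_permutes by auto
  have "card (?f ` ?A) = card {\<sigma>. \<sigma> permutes {..<Suc m}}"
    by (simp add: card_image[OF inj] card_cartesian_product card_permutations[of _ m]
        card_permutations[of _ "Suc m"])
  then have "?f ` ?A = {\<sigma>. \<sigma> permutes {..<Suc m}}"
    using sub by (intro card_subset_eq) (auto simp: finite_permutations)
  with inj show ?thesis by (simp add: bij_betw_def)
qed

lemma permute_list_cycle_perm:
  assumes "\<tau> permutes {..<length zs}" "p \<le> length zs"
  shows "permute_list (cycle_perm p \<tau>) (z # zs) =
    take p (permute_list \<tau> zs) @ z # drop p (permute_list \<tau> zs)"
proof (rule nth_equalityI)
  fix i assume "i < length (permute_list (cycle_perm p \<tau>) (z # zs))"
  then have i: "i < Suc (length zs)" by simp
  have "permute_list (cycle_perm p \<tau>) (z # zs) ! i = (z # zs) ! cycle_perm p \<tau> i"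
    using i by (intro permute_list_nth) (use cycle_perm_permutes[OF assms] in auto)
  moreover have "permute_list \<tau> zs ! j = zs ! \<tau> j" if "j < length zs" for j
    using that assms(1) by (intro permute_list_nth) auto
  ultimately show "permute_list (cycle_perm p \<tau>) (z # zs) ! i =
      (take p (permute_list \<tau> zs) @ z # drop p (permute_list \<tau> zs)) ! i"
    using i assms(2) by (auto simp: cycle_perm_def nth_append nth_Cons' min_def)
qed (use assms in auto)

text \<open>
  The inversions of the composed permutation are those of \<open>\<tau>\<close>, shifted, together with the pairs formed by
  the position \<open>p\<close> of the smallest element and the positions in front of it.
\<close>
lemma msign_cycle_perm:
  assumes "\<tau> permutes {..<length xs}" "p \<le> length xs"
  shows "(msign n (cycle_perm p \<tau>) (x # xs) :: 'k::field_char_0) =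
    (\<Prod>i<p. - ((-1) powi ip n (xs ! \<tau> i) x)) * msign n \<tau> xs"
proof -
  \<comment> \<open>the increasing enumeration of all positions other than \<open>p\<close>\<close>
  define s where "s i = (if i < p then i else Suc i)" for i
  let ?P = "\<lambda>\<sigma> m. {(i::nat, j). i < j \<and> j < m \<and> \<sigma> i > (\<sigma> j :: nat)}"
  let ?c = "cycle_perm p \<tau>"
  let ?t = "\<lambda>(i, j). - ((-1) powi ip n ((x # xs) ! ?c i) ((x # xs) ! ?c j)) :: 'k"
  have fin: "finite (?P \<sigma> m)" for \<sigma> m
    by (rule finite_subset[of _ "{..<m} \<times> {..<m}"]) auto
  have cs: "?c (s i) = Suc (\<tau> i)" for i
    by (simp add: s_def cycle_perm_def)
  have cp: "?c p = 0" by (simp add: cycle_perm_def)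
  have s_less: "s i < s j \<longleftrightarrow> i < j" for i j by (auto simp: s_def)
  have s_bound: "s i < Suc (length xs) \<longleftrightarrow> i < length xs" for i
    using assms(2) by (auto simp: s_def)
  have s_p: "s i \<noteq> p" for i by (auto simp: s_def)
  have s_surj: "i = p \<or> (\<exists>j. i = s j)" for i
    using s_def[of i] s_def[of "i - 1"] by (metis Suc_pred' gr_zeroI less_Suc_eq not_less_eq nat_neq_iff)
  have inj: "inj_on (map_prod s s) A" for A
    by (rule inj_onI) (auto simp: s_def split: if_splits)
  have "?P ?c (Suc (length xs)) = (\<lambda>i. (i, p)) ` {..<p} \<union> map_prod s s ` ?P \<tau> (length xs)"
  proof (intro set_eqI iffI; clarify)
    fix i j assume A: "i < j" "j < Suc (length xs)" "?c j < ?c i"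
      and B: "(i, j) \<notin> map_prod s s ` ?P \<tau> (length xs)"
    have "i \<noteq> p" using A(3) cp by auto
    then obtain i' where i': "i = s i'" using s_surj by blast
    have "j = p"
    proof (rule ccontr)
      assume "j \<noteq> p"
      then obtain j' where j': "j = s j'" using s_surj by blast
      have "(i', j') \<in> ?P \<tau> (length xs)"
        using A unfolding i' j' s_less s_bound cs by simp
      then have "map_prod s s (i', j') \<in> map_prod s s ` ?P \<tau> (length xs)" by (rule imageI)
      with B i' j' show False by simp
    qed
    with A show "(i, j) \<in> (\<lambda>i. (i, p)) ` {..<p}" by auto
  next
    fix i j assume "(i, j) \<in> (\<lambda>i. (i, p)) ` {..<p} \<union> map_prod s s ` ?P \<tau> (length xs)"
    then show "i < j \<and> j < Suc (length xs) \<and> ?c j < ?c i"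
    proof
      assume "(i, j) \<in> (\<lambda>i. (i, p)) ` {..<p}"
      then show ?thesis using assms(2) cp by (auto simp: cycle_perm_def)
    next
      assume "(i, j) \<in> map_prod s s ` ?P \<tau> (length xs)"
      then show ?thesis by (auto simp: s_less s_bound cs)
    qed
  qed
  moreover have "(\<lambda>i. (i, p)) ` {..<p} \<inter> map_prod s s ` ?P \<tau> (length xs) = {}"
    using s_p by auto
  ultimately have "msign n ?c (x # xs) =
      prod ?t ((\<lambda>i. (i, p)) ` {..<p}) * prod ?t (map_prod s s ` ?P \<tau> (length xs))"
    unfolding msign_def using fin[of "length xs" \<tau>] by (simp add: prod.union_disjoint)
  also have "prod ?t ((\<lambda>i. (i, p)) ` {..<p}) = (\<Prod>i<p. - ((-1) powi ip n (xs ! \<tau> i) x))"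
    by (subst prod.reindex) (auto simp: inj_on_def cp cycle_perm_def intro!: prod.cong)
  also have "prod ?t (map_prod s s ` ?P \<tau> (length xs)) = msign n \<tau> xs"
    unfolding msign_def by (subst prod.reindex[OF inj]) (auto simp: cs intro!: prod.cong)
  finally show ?thesis .
qed

context graded begin

lemma ins_as_sum:
  "ins z l F = (\<Sum>p\<le>length l.
     smul V (\<Prod>i<p. - ((-1) powi ip n (fst (l ! i)) (fst z))) (F (take p l @ z # drop p l)))"
proof (induction l arbitrary: F)
  case (Cons y l)
  have c: "sg (1 + ip n (fst z) (fst y)) v = smul V (- ((-1) powi ip n (fst y) (fst z))) v" for v
    by (simp add: vs.scale_minus_left smul_sign ip_commute[of n "fst y"]) (simp add: sg_def)
  show ?case
    unfolding ins.simps Cons.IH list.size add_0_right add_Suc_right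
    by (subst sum.atMost_Suc_shift)
      (simp add: c prod.lessThan_Suc_shift vs.scale_sum_right del: prod.lessThan_Suc)
qed simp

text \<open>
  The permutations of \<open>z # zs\<close> are sorted by the position of \<open>z\<close>: they arise from the permutations of \<open>zs\<close>
  by the insertion of \<open>z\<close>.
\<close>
lemma altsum_eq_permutations:
  "altsum zs F = (\<Sum>\<sigma> | \<sigma> permutes {..<length zs}.
     smul V (msign n \<sigma> (map fst zs)) (F (permute_list \<sigma> zs)))"
proof (induction zs arbitrary: F)
  case Nil
  have "{\<sigma>. \<sigma> permutes ({} :: nat set)} = {id}" by auto
  then show ?case by (simp add: msign_def)
next
  case (Cons z zs)
  let ?m = "length zs" and ?S = "{\<tau>. \<tau> permutes {..<length zs}}"
  let ?g = "\<lambda>\<sigma>. smul V (msign n \<sigma> (map fst (z # zs))) (F (permute_list \<sigma> (z # zs)))"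
  have summand: "?g (cycle_perm p \<tau>) =
      smul V (msign n \<tau> (map fst zs))
        (smul V (\<Prod>i<p. - ((-1) powi ip n (fst (permute_list \<tau> zs ! i)) (fst z)))
        (F (take p (permute_list \<tau> zs) @ z # drop p (permute_list \<tau> zs))))"
    if "p \<le> ?m" "\<tau> permutes {..<?m}" for p \<tau>
  proof -
    have "(\<Prod>i<p. - ((-1) powi ip n (fst (permute_list \<tau> zs ! i)) (fst z)) :: 'k) =
        (\<Prod>i<p. - ((-1) powi ip n (map fst zs ! \<tau> i) (fst z)))"
    proof (rule prod.cong)
      fix i assume "i \<in> {..<p}"
      then have "i < ?m" "\<tau> i < ?m" using that permutes_in_image[OF that(2), of i] by auto
      then show "- ((-1) powi ip n (fst (permute_list \<tau> zs ! i)) (fst z)) =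
          (- ((-1) powi ip n (map fst zs ! \<tau> i) (fst z)) :: 'k)"
        using that by (simp add: permute_list_nth)
    qed simp
    then show ?thesis
      using that msign_cycle_perm[where \<tau> = \<tau> and xs = "map fst zs" and p = p and n = n and x = "fst z" and 'k = 'k]
        permute_list_cycle_perm[where \<tau> = \<tau> and zs = zs and p = p and z = z]
      by (simp add: mult.commute)
  qed
  have "altsum (z # zs) F = (\<Sum>\<tau>\<in>?S. smul V (msign n \<tau> (map fst zs)) (ins z (permute_list \<tau> zs) F))"
    by (simp add: Cons.IH)
  also have "\<dots> = (\<Sum>\<tau>\<in>?S. \<Sum>p\<le>?m. ?g (cycle_perm p \<tau>))"
    by (intro sum.cong refl) (simp add: ins_as_sum vs.scale_sum_right summand del: list.map)
  also have "\<dots> = (\<Sum>(p, \<tau>)\<in>{..?m} \<times> ?S. ?g (cycle_perm p \<tau>))"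
    by (subst sum.swap) (simp add: sum.cartesian_product)
  also have "\<dots> = (\<Sum>\<sigma> | \<sigma> permutes {..<Suc ?m}. ?g \<sigma>)"
    by (subst sum.reindex_bij_betw[OF bij_cycle_perm, symmetric]) (simp add: case_prod_beta)
  finally show ?case by simp
qed

lemma plug_eq:
  "p \<le> length zs \<Longrightarrow> plug p \<kappa> F G zs =
     G ((sum_list (map fst (take p zs)) + \<kappa>, F (take p zs)) # drop p zs)"
proof (induction p arbitrary: \<kappa> F zs)
  case (Suc p)
  then show ?case by (cases zs) (auto simp: ac_simps)
qed simp

lemma plugsum_eq_sum:
  "length zs = p + q \<Longrightarrow> plugsum p \<kappa> F zs G =
     (\<Sum>i\<le>q. sg ((int p + 1) * int i + ip n \<kappa> (sum_list (map fst (take i zs))))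
        (plug p \<kappa> F (\<lambda>l. G (take i zs @ l)) (drop i zs)))"
proof (induction q arbitrary: zs G)
  case 0
  then show ?case by (cases zs) (auto simp: plugsum_short)
next
  case (Suc q)
  then obtain z ys where zs: "zs = z # ys" "length ys = p + q" by (cases zs) auto
  show ?case
    unfolding zs(1) plugsum.simps Suc.IH[OF zs(2)]
    by (subst sum.atMost_Suc_shift)
      (simp add: sg_sum sg_sg ip_add_right algebra_simps)
qed

section \<open>The composition of alternating functions\<close>

text \<open>
  This is \<open>i(F) G\<close>.  The factor \<open>1/(p + q - 1)!\<close> of the alternator has been cancelled against the numerator
  of the coefficient of \<open>i\<close>.
\<close>
definition circ :: "nat \<Rightarrow> deg \<Rightarrow> ((deg \<times> 'v) list \<Rightarrow> 'v) \<Rightarrow> nat \<Rightarrow> deg \<Rightarrow>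
    ((deg \<times> 'v) list \<Rightarrow> 'v) \<Rightarrow> (deg \<times> 'v) list \<Rightarrow> 'v" where
  "circ p \<kappa> F q \<kappa>' G zs =
     smul V (1 / (fact p * fact q)) (sg (ip n \<kappa> \<kappa>') (altsum zs (\<lambda>l. plugsum p \<kappa> F l G)))"

text \<open>
  The Leibniz rule for \<open>i(F) G\<close>.  The first argument \<open>X\<close> of an alternation sum is inserted into \<open>j(F) G\<close>
  before the alternation, so the rule for \<open>j\<close> applies.  As \<open>F\<close> and \<open>G\<close> are alternating, \<open>j(X) F\<close> and \<open>j(X) G\<close>
  are the contractions times \<open>p\<close> and \<open>q + 1\<close>, and these factors turn \<open>p!\<close> and \<open>(q + 1)!\<close> into the
  factorials for the contracted maps.  A summand is missing when the map to be contracted would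
  fall into degree \<open>-2\<close> or, on the right of \<open>i\<close>, into degree \<open>-1\<close>.
\<close>
lemma circ_Cons:
  assumes F: "homlin p \<kappa> F" "alternating p F"
    and G: "homlin (Suc q) \<kappa>' G" "alternating (Suc q) G"
    and X: "X \<in> piece V x" and zs: "zs \<in> homs k" "p + q = Suc k"
  shows "circ p \<kappa> F (Suc q) \<kappa>' G ((x, X) # zs) =
     (if p = 0 then 0
      else sg (ip n x \<kappa>') (circ (p - 1) (\<kappa> + x) (\<lambda>l. F ((x, X) # l)) (Suc q) \<kappa>' G zs))
     + (if q = 0 then 0
        else sg (int p + 1) (circ p \<kappa> F q (\<kappa>' + x) (\<lambda>l. G ((x, X) # l)) zs))"
proof -
  define a where "a = (x, X)"
  let ?J1 = "\<lambda>l. plugsum (p - 1) (\<kappa> + x) (\<lambda>l. F (a # l)) l G"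
  let ?J2 = "\<lambda>l. plugsum p \<kappa> F l (\<lambda>l. G (a # l))"
  have 1: "(if p = 0 then 0 else plugsum (p - 1) (\<kappa> + x) (\<lambda>l. ins a l F) l G) =
      smul V (of_nat p) (?J1 l)" if l: "l \<in> homs k" for l
  proof (cases p)
    case 0 then show ?thesis by simp
  next
    case (Suc r)
    have lr: "l \<in> homs (r + q)" using l zs(2) Suc by simp
    have Fa: "homlin r (\<kappa> + x) (\<lambda>l. F (a # l))" using F X Suc by (simp add: a_def)
    have "ins a l F = smul V (of_nat (Suc r)) (F (a # l))" if "l \<in> homs r" for l
      unfolding a_def by (rule ins_alternating) (use F X that Suc in auto)
    then have "plugsum r (\<kappa> + x) (\<lambda>l. ins a l F) l G =
        plugsum r (\<kappa> + x) (\<lambda>l. smul V (of_nat (Suc r)) (F (a # l))) l G"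
      by (rule plugsum_cong_left[OF _ lr])
    then show ?thesis
      using plugsum_smul_left[OF Fa G(1) lr] Suc by simp
  qed
  have 2: "plugsum p \<kappa> F l (\<lambda>l. ins a l G) = (if q = 0 then 0 else smul V (of_nat (Suc q)) (?J2 l))"
    if l: "l \<in> homs k" for l
  proof (cases q)
    case 0
    then show ?thesis using l zs(2) by (simp add: plugsum_short homs_length)
  next
    case (Suc r)
    have "ins a l G = smul V (of_nat (Suc q)) (G (a # l))" if "l \<in> homs q" for l
      unfolding a_def by (rule ins_alternating) (use G X that in auto)
    then have "plugsum p \<kappa> F l (\<lambda>l. ins a l G) =
        plugsum p \<kappa> F l (\<lambda>l. smul V (of_nat (Suc q)) (G (a # l)))"
      using l zs(2) Suc by (intro plugsum_cong_right[OF F(1), of _ r]) auto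
    then show ?thesis using Suc by (simp add: plugsum_smul_right)
  qed
  have "altsum (a # zs) (\<lambda>l. plugsum p \<kappa> F l G) =
      altsum zs (\<lambda>l. smul V (of_nat p) (?J1 l) + sg (int p + 1 + ip n \<kappa> x)
        (if q = 0 then 0 else smul V (of_nat (Suc q)) (?J2 l)))"
    unfolding altsum.simps
  proof (rule altsum_cong[OF zs(1)])
    fix l assume l: "l \<in> homs k"
    show "ins a l (\<lambda>l. plugsum p \<kappa> F l G) = smul V (of_nat p) (?J1 l) +
        sg (int p + 1 + ip n \<kappa> x) (if q = 0 then 0 else smul V (of_nat (Suc q)) (?J2 l))"
      using ins_plugsum[OF F(1) G(1) X l zs(2), folded a_def]
      unfolding 1[OF l] 2[OF l] .
  qed
  also have "\<dots> = smul V (of_nat p) (altsum zs ?J1) + sg (int p + 1 + ip n \<kappa> x)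
      (if q = 0 then 0 else smul V (of_nat (Suc q)) (altsum zs ?J2))"
    by (simp add: altsum_add altsum_smul altsum_sg del: of_nat_Suc)
  finally have A: "altsum (a # zs) (\<lambda>l. plugsum p \<kappa> F l G) = \<dots>" .
  have c1: "smul V (1 / (fact p * fact (Suc q))) (smul V (of_nat p) v) =
      smul V (1 / (fact (p - 1) * fact (Suc q))) v" if "p \<noteq> 0" for v
    using that by (cases p) (simp_all add: field_simps del: of_nat_Suc)
  have c2: "smul V (1 / (fact p * fact (Suc q))) (smul V (of_nat (Suc q)) v) =
      smul V (1 / (fact p * fact q)) v" for v
    by (simp add: field_simps del: of_nat_Suc)
  have s1: "sg (ip n x \<kappa>') (sg (ip n (\<kappa> + x) \<kappa>') v) = sg (ip n \<kappa> \<kappa>') v"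
    and s2: "sg (int p + 1) (sg (ip n \<kappa> (\<kappa>' + x)) v) =
      sg (ip n \<kappa> \<kappa>') (sg (int p + 1 + ip n \<kappa> x) v)" for v :: 'v
    by (auto simp: sg_def ip_add_left ip_add_right)
  show ?thesis
  proof (cases "p = 0"; cases "q = 0")
    assume "p = 0" "q = 0"
    then show ?thesis using zs(2) by simp
  next
    assume p: "p = 0" and q: "q \<noteq> 0"
    have p0: "smul V (of_nat p) v = 0" for v by (simp add: p)
    show ?thesis
      unfolding circ_def a_def[symmetric] A if_P[OF p] if_not_P[OF q]
      by (simp only: p0 sg_smul c2 s2 add_0_left)
  next
    assume p: "p \<noteq> 0" and q: "q = 0"
    show ?thesis
      unfolding circ_def a_def[symmetric] A if_not_P[OF p] if_P[OF q]
      by (simp only: sg_smul c1[OF p] s1 add_0_right sg_zero)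
  next
    assume p: "p \<noteq> 0" and q: "q \<noteq> 0"
    show ?thesis
      unfolding circ_def a_def[symmetric] A if_not_P[OF p] if_not_P[OF q]
      by (simp only: sg_smul sg_add vs.scale_right_distrib c1[OF p] c2 s1 s2)
  qed
qed

lemma alternating_smul: "alternating m F \<Longrightarrow> alternating m (\<lambda>zs. smul V c (F zs))"
  unfolding alternating_def sg_smul by metis

lemma alternating_sg: "alternating m F \<Longrightarrow> alternating m (\<lambda>zs. sg c (F zs))"
  using alternating_smul[of m F "(-1) powi c"] by (simp only: smul_sign)

lemma alternating_circ: "alternating m (circ p \<kappa> F q \<kappa>' G)"
  unfolding circ_def by (intro alternating_smul alternating_sg alternating_altsum)

end

section \<open>Multilinear maps and their homogeneous values\<close>

lemma linear_total_0:
  fixes V :: "('k::field_char_0, 'v::ab_group_add, 'z) graded_vs_scheme"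
    and W :: "('k, 'w::ab_group_add, 'y) graded_vs_scheme"
  assumes "linear_total V W f" "vector_space (smul V)" "vector_space (smul W)"
  shows "f 0 = 0"
proof -
  interpret V: vector_space "smul V" by fact
  interpret W: vector_space "smul W" by fact
  have "0 \<in> total V" unfolding total_def by (rule V.span_zero)
  then have "f (smul V 0 0) = smul W 0 (f 0)"
    using assms(1) unfolding linear_total_def by blast
  then show ?thesis by simp
qed

lemma (in graded) linear_total_cong:
  assumes "linear_total V W f" "\<And>X. X \<in> total V \<Longrightarrow> f X = g X"
  shows "linear_total V W g"
  using assms by (auto simp: linear_total_def Pi_iff total_add total_scale)

locale graded_ground = graded n V
  for n :: nat and V :: "('k::field_char_0, 'v::ab_group_add) graded_vs"
begin

lemma linear_total_V_0: "linear_total V V f \<Longrightarrow> f 0 = 0"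
  by (erule linear_total_0) (rule vs.vector_space_axioms)+

lemma args_0: "Xs \<in> args V 0 \<longleftrightarrow> Xs = []"
  by (auto simp: args_def)

lemma args_Suc:
  "Xs \<in> args V (Suc m) \<longleftrightarrow> (\<exists>X Ys. Xs = X # Ys \<and> X \<in> total V \<and> Ys \<in> args V m)"
  by (cases Xs) (auto simp: args_def)

lemma args_Cons [simp]: "X # Xs \<in> args V (Suc m) \<longleftrightarrow> X \<in> total V \<and> Xs \<in> args V m"
  by (auto simp: args_Suc)

lemma map_snd_args: "zs \<in> homs m \<Longrightarrow> map snd zs \<in> args V m"
  by (force simp: homs_def args_def)

lemma multilinear_0_iff:
  "multilinear V 0 K \<longleftrightarrow> K [] \<in> total V \<and> (\<forall>Xs. Xs \<noteq> [] \<longrightarrow> K Xs = 0)"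
  by (auto simp: multilinear_def args_0)

text \<open>
  Currying turns induction over the arity of a multilinear map into the elimination of one
  argument at a time.
\<close>
lemma multilinear_Suc_iff:
  "multilinear V (Suc m) K \<longleftrightarrow> (\<forall>Xs. Xs \<notin> args V (Suc m) \<longrightarrow> K Xs = 0) \<and>
     (\<forall>X\<in>total V. multilinear V m (\<lambda>Xs. K (X # Xs))) \<and>
     (\<forall>Xs\<in>args V m. linear_total V V (\<lambda>X. K (X # Xs)))" (is "?L \<longleftrightarrow> ?R")
proof
  assume L: ?L
  have 1: "linear_total V V (\<lambda>Y. K ((X # Xs)[i := Y]))"
    if "X \<in> total V" "Xs \<in> args V m" "i < Suc m" for X Xs i
  proof -
    have "X # Xs \<in> args V (Suc m)" using that by simp
    then show ?thesis using L that(3) unfolding multilinear_def by blast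
  qed
  show ?R
  proof (intro conjI allI ballI impI)
    fix Xs assume "Xs \<notin> args V (Suc m)"
    then show "K Xs = 0" using L by (simp add: multilinear_def)
  next
    fix X assume X: "X \<in> total V"
    show "multilinear V m (\<lambda>Xs. K (X # Xs))"
      unfolding multilinear_def
    proof (intro conjI allI ballI impI)
      fix Xs i assume "Xs \<in> args V m" "i < m"
      then show "linear_total V V (\<lambda>Y. K (X # Xs[i := Y]))"
        using 1[OF X, of Xs "Suc i"] by simp
    qed (use L X in \<open>auto simp: multilinear_def\<close>)
  next
    fix Xs assume "Xs \<in> args V m"
    then show "linear_total V V (\<lambda>X. K (X # Xs))"
      using 1[of 0 Xs 0] by simp
  qed
next
  assume R: ?R
  show ?L
    unfolding multilinear_def
  proof (intro conjI allI ballI impI)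
    fix Xs assume "Xs \<notin> args V (Suc m)"
    then show "K Xs = 0" using R by blast
  next
    fix Xs assume "Xs \<in> args V (Suc m)"
    then show "K Xs \<in> total V"
      using R by (auto simp: args_Suc multilinear_def)
  next
    fix Xs i assume Xs: "Xs \<in> args V (Suc m)" and i: "i < Suc m"
    then obtain X Ys where X: "Xs = X # Ys" "X \<in> total V" "Ys \<in> args V m"
      by (auto simp: args_Suc)
    show "linear_total V V (\<lambda>X. K (Xs[i := X]))"
    proof (cases i)
      case 0
      then show ?thesis using R X by simp
    next
      case (Suc j)
      then show ?thesis using R X i by (auto simp: multilinear_def)
    qed
  qed
qed

text \<open>
  Both sides are additive in each argument, and \<open>V\<close> is spanned by its homogeneous elements.
\<close>
lemma multilinear_eqI:
  assumes "multilinear V m K" "multilinear V m L"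
    and "\<And>zs. zs \<in> homs m \<Longrightarrow> K (map snd zs) = L (map snd zs)"
  shows "K = L"
  using assms
proof (induction m arbitrary: K L)
  case 0
  show ?case
  proof
    fix Xs show "K Xs = L Xs"
      using 0 by (cases "Xs = []") (auto simp: multilinear_0_iff)
  qed
next
  case (Suc m)
  have "(\<lambda>Xs. K (X # Xs)) = (\<lambda>Xs. L (X # Xs))" if "X \<in> total V" for X
    using that
  proof (induction rule: total_induct)
    case (piece x X)
    show ?case
    proof (rule Suc.IH)
      fix zs assume "zs \<in> homs m"
      then show "K (X # map snd zs) = L (X # map snd zs)"
        using Suc.prems(3)[of "(x, X) # zs"] piece by simp
    qed (use Suc.prems piece in \<open>auto simp: multilinear_Suc_iff\<close>)
  next
    case (add u v)
    show ?case
    proof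
      fix Xs
      show "K ((u + v) # Xs) = L ((u + v) # Xs)"
      proof (cases "Xs \<in> args V m")
        case True
        then show ?thesis
          using add Suc.prems(1,2) by (simp add: multilinear_Suc_iff linear_total_def fun_eq_iff)
      next
        case False
        then show ?thesis using Suc.prems(1,2) by (simp add: multilinear_Suc_iff)
      qed
    qed
  qed
  then have "K (X # Xs) = L (X # Xs)" if "X \<in> total V" for X Xs
    using that by metis
  moreover have "K Xs = L Xs" if "Xs \<notin> args V (Suc m)" for Xs
    using that Suc.prems(1,2) by (simp add: multilinear_def)
  ultimately have "K Xs = L Xs" for Xs
    by (cases "Xs \<in> args V (Suc m)") (auto simp: args_Suc)
  then show ?case by blast
qed

text \<open>
  The operators of the previous sections depend on the degrees of the arguments, which are
  therefore carried along in the argument list.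
\<close>
abbreviation tagged :: "('v list \<Rightarrow> 'v) \<Rightarrow> (deg \<times> 'v) list \<Rightarrow> 'v" where
  "tagged K zs \<equiv> K (map snd zs)"

definition mlin :: "nat \<Rightarrow> deg \<Rightarrow> ('v list \<Rightarrow> 'v) set" where
  "mlin m \<kappa> = {K. multilinear V m K \<and> homlin m \<kappa> (tagged K)}"

lemma multilinear_zero_arg:
  assumes "multilinear V m K" "0 \<in> set Xs"
  shows "K Xs = 0"
proof (cases "Xs \<in> args V m")
  case True
  obtain i where i: "i < length Xs" "Xs ! i = 0"
    using assms(2) by (auto simp: in_set_conv_nth)
  then have "linear_total V V (\<lambda>X. K (Xs[i := X]))"
    using assms(1) True by (auto simp: multilinear_def args_def)
  from linear_total_V_0[OF this] i show ?thesis by (metis list_update_id)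
qed (use assms in \<open>simp add: multilinear_def\<close>)

lemma homlin_multilinear:
  assumes "multilinear V m K"
    and "\<And>zs. zs \<in> homs m \<Longrightarrow> tagged K zs \<in> piece V (sum_list (map fst zs) + \<kappa>)"
  shows "homlin m \<kappa> (tagged K)"
  using assms
proof (induction m arbitrary: K \<kappa>)
  case 0
  then show ?case by simp
next
  case (Suc m)
  show ?case
    unfolding homlin.simps(2)
  proof (intro conjI allI ballI)
    fix x X assume X: "X \<in> piece V x"
    have "homlin m (\<kappa> + x) (tagged (\<lambda>Xs. K (X # Xs)))"
    proof (rule Suc.IH)
      fix zs assume "zs \<in> homs m"
      then show "K (X # map snd zs) \<in> piece V (sum_list (map fst zs) + (\<kappa> + x))"
        using Suc.prems(2)[of "(x, X) # zs"] X by (simp add: ac_simps)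
    qed (use Suc.prems(1) X in \<open>auto simp: multilinear_Suc_iff\<close>)
    then show "homlin m (\<kappa> + x) (\<lambda>zs. tagged K ((x, X) # zs))" by simp
  next
    fix x c A B zs assume "A \<in> piece V x" "B \<in> piece V x" "zs \<in> homs m"
    then show "tagged K ((x, A + smul V c B) # zs) =
        tagged K ((x, A) # zs) + smul V c (tagged K ((x, B) # zs))"
      using Suc.prems(1) map_snd_args[of zs m]
      by (simp add: multilinear_Suc_iff linear_total_def piece_total[of _ x])
  qed
qed

text \<open>
  The condition on degrees is imposed in \<^const>\<open>Mpiece\<close> for arguments of degrees in \<open>\<int>\<^sup>n\<close>.  For other degrees
  one of the arguments is \<open>0\<close>, and so is the value.
\<close>
lemma Mpiece_eq:
  assumes "- 1 \<le> k"
  shows "Mpiece n V k \<kappa> = mlin (nat (k + 1)) \<kappa>"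
proof -
  let ?m = "nat (k + 1)"
  have tag: "(\<exists>zs\<in>homs ?m. xs = map fst zs \<and> Xs = map snd zs) \<longleftrightarrow>
      length xs = ?m \<and> list_all2 (\<lambda>x X. X \<in> piece V x) xs Xs" for xs Xs
  proof
    assume "length xs = ?m \<and> list_all2 (\<lambda>x X. X \<in> piece V x) xs Xs"
    then show "\<exists>zs\<in>homs ?m. xs = map fst zs \<and> Xs = map snd zs"
      by (intro bexI[of _ "zip xs Xs"]) (auto simp: homs_def list_all2_iff)
  qed (auto simp: homs_def list_all2_conv_all_nth)
  have "(\<forall>xs Xs. length xs = ?m \<and> set xs \<subseteq> Zn n \<and> list_all2 (\<lambda>x X. X \<in> piece V x) xs Xs \<longrightarrow>
        K Xs \<in> piece V (sum_list xs + \<kappa>)) \<longleftrightarrow> homlin ?m \<kappa> (tagged K)"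
    if K: "multilinear V ?m K" for K
  proof
    assume A: "\<forall>xs Xs. length xs = ?m \<and> set xs \<subseteq> Zn n \<and> list_all2 (\<lambda>x X. X \<in> piece V x) xs Xs \<longrightarrow>
        K Xs \<in> piece V (sum_list xs + \<kappa>)"
    show "homlin ?m \<kappa> (tagged K)"
    proof (rule homlin_multilinear[OF K])
      fix zs assume zs: "zs \<in> homs ?m"
      show "tagged K zs \<in> piece V (sum_list (map fst zs) + \<kappa>)"
      proof (cases "set (map fst zs) \<subseteq> Zn n")
        case True
        then show ?thesis using A tag zs by blast
      next
        case False
        then have "0 \<in> set (map snd zs)"
          using zs piece_outside by (force simp: homs_def)
        then show ?thesis by (simp only: multilinear_zero_arg[OF K] piece_0)
      qed
    qed
  next
    assume "homlin ?m \<kappa> (tagged K)"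
    then show "\<forall>xs Xs. length xs = ?m \<and> set xs \<subseteq> Zn n \<and> list_all2 (\<lambda>x X. X \<in> piece V x) xs Xs \<longrightarrow>
        K Xs \<in> piece V (sum_list xs + \<kappa>)"
      using homlin_piece tag by metis
  qed
  then show ?thesis using assms by (auto simp: Mpiece_def mlin_def)
qed

lemma mlin_eqI:
  "K \<in> mlin m \<kappa> \<Longrightarrow> L \<in> mlin m \<kappa>' \<Longrightarrow> (\<And>zs. zs \<in> homs m \<Longrightarrow> tagged K zs = tagged L zs) \<Longrightarrow> K = L"
  using multilinear_eqI by (auto simp: mlin_def)

lemma mlin_homlin: "K \<in> mlin m \<kappa> \<Longrightarrow> homlin m \<kappa> (tagged K)"
  by (simp add: mlin_def)

lemma linear_total_add:
  "linear_total V V f \<Longrightarrow> linear_total V V g \<Longrightarrow> linear_total V V (\<lambda>X. f X + g X)"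
  by (auto simp: linear_total_def vs.scale_right_distrib algebra_simps)

lemma linear_total_smul: "linear_total V V f \<Longrightarrow> linear_total V V (\<lambda>X. smul V c (f X))"
  by (auto simp: linear_total_def vs.scale_right_distrib vs.scale_left_commute)

lemma linear_total_zero: "linear_total V V (\<lambda>X. 0)"
  by (auto simp: linear_total_def)

lemma multilinear_add:
  "multilinear V m K \<Longrightarrow> multilinear V m L \<Longrightarrow> multilinear V m (\<lambda>Xs. K Xs + L Xs)"
  by (auto simp: multilinear_def linear_total_add)

lemma multilinear_smul: "multilinear V m K \<Longrightarrow> multilinear V m (\<lambda>Xs. smul V c (K Xs))"
  by (auto simp: multilinear_def linear_total_smul)

lemma multilinear_zero: "multilinear V m (\<lambda>Xs. 0)"
  by (auto simp: multilinear_def linear_total_zero)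

lemma multilinear_sum:
  "finite S \<Longrightarrow> (\<And>x. x \<in> S \<Longrightarrow> multilinear V m (K x)) \<Longrightarrow> multilinear V m (\<lambda>Xs. \<Sum>x\<in>S. K x Xs)"
  by (induction S rule: finite_induct) (auto intro: multilinear_zero multilinear_add)

definition extend :: "nat \<Rightarrow> ((deg \<times> 'v) list \<Rightarrow> 'v) \<Rightarrow> 'v list \<Rightarrow> 'v" where
  "extend m F = hom_extend V m (\<lambda>xs Xs. F (zip xs Xs))"

lemma hom_extend_extend:
  assumes "\<And>zs. zs \<in> homs m \<Longrightarrow> f (map fst zs) (map snd zs) = F zs"
  shows "hom_extend V m f = extend m F"
proof
  fix Xs
  show "hom_extend V m f Xs = extend m F Xs"
    unfolding extend_def hom_extend_def
  proof (intro if_cong refl sum.cong)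
    fix xs assume Xs: "Xs \<in> args V m"
      and "xs \<in> {xs. length xs = m \<and> (\<forall>i<m. hcomp V (xs ! i) (Xs ! i) \<noteq> 0)}"
    then have l: "length xs = m" "length Xs = m" by (auto simp: args_def)
    have "zip xs (map2 (hcomp V) xs Xs) \<in> homs m"
      using Xs l by (auto simp: homs_def args_def set_zip subset_iff)
    from assms[OF this] l
    show "f xs (map2 (hcomp V) xs Xs) = F (zip xs (map2 (hcomp V) xs Xs))" by simp
  qed
qed

lemma extend_outside: "Xs \<notin> args V m \<Longrightarrow> extend m F Xs = 0"
  by (simp add: extend_def hom_extend_def)

lemma extend_0: "extend 0 F [] = F []"
  by (simp add: extend_def hom_extend_def args_0)

text \<open>
  The lists of degrees that index the sum in \<^const>\<open>hom_extend\<close> are split into head and tail, so that the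
  extension can be studied one argument at a time.
\<close>
lemma extend_Cons:
  assumes "X \<in> total V"
  shows "extend (Suc m) F (X # Xs) =
    (\<Sum>x | hcomp V x X \<noteq> 0. extend m (\<lambda>zs. F ((x, hcomp V x X) # zs)) Xs)"
proof (cases "Xs \<in> args V m")
  case True
  let ?A = "{x. hcomp V x X \<noteq> 0}"
  let ?B = "{xs. length xs = m \<and> (\<forall>i<m. hcomp V (xs ! i) (Xs ! i) \<noteq> 0)}"
  have set: "{xs. length xs = Suc m \<and> (\<forall>i<Suc m. hcomp V (xs ! i) ((X # Xs) ! i) \<noteq> 0)} =
      (\<lambda>(x, xs). x # xs) ` (?A \<times> ?B)"
  proof (intro set_eqI iffI)
    fix xs assume xs: "xs \<in> {xs. length xs = Suc m \<and> (\<forall>i<Suc m. hcomp V (xs ! i) ((X # Xs) ! i) \<noteq> 0)}"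
    then obtain y ys where y: "xs = y # ys" by (cases xs) auto
    have "y \<in> ?A" using xs y by force
    moreover have "ys \<in> ?B" using xs y by force
    ultimately show "xs \<in> (\<lambda>(x, xs). x # xs) ` (?A \<times> ?B)" using y by auto
  qed (auto simp: nth_Cons' less_Suc_eq_0_disj)
  have "extend (Suc m) F (X # Xs) = (\<Sum>(x, xs)\<in>?A \<times> ?B.
      F ((x, hcomp V x X) # zip xs (map2 (hcomp V) xs Xs)))"
    using True assms unfolding extend_def hom_extend_def set
    by (subst sum.reindex) (auto simp: inj_on_def intro!: sum.cong)
  then show ?thesis
    using True by (simp add: extend_def hom_extend_def sum.cartesian_product)
qed (use assms in \<open>simp add: extend_outside\<close>)

lemma extend_cong: "(\<And>zs. zs \<in> homs m \<Longrightarrow> F zs = G zs) \<Longrightarrow> extend m F = extend m G"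
  using hom_extend_extend[of m "\<lambda>xs Xs. G (zip xs Xs)" F]
  by (simp add: extend_def zip_map_fst_snd)

lemma extend_add: "extend m (\<lambda>zs. F zs + G zs) Xs = extend m F Xs + extend m G Xs"
  by (simp add: extend_def hom_extend_def sum.distrib)

lemma extend_smul: "extend m (\<lambda>zs. smul V c (F zs)) Xs = smul V c (extend m F Xs)"
  by (simp add: extend_def hom_extend_def vs.scale_sum_right)

lemma extend_multilinear:
  assumes "homlin m \<kappa> F"
  shows "multilinear V m (extend m F)"
  using assms
proof (induction m arbitrary: \<kappa> F)
  case 0
  then show ?case by (auto simp: multilinear_0_iff extend_0 extend_outside args_0)
next
  case (Suc m)
  have IH: "multilinear V m (extend m (\<lambda>zs. F ((x, A) # zs)))" if "A \<in> piece V x" for x A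
    by (rule Suc.IH) (use Suc.prems that in auto)
  show ?case
    unfolding multilinear_Suc_iff
  proof (intro conjI allI impI ballI)
    fix Xs assume "Xs \<notin> args V (Suc m)"
    then show "extend (Suc m) F Xs = 0" by (rule extend_outside)
  next
    fix X assume X: "X \<in> total V"
    show "multilinear V m (\<lambda>Xs. extend (Suc m) F (X # Xs))"
      unfolding extend_Cons[OF X]
      by (rule multilinear_sum) (use X finite_hcomp IH in auto)
  next
    fix Xs assume Xs: "Xs \<in> args V m"
    have "linear_total V V (\<lambda>X. \<Sum>x | hcomp V x X \<noteq> 0. extend m (\<lambda>zs. F ((x, hcomp V x X) # zs)) Xs)"
    proof (rule linear_extension)
      fix x A B assume AB: "A \<in> piece V x" "B \<in> piece V x"
      have "extend m (\<lambda>zs. F ((x, A + B) # zs)) =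
          extend m (\<lambda>zs. F ((x, A) # zs) + F ((x, B) # zs))"
        by (rule extend_cong) (rule homlin_first_add[OF Suc.prems AB])
      then show "extend m (\<lambda>zs. F ((x, A + B) # zs)) Xs =
          extend m (\<lambda>zs. F ((x, A) # zs)) Xs + extend m (\<lambda>zs. F ((x, B) # zs)) Xs"
        by (simp add: extend_add)
    next
      fix x c A assume A: "A \<in> piece V x"
      have "extend m (\<lambda>zs. F ((x, smul V c A) # zs)) = extend m (\<lambda>zs. smul V c (F ((x, A) # zs)))"
        by (rule extend_cong) (rule homlin_first_smul[OF Suc.prems A])
      then show "extend m (\<lambda>zs. F ((x, smul V c A) # zs)) Xs =
          smul V c (extend m (\<lambda>zs. F ((x, A) # zs)) Xs)"
        by (simp add: extend_smul)
    next
      fix x A assume "A \<in> piece V x"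
      from IH[OF this] show "extend m (\<lambda>zs. F ((x, A) # zs)) Xs \<in> total V"
        using Xs by (simp add: multilinear_def)
    qed
    then show "linear_total V V (\<lambda>X. extend (Suc m) F (X # Xs))"
      by (rule linear_total_cong) (rule extend_Cons[symmetric])
  qed
qed

text \<open>
  A nonzero homogeneous argument has a single nonzero component, itself.  If some argument is \<open>0\<close>, the
  sum is empty and the value of \<open>F\<close> is \<open>0\<close> by linearity.
\<close>
lemma extend_tagged:
  assumes "homlin m \<kappa> F" "zs \<in> homs m"
  shows "tagged (extend m F) zs = F zs"
  using assms
proof (induction m arbitrary: \<kappa> F zs)
  case 0
  then show ?case by (simp add: extend_0)
next
  case (Suc m)
  from Suc.prems(2) obtain x X ys where zs: "zs = (x, X) # ys" "X \<in> piece V x" "ys \<in> homs m"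
    by (auto simp: homs_Suc)
  have X: "X \<in> total V" using zs(2) by blast
  have IH: "extend m (\<lambda>zs. F ((x, X) # zs)) (map snd ys) = F ((x, X) # ys)"
    by (rule Suc.IH[of "\<kappa> + x"]) (use Suc.prems(1) zs in auto)
  show ?case
  proof (cases "X = 0")
    case True
    have "F ((x, smul V 0 0) # ys) = smul V 0 (F ((x, 0) # ys))"
      by (rule homlin_first_smul[OF Suc.prems(1) piece_0 zs(3)])
    then show ?thesis using True zs(1) by (simp add: extend_Cons)
  next
    case False
    have "{y. hcomp V y X \<noteq> 0} = {x}"
      using False zs(2) by (auto simp: hcomp_homogeneous)
    then show ?thesis
      using IH zs X by (simp add: extend_Cons hcomp_homogeneous)
  qed
qed

lemma extend_mlin: "homlin m \<kappa> F \<Longrightarrow> extend m F \<in> mlin m \<kappa>"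
  using extend_multilinear[of m \<kappa> F] homlin_cong[of m "tagged (extend m F)" F \<kappa>]
    extend_tagged[of m \<kappa> F] by (auto simp: mlin_def)

lemma alternator_eq:
  assumes "K \<in> mlin m \<kappa>"
  shows "alternator n V m K = extend m (\<lambda>zs. smul V (1 / fact m) (altsum zs (tagged K)))"
  unfolding alternator_def
proof (rule hom_extend_extend)
  fix zs assume "zs \<in> homs m"
  then have m: "m = length zs" by (simp add: homs_def)
  show "smul V (1 / fact m) (\<Sum>\<sigma> | \<sigma> permutes {..<m}.
      smul V (msign n \<sigma> (map fst zs)) (K (permute_list \<sigma> (map snd zs)))) =
      smul V (1 / fact m) (altsum zs (tagged K))"
    unfolding altsum_eq_permutations m
    by (intro arg_cong[where f = "smul V _"] sum.cong refl) (simp add: permute_list_map)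
qed

lemma alternator_mlin: "K \<in> mlin m \<kappa> \<Longrightarrow> alternator n V m K \<in> mlin m \<kappa>"
  and alternator_tagged: "K \<in> mlin m \<kappa> \<Longrightarrow> zs \<in> homs m \<Longrightarrow>
    tagged (alternator n V m K) zs = smul V (1 / fact m) (altsum zs (tagged K))"
  by (simp_all add: alternator_eq[of K m \<kappa>] extend_mlin extend_tagged[of _ \<kappa>] homlin_smul
      homlin_altsum mlin_homlin)

definition Alt :: "nat \<Rightarrow> deg \<Rightarrow> ('v list \<Rightarrow> 'v) set" where
  "Alt m \<kappa> = {K \<in> mlin m \<kappa>. alternating m (tagged K)}"

lemma alternating_cong:
  assumes "\<And>zs. zs \<in> homs m \<Longrightarrow> F zs = G zs"
  shows "alternating m F = alternating m G"
proof -
  have "us @ b # a # vs \<in> homs m" if "us @ a # b # vs \<in> homs m" for us a b vs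
    using that by (auto simp: homs_def)
  then show ?thesis using assms unfolding alternating_def by metis
qed

text \<open>
  The alternation sum produces alternating functions and multiplies those that are alternating already
  by \<open>m!\<close>, which the alternator divides out.
\<close>
lemma alternator_image: "alternator n V m ` mlin m \<kappa> = Alt m \<kappa>"
proof
  show "alternator n V m ` mlin m \<kappa> \<subseteq> Alt m \<kappa>"
  proof
    fix L assume "L \<in> alternator n V m ` mlin m \<kappa>"
    then obtain K where K: "K \<in> mlin m \<kappa>" "L = alternator n V m K" by blast
    have "alternating m (\<lambda>zs. smul V (1 / fact m) (altsum zs (tagged K)))"
      by (intro alternating_smul alternating_altsum)
    moreover have "alternating m (tagged L) =
        alternating m (\<lambda>zs. smul V (1 / fact m) (altsum zs (tagged K)))"
      unfolding K(2) by (rule alternating_cong) (rule alternator_tagged[OF K(1)])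
    ultimately have "alternating m (tagged L)" by blast
    then show "L \<in> Alt m \<kappa>"
      using alternator_mlin[OF K(1)] K(2) by (simp add: Alt_def)
  qed
  show "Alt m \<kappa> \<subseteq> alternator n V m ` mlin m \<kappa>"
  proof
    fix K assume "K \<in> Alt m \<kappa>"
    then have K: "K \<in> mlin m \<kappa>" "alternating m (tagged K)" by (auto simp: Alt_def)
    have "alternator n V m K = K"
      by (rule mlin_eqI[OF alternator_mlin[OF K(1)] K(1)])
        (simp add: alternator_tagged[OF K(1)] altsum_alternating[OF K(2)])
    with K(1) show "K \<in> alternator n V m ` mlin m \<kappa>" by force
  qed
qed

lemma Apiece_eq: "- 1 \<le> k \<Longrightarrow> Apiece n V k \<kappa> = Alt (nat (k + 1)) \<kappa>"
  by (simp add: Apiece_def Mpiece_eq alternator_image)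

lemma jop_eq:
  assumes "- 1 \<le> k1" "0 \<le> k2" "K1 \<in> mlin (nat (k1 + 1)) \<kappa>1" "K2 \<in> mlin (nat (k2 + 1)) \<kappa>2"
  shows "jop n V k1 \<kappa>1 K1 k2 \<kappa>2 K2 = extend (nat (k1 + k2 + 1))
    (\<lambda>zs. sg (ip n \<kappa>1 \<kappa>2) (plugsum (nat (k1 + 1)) \<kappa>1 (tagged K1) zs (tagged K2)))"
proof -
  define p q where "p = nat (k1 + 1)" and "q = nat k2"
  have pq: "nat (k1 + k2 + 1) = p + q" "int p = k1 + 1" "nat (k1 + 1) = p" "nat k2 = q"
    using assms(1,2) by (simp_all add: p_def q_def nat_add_distrib[symmetric])
  have "hom_extend V (p + q) (\<lambda>xs Xs. \<Sum>i\<le>q.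
      smul V ((-1) powi (k1 * int i + ip n \<kappa>1 (\<kappa>2 + sum_list (take i xs))))
        (K2 (take i Xs @ [K1 (take p (drop i Xs))] @ drop (i + p) Xs))) =
    extend (p + q) (\<lambda>zs. sg (ip n \<kappa>1 \<kappa>2) (plugsum p \<kappa>1 (tagged K1) zs (tagged K2)))"
  proof (rule hom_extend_extend)
    fix zs assume "zs \<in> homs (p + q)"
    then have l: "length zs = p + q" by (simp add: homs_def)
    show "(\<Sum>i\<le>q. smul V ((-1) powi (k1 * int i + ip n \<kappa>1 (\<kappa>2 + sum_list (take i (map fst zs)))))
        (K2 (take i (map snd zs) @ [K1 (take p (drop i (map snd zs)))] @ drop (i + p) (map snd zs)))) =
      sg (ip n \<kappa>1 \<kappa>2) (plugsum p \<kappa>1 (tagged K1) zs (tagged K2))"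
      unfolding plugsum_eq_sum[OF l] sg_sum
    proof (rule sum.cong)
      fix i assume "i \<in> {..q}"
      then have "p \<le> length (drop i zs)" using l by simp
      then show "smul V ((-1) powi (k1 * int i + ip n \<kappa>1 (\<kappa>2 + sum_list (take i (map fst zs)))))
        (K2 (take i (map snd zs) @ [K1 (take p (drop i (map snd zs)))] @ drop (i + p) (map snd zs))) =
        sg (ip n \<kappa>1 \<kappa>2) (sg ((int p + 1) * int i + ip n \<kappa>1 (sum_list (map fst (take i zs))))
          (plug p \<kappa>1 (tagged K1) (\<lambda>l. tagged K2 (take i zs @ l)) (drop i zs)))"
        by (simp add: plug_eq smul_sign sg_sg ip_add_right take_map drop_map add.commute[of i] pq(2))
          (rule sg_cong, simp)
    qed simp
  qed
  then show ?thesis using assms(1,2) by (simp add: jop_def pq)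
qed

lemma iop_tagged:
  assumes "- 1 \<le> k1" "0 \<le> k2" "K1 \<in> mlin (nat (k1 + 1)) \<kappa>1" "K2 \<in> mlin (nat (k2 + 1)) \<kappa>2"
  shows "iop n V k1 \<kappa>1 K1 k2 \<kappa>2 K2 \<in> mlin (nat (k1 + k2 + 1)) (\<kappa>1 + \<kappa>2)" (is ?A)
    and "zs \<in> homs (nat (k1 + k2 + 1)) \<Longrightarrow> tagged (iop n V k1 \<kappa>1 K1 k2 \<kappa>2 K2) zs =
      circ (nat (k1 + 1)) \<kappa>1 (tagged K1) (nat (k2 + 1)) \<kappa>2 (tagged K2) zs" (is "_ \<Longrightarrow> ?B zs")
proof -
  define p q where "p = nat (k1 + 1)" and "q = nat k2"
  have pq: "nat (k1 + k2 + 1) = p + q" "nat (k1 + 1) = p" "nat (k2 + 1) = Suc q"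
    using assms(1,2) by (simp_all add: p_def q_def nat_add_distrib[symmetric])
  have K: "homlin p \<kappa>1 (tagged K1)" "homlin (Suc q) \<kappa>2 (tagged K2)"
    using assms(3,4) by (simp_all only: pq mlin_homlin)
  let ?J = "\<lambda>zs. sg (ip n \<kappa>1 \<kappa>2) (plugsum p \<kappa>1 (tagged K1) zs (tagged K2))"
  have J: "homlin (p + q) (\<kappa>1 + \<kappa>2) ?J"
    by (intro homlin_sg homlin_plugsum K)
  have j: "jop n V k1 \<kappa>1 K1 k2 \<kappa>2 K2 = extend (p + q) ?J"
    using jop_eq[OF assms] by (simp add: pq)
  have jm: "extend (p + q) ?J \<in> mlin (p + q) (\<kappa>1 + \<kappa>2)" by (rule extend_mlin[OF J])
  have i: "iop n V k1 \<kappa>1 K1 k2 \<kappa>2 K2 = (\<lambda>Xs. smul V (fact (p + q) / (fact p * fact (Suc q)))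
      (alternator n V (p + q) (extend (p + q) ?J) Xs))"
    using assms(1,2) unfolding iop_def j pq by simp
  show ?A
    using alternator_mlin[OF jm] unfolding i pq
    by (simp add: mlin_def multilinear_smul homlin_smul)
  show "?B zs" if "zs \<in> homs (nat (k1 + k2 + 1))"
  proof -
    have zs: "zs \<in> homs (p + q)" using that by (simp add: pq)
    have "altsum zs (tagged (extend (p + q) ?J)) = altsum zs ?J"
      by (rule altsum_cong[OF zs]) (simp add: extend_tagged[OF J])
    then show ?thesis
      unfolding i pq circ_def
      by (simp add: alternator_tagged[OF jm zs] altsum_sg del: fact_Suc)
  qed
qed

end

section \<open>The spaces \<open>A\<^bsup>(k,\<kappa>)\<^esup>(V)\<close> and their contractions\<close>

lemma dfst_dpair [simp]: "dfst (dpair k x) = k"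
  and dsnd_dpair [simp]: "dsnd (dpair k x) = x"
  and dpair_dfst_dsnd [simp]: "dpair (dfst d) (dsnd d) = d"
  and dfst_add [simp]: "dfst (d + e) = dfst d + dfst e"
  and dsnd_add [simp]: "dsnd (d + e) = dsnd d + dsnd e"
  by (auto simp: dfst_def dsnd_def dpair_def fun_eq_iff plus_fun_apply split: nat.split)

lemma ip_Suc: "ip (Suc n) d e = dfst d * dfst e + ip n (dsnd d) (dsnd e)"
  unfolding ip_def dfst_def dsnd_def by (subst sum.lessThan_Suc_shift) simp

lemma Zn_Suc: "d \<in> Zn (Suc n) \<longleftrightarrow> dsnd d \<in> Zn n"
  by (auto simp: Zn_def dsnd_def) (metis Suc_le_D Suc_le_mono)

context graded begin

lemma alternating_add:
  "alternating m F \<Longrightarrow> alternating m G \<Longrightarrow> alternating m (\<lambda>zs. F zs + G zs)"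
  unfolding alternating_def sg_add by metis

lemma alternating_0: "alternating m (\<lambda>zs. 0)"
  by (simp add: alternating_def)

lemma circ_linear_left:
  assumes "homlin p \<kappa> F" "homlin p \<kappa> F'" "homlin (Suc q) \<kappa>' G" "zs \<in> homs (p + q)"
  shows "circ p \<kappa> (\<lambda>l. F l + smul V c (F' l)) (Suc q) \<kappa>' G zs =
    circ p \<kappa> F (Suc q) \<kappa>' G zs + smul V c (circ p \<kappa> F' (Suc q) \<kappa>' G zs)"
proof -
  have "altsum zs (\<lambda>l. plugsum p \<kappa> (\<lambda>l. F l + smul V c (F' l)) l G) =
      altsum zs (\<lambda>l. plugsum p \<kappa> F l G + smul V c (plugsum p \<kappa> F' l G))"
    by (rule altsum_cong[OF assms(4)]) (rule plugsum_linear_left[OF assms(1-3)])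
  then show ?thesis
    by (simp only: circ_def altsum_add altsum_smul sg_add sg_smul vs.scale_right_distrib
        vs.scale_left_commute[of c])
qed

lemma circ_linear_right:
  "circ p \<kappa> F q \<kappa>' (\<lambda>l. G l + smul V c (G' l)) zs =
    circ p \<kappa> F q \<kappa>' G zs + smul V c (circ p \<kappa> F q \<kappa>' G' zs)"
  by (simp only: circ_def plugsum_add_right plugsum_smul_right altsum_add altsum_smul sg_add sg_smul
      vs.scale_right_distrib vs.scale_left_commute[of c])

lemma plugsum_0: "plugsum 0 x F zs G = ins (x, F []) zs G"
  by (induction zs arbitrary: G) auto

end

context graded_ground begin

definition scale :: "'k \<Rightarrow> ('v list \<Rightarrow> 'v) \<Rightarrow> 'v list \<Rightarrow> 'v" where
  "scale c K = (\<lambda>Xs. smul V c (K Xs))"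

lemma scale_sign: "scale ((-1) powi a) K = sg a K"
  by (simp add: scale_def smul_sign fun_eq_iff sg_apply)

lemma Alt_add: "K \<in> Alt m \<kappa> \<Longrightarrow> L \<in> Alt m \<kappa> \<Longrightarrow> K + L \<in> Alt m \<kappa>"
  by (auto simp: Alt_def mlin_def plus_fun_def intro: multilinear_add homlin_add alternating_add)

lemma Alt_scale: "K \<in> Alt m \<kappa> \<Longrightarrow> scale c K \<in> Alt m \<kappa>"
  by (auto simp: Alt_def mlin_def scale_def intro: multilinear_smul homlin_smul alternating_smul)

lemma Alt_0: "0 \<in> Alt m \<kappa>"
  by (auto simp: Alt_def mlin_def zero_fun_def intro: multilinear_zero homlin_0 alternating_0)

definition A :: "deg \<Rightarrow> ('v list \<Rightarrow> 'v) set" where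
  "A d = Apiece n V (dfst d) (dsnd d)"

lemma A_Alt: "-1 \<le> dfst d \<Longrightarrow> A d = Alt (nat (dfst d + 1)) (dsnd d)"
  by (simp add: A_def Apiece_eq)

lemma A_low: "dfst d < -1 \<Longrightarrow> A d = {0}"
proof -
  have "alternator n V 0 0 = (0 :: 'v list \<Rightarrow> 'v)"
    using alternator_eq[of 0 0 0] Alt_0[of 0 0]
    by (auto simp: Alt_def fun_eq_iff extend_def hom_extend_def zero_fun_apply args_0)
  then show "dfst d < -1 \<Longrightarrow> A d = {0}"
    by (simp add: A_def Apiece_def Mpiece_def)
qed

lemma A_cases: "(A d = {0}) \<or> (\<exists>m. A d = Alt m (dsnd d))"
  using A_low[of d] A_Alt[of d] by (cases "dfst d < -1") auto

lemma A_0 [simp, intro]: "0 \<in> A d"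
  using A_cases[of d] Alt_0 by fastforce

lemma scale_0 [simp]: "scale c 0 = 0"
  by (simp add: scale_def zero_fun_def)

lemma A_add [intro]: "K \<in> A d \<Longrightarrow> L \<in> A d \<Longrightarrow> K + L \<in> A d"
  using A_cases[of d] by (elim disjE exE) (simp_all add: Alt_add)

lemma A_scale [intro]: "K \<in> A d \<Longrightarrow> scale c K \<in> A d"
  using A_cases[of d] by (elim disjE exE) (simp_all add: Alt_scale)

lemma A_sg [intro]: "K \<in> A d \<Longrightarrow> sg a K \<in> A d"
  unfolding scale_sign[symmetric] by (rule A_scale)

lemma A_minus [intro]: "K \<in> A d \<Longrightarrow> - K \<in> A d"
  using A_sg[of K d 1] by (simp add: sg_def)

lemma A_diff [intro]: "K \<in> A d \<Longrightarrow> L \<in> A d \<Longrightarrow> K - L \<in> A d"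
  using A_add[of K d "- L"] by auto

definition con :: "'v \<Rightarrow> ('v list \<Rightarrow> 'v) \<Rightarrow> 'v list \<Rightarrow> 'v" where
  "con X K = (\<lambda>Xs. K (X # Xs))"

lemma con_add: "con X (K + L) = con X K + con X L"
  and con_diff: "con X (K - L) = con X K - con X L"
  and con_sg: "con X (sg a K) = sg a (con X K)"
  and con_0 [simp]: "con X 0 = 0"
  by (auto simp: con_def scale_def fun_eq_iff plus_fun_apply zero_fun_apply sg_apply)

text \<open>
  A constant vanishes at every nonempty list.  Contraction thus takes \<open>V\<close> to \<open>0\<close>, in accordance with
  \<open>A\<^bsup>(-2,*)\<^esup>(V) = 0\<close>, and the rules below hold in all degrees.
\<close>
lemma con_low: "K \<in> A d \<Longrightarrow> dfst d \<le> -1 \<Longrightarrow> con X K = 0"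
proof (cases "dfst d = -1")
  case True
  assume "K \<in> A d"
  with True have "multilinear V 0 K" by (simp add: A_Alt Alt_def mlin_def)
  then show ?thesis by (auto simp: con_def multilinear_0_iff fun_eq_iff zero_fun_apply)
next
  case False
  assume "K \<in> A d" "dfst d \<le> -1"
  with False A_low[of d] show ?thesis by simp
qed

lemma con_A:
  assumes "K \<in> A d" "X \<in> piece V x" "e = d + dpair (-1) x"
  shows "con X K \<in> A e"
proof (cases "0 \<le> dfst d")
  case True
  have m: "nat (dfst d + 1) = Suc (nat (dfst d))" using True by simp
  have K: "multilinear V (Suc (nat (dfst d))) K" "homlin (Suc (nat (dfst d))) (dsnd d) (tagged K)"
    "alternating (Suc (nat (dfst d))) (tagged K)"
    using assms(1) True by (simp_all only: A_Alt Alt_def mlin_def m mem_Collect_eq)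
  have "multilinear V (nat (dfst d)) (con X K)"
    using K(1) assms(2) by (auto simp: multilinear_Suc_iff con_def)
  moreover have "homlin (nat (dfst d)) (dsnd d + x) (tagged (con X K))"
    using homlin_Cons[OF K(2) assms(2)] by (simp add: con_def)
  moreover have "alternating (nat (dfst d)) (tagged (con X K))"
    using alternating_Cons[OF K(3) assms(2)] by (simp add: con_def)
  ultimately show ?thesis using True by (simp add: A_Alt Alt_def mlin_def assms(3))
qed (use assms con_low in auto)

lemma A_eqI:
  assumes "K \<in> A d" "L \<in> A d" "0 \<le> dfst d"
    and "\<And>x X. X \<in> piece V x \<Longrightarrow> con X K = con X L"
  shows "K = L"
proof (rule mlin_eqI)
  show "K \<in> mlin (Suc (nat (dfst d))) (dsnd d)" "L \<in> mlin (Suc (nat (dfst d))) (dsnd d)"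
    using assms by (simp_all add: A_Alt Alt_def nat_add_distrib)
next
  fix zs assume "zs \<in> homs (Suc (nat (dfst d)))"
  then obtain x X ys where "zs = (x, X) # ys" "X \<in> piece V x" by (auto simp: homs_Suc)
  then show "tagged K zs = tagged L zs"
    using assms(4)[of X x] by (simp add: con_def fun_eq_iff)
qed

definition io :: "deg \<Rightarrow> ('v list \<Rightarrow> 'v) \<Rightarrow> deg \<Rightarrow> ('v list \<Rightarrow> 'v) \<Rightarrow> 'v list \<Rightarrow> 'v" where
  "io d K e L = iop n V (dfst d) (dsnd d) K (dfst e) (dsnd e) L"

lemma io_low: "dfst d < -1 \<or> dfst e \<le> -1 \<Longrightarrow> io d K e L = 0"
  by (simp add: io_def iop_def)

lemma io_props:
  assumes "K \<in> A d" "L \<in> A e" "-1 \<le> dfst d" "0 \<le> dfst e"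
  defines "p \<equiv> nat (dfst d + 1)" and "q \<equiv> nat (dfst e)"
  shows "homlin p (dsnd d) (tagged K)" "alternating p (tagged K)"
    and "homlin (Suc q) (dsnd e) (tagged L)" "alternating (Suc q) (tagged L)"
    and "nat (dfst d + dfst e + 1) = p + q"
    and "io d K e L \<in> mlin (p + q) (dsnd d + dsnd e)"
    and "zs \<in> homs (p + q) \<Longrightarrow> tagged (io d K e L) zs =
      circ p (dsnd d) (tagged K) (Suc q) (dsnd e) (tagged L) zs"
proof -
  have q: "nat (dfst e + 1) = Suc q" and pq: "nat (dfst d + dfst e + 1) = p + q"
    using assms(3,4) by (simp_all add: p_def q_def)
  have K: "K \<in> mlin p (dsnd d)" "alternating p (tagged K)"
    and L: "L \<in> mlin (Suc q) (dsnd e)" "alternating (Suc q) (tagged L)"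
    using assms(1-4) q by (simp_all add: A_Alt Alt_def p_def)
  show "homlin p (dsnd d) (tagged K)" "alternating p (tagged K)"
    "homlin (Suc q) (dsnd e) (tagged L)" "alternating (Suc q) (tagged L)"
    "nat (dfst d + dfst e + 1) = p + q"
    using K L pq by (simp_all only: mlin_homlin)
  show "io d K e L \<in> mlin (p + q) (dsnd d + dsnd e)"
    using iop_tagged(1)[OF assms(3,4), of K "dsnd d" L "dsnd e"] K L
    by (simp only: p_def[symmetric] q pq io_def)
  show "zs \<in> homs (p + q) \<Longrightarrow> tagged (io d K e L) zs =
      circ p (dsnd d) (tagged K) (Suc q) (dsnd e) (tagged L) zs"
    using iop_tagged(2)[OF assms(3,4), of K "dsnd d" L "dsnd e" zs] K L
    by (simp only: p_def[symmetric] q pq io_def)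
qed

lemma io_A:
  assumes "K \<in> A d" "L \<in> A e"
  shows "io d K e L \<in> A (d + e)"
proof (cases "dfst d < -1 \<or> dfst e \<le> -1")
  case False
  then have k: "-1 \<le> dfst d" "0 \<le> dfst e" by auto
  note p = io_props[OF assms k]
  have "alternating (nat (dfst d + 1) + nat (dfst e)) (tagged (io d K e L)) =
      alternating (nat (dfst d + 1) + nat (dfst e)) (circ (nat (dfst d + 1)) (dsnd d) (tagged K)
        (Suc (nat (dfst e))) (dsnd e) (tagged L))"
    by (rule alternating_cong) (rule p(7))
  then have "alternating (nat (dfst d + 1) + nat (dfst e)) (tagged (io d K e L))"
    using alternating_circ by blast
  then show ?thesis
    using p(5,6) k by (simp add: A_Alt Alt_def)
qed (simp add: io_low)

lemma A_eqI_tagged: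
  assumes "K \<in> A d" "L \<in> A d" "-1 \<le> dfst d"
    and "\<And>zs. zs \<in> homs (nat (dfst d + 1)) \<Longrightarrow> tagged K zs = tagged L zs"
  shows "K = L"
  by (rule mlin_eqI[of K "nat (dfst d + 1)" "dsnd d" L "dsnd d"])
    (use assms in \<open>simp_all add: A_Alt Alt_def\<close>)

lemma io_eqI:
  assumes "M \<in> A (d + e)" "N \<in> A (d + e)" "-1 \<le> dfst d" "0 \<le> dfst e"
    and "\<And>zs. zs \<in> homs (nat (dfst d + 1) + nat (dfst e)) \<Longrightarrow> tagged M zs = tagged N zs"
  shows "M = N"
proof (rule A_eqI_tagged[OF assms(1,2)])
  have "nat (dfst (d + e) + 1) = nat (dfst d + 1) + nat (dfst e)"
    using assms(3,4) by simp
  then show "zs \<in> homs (nat (dfst (d + e) + 1)) \<Longrightarrow> tagged M zs = tagged N zs" for zs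
    using assms(5) by simp
qed (use assms(3,4) in simp)

lemma io_linear_left:
  assumes "K \<in> A d" "K' \<in> A d" "L \<in> A e"
  shows "io d (K + scale c K') e L = io d K e L + scale c (io d K' e L)"
proof (cases "dfst d < -1 \<or> dfst e \<le> -1")
  case False
  then have k: "-1 \<le> dfst d" "0 \<le> dfst e" by auto
  have KK: "K + scale c K' \<in> A d" using assms by blast
  show ?thesis
  proof (rule io_eqI[OF _ _ k])
    fix zs assume zs: "zs \<in> homs (nat (dfst d + 1) + nat (dfst e))"
    show "tagged (io d (K + scale c K') e L) zs = tagged (io d K e L + scale c (io d K' e L)) zs"
      using circ_linear_left[OF io_props(1)[OF assms(1,3) k] io_props(1,3)[OF assms(2,3) k] zs]
      by (simp only: plus_fun_apply scale_def io_props(7)[OF KK assms(3) k zs, unfolded scale_def]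
          io_props(7)[OF assms(1,3) k zs] io_props(7)[OF assms(2,3) k zs])
  qed (use assms KK in \<open>auto intro!: A_add A_scale io_A\<close>)
qed (simp add: io_low)

lemma io_linear_right:
  assumes "K \<in> A d" "L \<in> A e" "L' \<in> A e"
  shows "io d K e (L + scale c L') = io d K e L + scale c (io d K e L')"
proof (cases "dfst d < -1 \<or> dfst e \<le> -1")
  case False
  then have k: "-1 \<le> dfst d" "0 \<le> dfst e" by auto
  have LL: "L + scale c L' \<in> A e" using assms by blast
  show ?thesis
  proof (rule io_eqI[OF _ _ k])
    fix zs assume zs: "zs \<in> homs (nat (dfst d + 1) + nat (dfst e))"
    show "tagged (io d K e (L + scale c L')) zs = tagged (io d K e L + scale c (io d K e L')) zs"
      by (simp only: plus_fun_apply scale_def io_props(7)[OF assms(1) LL k zs, unfolded scale_def]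
          circ_linear_right io_props(7)[OF assms(1,2) k zs] io_props(7)[OF assms(1,3) k zs])
  qed (use assms LL in \<open>auto intro!: A_add A_scale io_A\<close>)
qed (simp add: io_low)

text \<open>
  \<open>circ_Cons\<close> in terms of the degrees \<open>d\<close> and \<open>e\<close>.  The conventions for \<open>i\<close> in low degrees make the missing
  summands of that rule vanish.
\<close>
lemma con_io:
  assumes K: "K \<in> A d" and L: "L \<in> A e" and X: "X \<in> piece V x"
  defines "\<xi> \<equiv> dpair (-1) x"
  shows "con X (io d K e L) =
    sg (ip n x (dsnd e)) (io (d + \<xi>) (con X K) e L) + sg (dfst d) (io d K (e + \<xi>) (con X L))"
proof (cases "dfst d < -1 \<or> dfst e \<le> -1 \<or> dfst d + dfst e = -1")
  case True
  then have "dfst d + dfst e = -1 \<and> dfst d = -1 \<or> dfst d < -1 \<or> dfst e \<le> -1" by auto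
  moreover have "con X (io d K e L) = 0" if "dfst d + dfst e = -1"
    using con_low[OF io_A[OF K L]] that by simp
  ultimately show ?thesis by (auto simp: io_low \<xi>_def)
next
  case False
  then have k: "-1 \<le> dfst d" "0 \<le> dfst e" "0 \<le> dfst d + dfst e" by auto
  define p q r where "p = nat (dfst d + 1)" and "q = nat (dfst e)" and "r = nat (dfst d + dfst e)"
  have r: "p + q = Suc r" using k by (simp add: p_def q_def r_def)
  note KL = io_props[OF K L k(1,2), folded p_def q_def]
  have cK: "con X K \<in> A (d + \<xi>)" and cL: "con X L \<in> A (e + \<xi>)"
    using con_A[OF K X] con_A[OF L X] by (simp_all add: \<xi>_def)
  show ?thesis
  proof (rule mlin_eqI)
    have m: "M \<in> mlin r (dsnd d + dsnd e + x)" if "M \<in> A (d + e + \<xi>)" for M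
      using that k by (simp add: A_Alt Alt_def \<xi>_def r_def)
    show "con X (io d K e L) \<in> mlin r (dsnd d + dsnd e + x)"
      by (rule m, rule con_A[OF io_A[OF K L] X]) (simp add: \<xi>_def)
    have "d + \<xi> + e = d + e + \<xi>" "d + (e + \<xi>) = d + e + \<xi>" by (simp_all add: ac_simps)
    with io_A[OF cK L] io_A[OF K cL]
    show "sg (ip n x (dsnd e)) (io (d + \<xi>) (con X K) e L) + sg (dfst d) (io d K (e + \<xi>) (con X L))
        \<in> mlin r (dsnd d + dsnd e + x)"
      by (intro m) auto
  next
    fix zs assume zs: "zs \<in> homs r"
    have "tagged (con X (io d K e L)) zs = tagged (io d K e L) ((x, X) # zs)"
      by (simp add: con_def)
    also have "\<dots> = circ p (dsnd d) (tagged K) (Suc q) (dsnd e) (tagged L) ((x, X) # zs)"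
      by (rule KL(7)) (use zs X r in simp)
    also have "\<dots> = (if p = 0 then 0
        else sg (ip n x (dsnd e)) (circ (p - 1) (dsnd d + x) (tagged (con X K)) (Suc q) (dsnd e) (tagged L) zs))
       + (if q = 0 then 0
        else sg (int p + 1) (circ p (dsnd d) (tagged K) q (dsnd e + x) (tagged (con X L)) zs))"
      using circ_Cons[OF KL(1-4) X zs r] by (simp add: con_def)
    also have "(if p = 0 then 0
        else sg (ip n x (dsnd e)) (circ (p - 1) (dsnd d + x) (tagged (con X K)) (Suc q) (dsnd e) (tagged L) zs)) =
        tagged (sg (ip n x (dsnd e)) (io (d + \<xi>) (con X K) e L)) zs"
    proof (cases "p = 0")
      case True
      then have "dfst (d + \<xi>) < -1" using k by (simp add: p_def \<xi>_def)
      then show ?thesis using True by (simp add: io_low sg_apply zero_fun_apply)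
    next
      case False
      then have "-1 \<le> dfst (d + \<xi>)" "nat (dfst (d + \<xi>) + 1) = p - 1" using k by (simp_all add: p_def \<xi>_def)
      with io_props(7)[OF cK L _ k(2), of zs] zs r False
      show ?thesis by (simp add: sg_apply q_def \<xi>_def)
    qed
    also have "(if q = 0 then 0
        else sg (int p + 1) (circ p (dsnd d) (tagged K) q (dsnd e + x) (tagged (con X L)) zs)) =
        tagged (sg (dfst d) (io d K (e + \<xi>) (con X L))) zs"
    proof (cases "q = 0")
      case True
      then have "dfst (e + \<xi>) \<le> -1" using k by (simp add: q_def \<xi>_def)
      then show ?thesis using True by (simp add: io_low sg_apply zero_fun_apply)
    next
      case False
      then have e: "0 \<le> dfst (e + \<xi>)" "Suc (nat (dfst (e + \<xi>))) = q" using k by (simp_all add: q_def \<xi>_def)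
      have "nat (dfst d + 1) + nat (dfst (e + \<xi>)) = r"
        using r e(2) p_def by linarith
      then have "zs \<in> homs (nat (dfst d + 1) + nat (dfst (e + \<xi>)))"
        using zs by simp
      from io_props(7)[OF K cL k(1) e(1) this] e(2)
      have "tagged (io d K (e + \<xi>) (con X L)) zs =
          circ p (dsnd d) (tagged K) q (dsnd e + x) (tagged (con X L)) zs"
        by (simp add: p_def \<xi>_def)
      moreover have "sg (int p + 1) v = sg (dfst d) v" for v :: 'v
        using k(1) by (intro sg_cong) (simp add: p_def)
      ultimately show ?thesis using False by (simp add: sg_apply)
    qed
    finally show "tagged (con X (io d K e L)) zs =
        tagged (sg (ip n x (dsnd e)) (io (d + \<xi>) (con X K) e L) + sg (dfst d) (io d K (e + \<xi>) (con X L))) zs"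
      by (simp add: plus_fun_apply[of _ _ "map snd zs"])
  qed
qed

text \<open>
  Here \<open>j(X) L\<close> is \<open>\<plusminus> (q + 1) L(X, \<dots>)\<close>, which is alternating in its \<open>q\<close> arguments, so that alternation only
  multiplies by \<open>q!\<close>; the product \<open>(q + 1)!\<close> cancels.
\<close>
lemma io_V:
  assumes X: "K \<in> A (dpair (-1) x)" and L: "L \<in> A e"
  shows "io (dpair (-1) x) K e L = sg (ip n x (dsnd e)) (con (K []) L)"
proof (cases "dfst e \<le> -1")
  case True
  then show ?thesis using con_low[OF L] by (simp add: io_low)
next
  case False
  then have k: "-1 \<le> dfst (dpair (-1) x)" "0 \<le> dfst e" by simp_all
  define q where "q = nat (dfst e)"
  note KL = io_props[OF X L k, folded q_def, simplified]
  have KX: "K [] \<in> piece V x"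
    using KL(1) by simp
  have cL: "con (K []) L \<in> A (e + dpair (-1) x)"
    by (rule con_A[OF L KX refl])
  show ?thesis
  proof (rule io_eqI[OF _ _ k])
    show "sg (ip n x (dsnd e)) (con (K []) L) \<in> A (dpair (-1) x + e)"
      using A_sg[OF cL] by (simp add: add.commute)
  next
    fix zs assume zs: "zs \<in> homs (nat (dfst (dpair (-1) x) + 1) + nat (dfst e))"
    then have zs': "zs \<in> homs q" by (simp add: q_def)
    have alt: "alternating q (\<lambda>l. tagged L ((x, K []) # l))"
      using KL(4) KX by (rule alternating_Cons)
    have "altsum zs (\<lambda>l. ins (x, K []) l (tagged L)) =
        altsum zs (\<lambda>l. smul V (of_nat (Suc q)) (tagged L ((x, K []) # l)))"
      by (rule altsum_cong[OF zs']) (rule ins_alternating[OF KL(4) KX])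
    also have "\<dots> = smul V (fact (Suc q)) (tagged L ((x, K []) # zs))"
      unfolding altsum_smul altsum_alternating[OF alt zs'] by simp
    finally show "tagged (io (dpair (-1) x) K e L) zs = tagged (sg (ip n x (dsnd e)) (con (K []) L)) zs"
      using KL(7)[OF zs'] by (simp add: circ_def plugsum_0 sg_smul sg_apply con_def del: fact_Suc)
  qed (use X L io_A in auto)
qed

end

context graded_ground begin

section \<open>The bracket of \<open>A(V)\<close> and its Jacobi identity\<close>

definition br :: "deg \<Rightarrow> ('v list \<Rightarrow> 'v) \<Rightarrow> deg \<Rightarrow> ('v list \<Rightarrow> 'v) \<Rightarrow> 'v list \<Rightarrow> 'v" where
  "br d K e L = wedge_brk n V (dfst d) (dsnd d) K (dfst e) (dsnd e) L"

lemma br_io: "br d K e L = io d K e L - sg (ip (Suc n) d e) (io e L d K)"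
  by (simp add: br_def wedge_brk_def io_def ip_Suc smul_sign fun_eq_iff sg_apply)

lemma scale_add: "scale c (K + L) = scale c K + scale c L"
  and scale_diff: "scale c (K - L) = scale c K - scale c L"
  and scale_sg: "scale c (sg a K) = sg a (scale c K)"
  by (simp_all add: scale_def fun_eq_iff plus_fun_apply sg_apply sg_smul
      vs.scale_right_distrib vs.scale_right_diff_distrib)

lemma br_A: "K \<in> A d \<Longrightarrow> L \<in> A e \<Longrightarrow> f = d + e \<Longrightarrow> br d K e L \<in> A f"
  unfolding br_io using io_A[of K d L e] io_A[of L e K d] by (auto simp: add.commute[of e])

lemma br_linear_left:
  "K \<in> A d \<Longrightarrow> K' \<in> A d \<Longrightarrow> L \<in> A e \<Longrightarrow> br d (K + scale c K') e L = br d K e L + scale c (br d K' e L)"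
  by (simp add: br_io io_linear_left io_linear_right sg_add scale_diff scale_sg)

lemma br_linear_right:
  "K \<in> A d \<Longrightarrow> L \<in> A e \<Longrightarrow> L' \<in> A e \<Longrightarrow> br d K e (L + scale c L') = br d K e L + scale c (br d K e L')"
  by (simp add: br_io io_linear_left io_linear_right sg_add scale_diff scale_sg)

lemma scale_1: "scale 1 K = K"
  and scale_minus_1: "K + scale (c - 1) K = scale c K"
  by (simp_all add: scale_def fun_eq_iff plus_fun_apply vs.scale_left_diff_distrib)

lemma br_add_left: "K \<in> A d \<Longrightarrow> K' \<in> A d \<Longrightarrow> L \<in> A e \<Longrightarrow> br d (K + K') e L = br d K e L + br d K' e L"
  and br_add_right: "L \<in> A d \<Longrightarrow> K \<in> A e \<Longrightarrow> K' \<in> A e \<Longrightarrow> br d L e (K + K') = br d L e K + br d L e K'"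
  using br_linear_left[of K d K' L e 1] br_linear_right[of L d K e K' 1] by (simp_all add: scale_1)

lemma br_scale_left: "K \<in> A d \<Longrightarrow> L \<in> A e \<Longrightarrow> br d (scale c K) e L = scale c (br d K e L)"
  and br_scale_right: "K \<in> A d \<Longrightarrow> L \<in> A e \<Longrightarrow> br d K e (scale c L) = scale c (br d K e L)"
  using br_linear_left[of K d K L e "c - 1"] br_linear_right[of K d L e L "c - 1"]
  by (simp_all add: scale_minus_1)

lemma br_sg_left: "K \<in> A d \<Longrightarrow> L \<in> A e \<Longrightarrow> br d (sg a K) e L = sg a (br d K e L)"
  and br_sg_right: "K \<in> A d \<Longrightarrow> L \<in> A e \<Longrightarrow> br d K e (sg a L) = sg a (br d K e L)"
  unfolding scale_sign[symmetric] by (rule br_scale_left br_scale_right; assumption)+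

lemma br_0_left [simp]: "L \<in> A e \<Longrightarrow> br d 0 e L = 0"
  and br_0_right [simp]: "K \<in> A d \<Longrightarrow> br d K e 0 = 0"
proof -
  have z: "scale 0 K = 0" for K by (simp add: scale_def zero_fun_def)
  show "L \<in> A e \<Longrightarrow> br d 0 e L = 0" using br_scale_left[of 0 d L e 0] by (simp add: z)
  show "K \<in> A d \<Longrightarrow> br d K e 0 = 0" using br_scale_right[of K d 0 e 0] by (simp add: z)
qed

lemma br_antisym: "br d K e L = - sg (ip (Suc n) d e) (br e L d K)"
  by (simp add: br_io sg_diff sg_sg ip_commute[of "Suc n" e d]) (simp add: sg_def)

text \<open>
  The bracket with \<open>X \<in> V\<^sup>x\<close> on maps of degree \<open>d\<close>, see \<open>br_V\<close>.
\<close>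
definition ad :: "deg \<Rightarrow> 'v \<Rightarrow> deg \<Rightarrow> ('v list \<Rightarrow> 'v) \<Rightarrow> 'v list \<Rightarrow> 'v" where
  "ad x X d K = sg (ip n x (dsnd d)) (con X K)"

lemma ad_A: "K \<in> A d \<Longrightarrow> X \<in> piece V x \<Longrightarrow> e = dpair (-1) x + d \<Longrightarrow> ad x X d K \<in> A e"
  unfolding ad_def by (intro A_sg con_A) (auto simp: add.commute)

lemma ad_low: "K \<in> A d \<Longrightarrow> dfst d \<le> -1 \<Longrightarrow> ad x X d K = 0"
  by (simp add: ad_def con_low)

lemma ad_add: "ad x X d (K + L) = ad x X d K + ad x X d L"
  and ad_sg: "ad x X d (sg a K) = sg a (ad x X d K)"
  by (simp_all add: ad_def con_add con_sg sg_add sg_sg add.commute)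

text \<open>
  The key to finality and to the Jacobi identity: contractions detect equality in the degrees
  \<open>(k, \<kappa>)\<close> with \<open>k \<ge> 0\<close>.
\<close>
lemma A_eqI_ad:
  assumes "K \<in> A d" "L \<in> A d" "0 \<le> dfst d"
    and "\<And>x X. X \<in> piece V x \<Longrightarrow> ad x X d K = ad x X d L"
  shows "K = L"
proof (rule A_eqI[OF assms(1-3)])
  fix x X assume "X \<in> piece V x"
  then have "ad x X d K = ad x X d L" by (rule assms(4))
  then show "con X K = con X L" by (simp add: ad_def sg_def split: if_splits)
qed

lemma br_V:
  assumes "K \<in> A (dpair (-1) x)" "L \<in> A e"
  shows "br (dpair (-1) x) K e L = ad x (K []) e L"
  using io_V[OF assms] by (simp add: br_io io_low ad_def)

text \<open>
  Both halves of the bracket obey the Leibniz rule \<open>con_io\<close>; it remains to compare the signs.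
\<close>
lemma ad_br:
  assumes K: "K \<in> A d" and L: "L \<in> A e" and X: "X \<in> piece V x"
  defines "\<xi> \<equiv> dpair (-1) x"
  shows "ad x X (d + e) (br d K e L) =
    br (\<xi> + d) (ad x X d K) e L + sg (ip (Suc n) \<xi> d) (br d K (\<xi> + e) (ad x X e L))"
proof -
  have cK: "con X K \<in> A (\<xi> + d)" and cL: "con X L \<in> A (\<xi> + e)"
    using con_A[OF K X] con_A[OF L X] by (simp_all add: \<xi>_def add.commute)
  have 1: "br (\<xi> + d) (ad x X d K) e L = sg (ip n x (dsnd d)) (io (\<xi> + d) (con X K) e L)
      - sg (ip (Suc n) (\<xi> + d) e + ip n x (dsnd d)) (io e L (\<xi> + d) (con X K))"
    unfolding ad_def br_sg_left[OF cK L] by (simp add: br_io sg_diff sg_sg add.commute)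
  have 2: "br d K (\<xi> + e) (ad x X e L) = sg (ip n x (dsnd e)) (io d K (\<xi> + e) (con X L))
      - sg (ip (Suc n) d (\<xi> + e) + ip n x (dsnd e)) (io (\<xi> + e) (con X L) d K)"
    unfolding ad_def br_sg_right[OF K cL] by (simp add: br_io sg_diff sg_sg add.commute)
  have 3: "ad x X (d + e) (br d K e L) = sg (ip n x (dsnd d) + ip n x (dsnd e))
      ((sg (ip n x (dsnd e)) (io (\<xi> + d) (con X K) e L) + sg (dfst d) (io d K (\<xi> + e) (con X L)))
      - sg (ip (Suc n) d e) (sg (ip n x (dsnd d)) (io (\<xi> + e) (con X L) d K)
          + sg (dfst e) (io e L (\<xi> + d) (con X K))))"
    using con_io[OF K L X] con_io[OF L K X]
    by (simp add: ad_def br_io con_diff con_sg ip_add_right \<xi>_def[symmetric] add.commute)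
  have signs: "sg (a + b) ((sg b P + sg i Q) - sg (i * j + r) (sg a R + sg j S)) =
      (sg a P - sg (- 1 * j + b + (i * j + r) + a) S) +
      sg (- 1 * i + a) (sg b Q - sg (i * - 1 + a + (i * j + r) + b) R)"
    for P Q R S :: "'v list \<Rightarrow> 'v" and a b i j r :: int
    by (cases "even a"; cases "even b"; cases "even i"; cases "even j"; cases "even r";
        simp add: sg_def)
  show ?thesis
    unfolding 1 2 3 unfolding ip_Suc \<xi>_def dfst_add dsnd_add dfst_dpair dsnd_dpair ip_add_left ip_add_right
      ip_commute[of n "dsnd d" x]
    by (rule signs)
qed

definition jacobi :: "deg \<Rightarrow> ('v list \<Rightarrow> 'v) \<Rightarrow> deg \<Rightarrow> ('v list \<Rightarrow> 'v) \<Rightarrow> deg \<Rightarrow> ('v list \<Rightarrow> 'v) \<Rightarrow> bool" where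
  "jacobi d K e L f M \<longleftrightarrow> br d K (e + f) (br e L f M) =
     br (d + e) (br d K e L) f M + sg (ip (Suc n) d e) (br e L (d + f) (br d K f M))"

text \<open>
  For \<open>X \<in> V\<close> the Jacobi identity says that \<open>[X, _]\<close> is a derivation.
\<close>
lemma jacobi_V:
  assumes "K \<in> A d" "L \<in> A e" "M \<in> A f" "dfst d = -1"
  shows "jacobi d K e L f M"
proof -
  define x where "x = dsnd d"
  have d: "d = dpair (-1) x" unfolding x_def assms(4)[symmetric] by simp
  have "K [] \<in> piece V x"
    using assms(1) by (simp add: d A_Alt Alt_def mlin_def)
  from ad_br[OF assms(2,3) this]
  show ?thesis
    using assms(1-3) br_A[OF assms(2,3) refl] by (simp add: jacobi_def d br_V)
qed

text \<open>
  By graded antisymmetry the Jacobi identity for a triple implies that for every rearrangement of it;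
  this lemma and the next provide two transpositions, which generate all of them.
\<close>
lemma jacobi_swap_left:
  assumes "jacobi d K e L f M" "K \<in> A d" "L \<in> A e" "M \<in> A f"
  shows "jacobi e L d K f M"
proof -
  have "br (e + d) (br e L d K) f M = - sg (ip (Suc n) e d) (br (d + e) (br d K e L) f M)"
    using br_sg_left[OF br_A[OF assms(2,3) refl] assms(4), of "1 + ip (Suc n) e d"]
    by (simp add: br_antisym[of e L d K] add.commute[of e] sg_def split: if_splits)
  then show ?thesis
    using assms(1) by (simp add: jacobi_def ip_commute[of "Suc n" e d] sg_def)
qed

lemma jacobi_swap_right:
  assumes "jacobi d K e L f M" "K \<in> A d" "L \<in> A e" "M \<in> A f"
  shows "jacobi d K f M e L"
proof -
  have LM: "br e L f M = sg (1 + ip (Suc n) e f) (br f M e L)"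
    by (subst br_antisym) (simp add: sg_def)
  have 1: "br d K (e + f) (br e L f M) = sg (1 + ip (Suc n) e f) (br d K (f + e) (br f M e L))"
    unfolding LM by (subst add.commute[of e]) (rule br_sg_right[OF assms(2) br_A[OF assms(4,3) refl]])
  have 2: "br (d + e) (br d K e L) f M = sg (1 + ip (Suc n) (d + e) f) (br f M (d + e) (br d K e L))"
    by (subst br_antisym) (simp add: sg_def)
  have 3: "br e L (d + f) (br d K f M) = sg (1 + ip (Suc n) e (d + f)) (br (d + f) (br d K f M) e L)"
    by (subst br_antisym) (simp add: sg_def)
  have signs: "sg (1 + r) P = sg (1 + (s + r)) Q + sg t (sg (1 + (t + r)) R) \<Longrightarrow> P = R + sg s Q"
    for P Q R :: "'v list \<Rightarrow> 'v" and r s t :: int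
    by (cases "even r"; cases "even s"; cases "even t") (auto simp: sg_def algebra_simps)
  show ?thesis
    unfolding jacobi_def
    by (rule signs[of "ip (Suc n) e f" _ "ip (Suc n) d f" _ "ip (Suc n) d e"])
      (use assms(1)[unfolded jacobi_def 1 2 3 ip_add_left ip_add_right ip_commute[of "Suc n" e d]] in simp)
qed

lemma jacobi_zero:
  assumes "K \<in> A d" "L \<in> A e" "M \<in> A f" "K = 0 \<or> L = 0 \<or> M = 0"
  shows "jacobi d K e L f M"
  using assms br_A[OF assms(1,2) refl] br_A[OF assms(2,3) refl] br_A[OF assms(1,3) refl]
  by (auto simp: jacobi_def)

text \<open>
  Induction on the total degree, shifted so that it is nonnegative when all entries have degree at
  least \<open>-1\<close>.  If all entries have nonnegative degree, so does the result, and it suffices to compare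
  the contractions.  Each of the three terms contracts to three terms by the derivation property, and the
  nine terms are three Jacobi identities in which one entry has been contracted.
\<close>
lemma jacobi_all:
  assumes "K \<in> A d" "L \<in> A e" "M \<in> A f"
  shows "jacobi d K e L f M"
  using assms
proof (induction "nat (dfst d + dfst e + dfst f + 3)" arbitrary: d e f K L M rule: less_induct)
  case less
  note K = less.prems(1) and L = less.prems(2) and M = less.prems(3)
  consider "dfst d < -1 \<or> dfst e < -1 \<or> dfst f < -1" | "dfst d = -1" | "dfst e = -1" | "dfst f = -1"
    | (nonneg) "0 \<le> dfst d" "0 \<le> dfst e" "0 \<le> dfst f"
    by linarith
  then show ?case
  proof cases
    case 1
    then show ?thesis using K L M A_low by (intro jacobi_zero) auto
  next
    case 2
    then show ?thesis by (rule jacobi_V[OF K L M])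
  next
    case 3
    then show ?thesis using jacobi_swap_left[OF jacobi_V[OF L K M]] K L M by blast
  next
    case 4
    then show ?thesis using jacobi_swap_right[OF jacobi_swap_left[OF jacobi_V[OF M K L]]] K L M by blast
  next
    case nonneg
    have eq: "d + e + f = d + (e + f)" "e + (d + f) = d + (e + f)" by (simp_all add: ac_simps)
    show ?thesis
      unfolding jacobi_def
    proof (rule A_eqI_ad)
      show "br d K (e + f) (br e L f M) \<in> A (d + (e + f))"
        by (intro br_A[OF K br_A[OF L M]] refl)
      show "br (d + e) (br d K e L) f M + sg (ip (Suc n) d e) (br e L (d + f) (br d K f M))
          \<in> A (d + (e + f))"
        by (intro A_add A_sg br_A[OF br_A[OF K L] M] br_A[OF L br_A[OF K M]] eq[symmetric] refl)
      show "0 \<le> dfst (d + (e + f))" using nonneg by simp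
    next
      fix x X assume X: "X \<in> piece V x"
      define \<xi> where "\<xi> = dpair (-1) x"
      let ?ad = "\<lambda>d K. ad x X d K"
      let ?s = "\<lambda>d e. ip (Suc n) d e"
      note derivation = ad_br[OF _ _ X, folded \<xi>_def]
      have adK: "?ad d K \<in> A (\<xi> + d)" and adL: "?ad e L \<in> A (\<xi> + e)" and adM: "?ad f M \<in> A (\<xi> + f)"
        using ad_A[OF K X] ad_A[OF L X] ad_A[OF M X] by (simp_all add: \<xi>_def)
      have xi: "dfst \<xi> = -1" by (simp add: \<xi>_def)
      have JK: "jacobi (\<xi> + d) (?ad d K) e L f M"
        and JL: "jacobi d K (\<xi> + e) (?ad e L) f M"
        and JM: "jacobi d K e L (\<xi> + f) (?ad f M)"
        by (rule less.hyps; use nonneg xi K L M adK adL adM in simp)+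
      have KL: "br d K e L \<in> A (d + e)" and LM: "br e L f M \<in> A (e + f)" and KM: "br d K f M \<in> A (d + f)"
        using br_A[OF K L refl] br_A[OF L M refl] br_A[OF K M refl] by simp_all
      have aKL: "br (\<xi> + d) (?ad d K) e L \<in> A (\<xi> + (d + e))" "br d K (\<xi> + e) (?ad e L) \<in> A (\<xi> + (d + e))"
        and aLM: "br (\<xi> + e) (?ad e L) f M \<in> A (\<xi> + (e + f))" "br e L (\<xi> + f) (?ad f M) \<in> A (\<xi> + (e + f))"
        and aKM: "br (\<xi> + d) (?ad d K) f M \<in> A (\<xi> + (d + f))" "br d K (\<xi> + f) (?ad f M) \<in> A (\<xi> + (d + f))"
        by (rule br_A; use K L M adK adL adM in \<open>simp add: ac_simps\<close>)+
      have 1: "?ad (d + (e + f)) (br d K (e + f) (br e L f M)) =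
          br (\<xi> + d) (?ad d K) (e + f) (br e L f M) +
          sg (?s \<xi> d) (br d K (\<xi> + (e + f)) (br (\<xi> + e) (?ad e L) f M) +
            sg (?s \<xi> e) (br d K (\<xi> + (e + f)) (br e L (\<xi> + f) (?ad f M))))"
        unfolding derivation[OF K LM] derivation[OF L M]
          br_add_right[OF K aLM(1) A_sg[OF aLM(2)]] br_sg_right[OF K aLM(2)] ..
      have 2: "?ad (d + (e + f)) (br (d + e) (br d K e L) f M) =
          br (\<xi> + (d + e)) (br (\<xi> + d) (?ad d K) e L) f M
          + sg (?s \<xi> d) (br (\<xi> + (d + e)) (br d K (\<xi> + e) (?ad e L)) f M)
          + sg (?s \<xi> d + ?s \<xi> e) (br (d + e) (br d K e L) (\<xi> + f) (?ad f M))"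
        unfolding eq(1)[symmetric] derivation[OF KL M] derivation[OF K L]
          br_add_left[OF aKL(1) A_sg[OF aKL(2)] M] br_sg_left[OF aKL(2) M] ip_add_right ..
      have 3: "?ad (d + (e + f)) (br e L (d + f) (br d K f M)) =
          br (\<xi> + e) (?ad e L) (d + f) (br d K f M) +
          sg (?s \<xi> e) (br e L (\<xi> + (d + f)) (br (\<xi> + d) (?ad d K) f M) +
            sg (?s \<xi> d) (br e L (\<xi> + (d + f)) (br d K (\<xi> + f) (?ad f M))))"
        unfolding eq(2)[symmetric] derivation[OF L KM] derivation[OF K M]
          br_add_right[OF L aKM(1) A_sg[OF aKM(2)]] br_sg_right[OF L aKM(2)] ..
      have signs: "(a1 + sg (q + r) b1) + sg p ((a2 + sg (p + r) b2) + sg q (a3 + sg r b3)) =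
          (a1 + sg p a2 + sg (p + q) a3) + sg r (b2 + sg q (b1 + sg p b3))"
        for a1 a2 a3 b1 b2 b3 :: "'v list \<Rightarrow> 'v" and p q r :: int
        by (cases "even p"; cases "even q"; cases "even r"; simp add: sg_def algebra_simps)
      have assoc: "\<xi> + d + e = \<xi> + (d + e)" "d + (\<xi> + e) = \<xi> + (d + e)" "\<xi> + e + f = \<xi> + (e + f)"
        "e + (\<xi> + f) = \<xi> + (e + f)" "\<xi> + d + f = \<xi> + (d + f)" "d + (\<xi> + f) = \<xi> + (d + f)"
        by (simp_all add: ac_simps)
      note J = JK[unfolded jacobi_def assoc ip_add_left] JL[unfolded jacobi_def assoc ip_add_right]
        JM[unfolded jacobi_def assoc]
      show "?ad (d + (e + f)) (br d K (e + f) (br e L f M)) = ?ad (d + (e + f))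
          (br (d + e) (br d K e L) f M + sg (?s d e) (br e L (d + f) (br d K f M)))"
        unfolding ad_add ad_sg 1 2 3 J ip_commute[of "Suc n" d \<xi>] by (rule signs)
    qed
  qed
qed

end

section \<open>The graded Lie algebra \<open>A(V)\<close>\<close>

lemma sum_fun_eval: "(\<Sum>i\<in>I. f i) x = (\<Sum>i\<in>I. f i x)" for f :: "'i \<Rightarrow> 'b \<Rightarrow> 'c::ab_group_add"
  by (induction I rule: infinite_finite_induct) (auto simp: plus_fun_apply zero_fun_apply)

context graded_ground begin

abbreviation AV :: "('k, 'v, 'v multimaps) lie_over" where
  "AV \<equiv> A_alg n V"

definition single :: "deg \<Rightarrow> ('v list \<Rightarrow> 'v) \<Rightarrow> 'v multimaps" where
  "single d K = (\<lambda>_. 0)(d := K)"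

lemma single_apply: "single d K e = (if e = d then K else 0)"
  by (simp add: single_def)

lemma single_add: "single d (K + L) = single d K + single d L"
  by (rule ext) (simp add: plus_fun_apply[of _ _ "_ :: deg"] single_apply)

lemma single_minus: "single d (- K) = - single d K"
  by (rule ext) (simp add: single_apply)

lemma single_0 [simp]: "single d 0 = 0"
  by (rule ext) (simp add: single_apply zero_fun_apply[of "_ :: deg"])

lemma single_sg: "single d (sg a K) = sg a (single d K)"
  by (simp add: sg_def single_minus)

lemma smul_AV: "smul AV c P d = scale c (P d)"
  by (simp add: A_alg_def scale_def)

lemma piece_AV: "piece AV d = single d ` A d"
  by (auto simp: A_alg_def A_def single_def)

lemma single_scale: "single d (scale c K) = smul AV c (single d K)"
  by (rule ext) (simp add: smul_AV single_apply)

lemma A_sum: "(\<And>i. i \<in> I \<Longrightarrow> f i \<in> A d) \<Longrightarrow> sum f I \<in> A d"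
  by (induction I rule: infinite_finite_induct) auto

text \<open>
  Degrees of homogeneous arguments in \<open>\<int>\<^sup>n\<close> add up in \<open>\<int>\<^sup>n\<close>, so that the values have degrees outside
  \<open>\<int>\<^sup>n\<close>; and an argument of degree outside \<open>\<int>\<^sup>n\<close> is \<open>0\<close>.
\<close>
lemma A_outside:
  assumes "K \<in> A d" "dsnd d \<notin> Zn n"
  shows "K = 0"
proof (cases "dfst d < -1")
  case True
  with assms A_low show ?thesis by simp
next
  case False
  define m where "m = nat (dfst d + 1)"
  have K: "multilinear V m K" "homlin m (dsnd d) (tagged K)"
    using assms(1) False by (simp_all add: A_Alt Alt_def mlin_def m_def)
  have "K = (\<lambda>_. 0)"
  proof (rule multilinear_eqI[OF K(1) multilinear_zero])
    fix zs assume zs: "zs \<in> homs m"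
    show "tagged K zs = 0"
    proof (cases "set (map fst zs) \<subseteq> Zn n")
      case True
      then have "sum_list (map fst zs) \<in> Zn n"
        by (induction zs) (auto intro: Zn_add)
      then have "sum_list (map fst zs) + dsnd d \<notin> Zn n"
        using assms(2) by (auto simp: Zn_def plus_fun_apply)
      then show ?thesis using homlin_piece[OF K(2) zs] piece_outside by blast
    next
      case False
      then have "0 \<in> set (map snd zs)"
        using zs piece_outside by (force simp: homs_def)
      then show ?thesis by (rule multilinear_zero_arg[OF K(1)])
    qed
  qed
  then show ?thesis by (simp add: zero_fun_def)
qed

lemma vector_space_AV: "vector_space (smul AV)"
  by unfold_locales
    (auto simp: fun_eq_iff smul_AV scale_def plus_fun_apply vs.scale_right_distrib vs.scale_left_distrib)

lemma graded_space_AV: "graded_space (Suc n) AV"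
  unfolding graded_space_def
proof (intro conjI allI impI vector_space_AV)
  interpret S: vector_space "smul AV" by (rule vector_space_AV)
  fix d
  show "S.subspace (piece AV d)"
  proof (rule S.subspaceI)
    show "0 \<in> piece AV d" using single_0[of d] by (auto simp: piece_AV intro!: image_eqI[of 0 _ 0])
  next
    fix P Q assume "P \<in> piece AV d" "Q \<in> piece AV d"
    then show "P + Q \<in> piece AV d" by (auto simp: piece_AV single_add[symmetric])
  next
    fix c P assume "P \<in> piece AV d"
    then show "smul AV c P \<in> piece AV d" by (auto simp: piece_AV single_scale[symmetric])
  qed
next
  fix d assume "d \<notin> Zn (Suc n)"
  then have "A d = {0}" using A_outside[of _ d] by (auto simp: Zn_Suc)
  then show "piece AV d = {0}" by (simp add: piece_AV)
next
  fix I and f :: "deg \<Rightarrow> 'v multimaps"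
  assume f: "finite I \<and> (\<forall>d\<in>I. f d \<in> piece AV d) \<and> sum f I = 0"
  have fd: "f d = single d (f d d)" if "d \<in> I" for d
    using f that by (auto simp: piece_AV single_apply)
  show "\<forall>d\<in>I. f d = 0"
  proof
    fix d assume d: "d \<in> I"
    have "sum f I d = (\<Sum>e\<in>I. if e = d then f d d else 0)"
      unfolding sum_fun_eval[of f I d]
    proof (rule sum.cong[OF refl])
      fix e assume "e \<in> I"
      then have "f e d = single e (f e e) d" using fd by simp
      then show "f e d = (if e = d then f d d else 0)" by (auto simp: single_apply)
    qed
    then have "f d d = 0" using f d by (simp add: zero_fun_apply[of d])
    then show "f d = 0" using fd[OF d] by simp
  qed
qed

sublocale AV: graded "Suc n" AV
  by unfold_locales (rule graded_space_AV)

lemma total_AV: "total AV = {P. finite {d. P d \<noteq> 0} \<and> (\<forall>d. P d \<in> A d)}"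
proof (intro set_eqI iffI)
  fix P assume "P \<in> total AV"
  then have "finite {d. P d \<noteq> 0} \<and> (\<forall>d. P d \<in> A d)"
  proof (induction rule: AV.total_induct)
    case (piece d P)
    then obtain K where K: "P = single d K" "K \<in> A d" by (auto simp: piece_AV)
    have "{e. P e \<noteq> 0} \<subseteq> {d}" by (auto simp: K single_apply)
    then show ?case using K by (auto simp: single_apply intro: finite_subset)
  next
    case (add P Q)
    have "{d. (P + Q) d \<noteq> 0} \<subseteq> {d. P d \<noteq> 0} \<union> {d. Q d \<noteq> 0}"
      by (auto simp: plus_fun_apply[of P])
    with add show ?case by (auto simp: plus_fun_apply[of P] intro: finite_subset)
  qed
  then show "P \<in> {P. finite {d. P d \<noteq> 0} \<and> (\<forall>d. P d \<in> A d)}" by simp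
next
  fix P assume "P \<in> {P. finite {d. P d \<noteq> 0} \<and> (\<forall>d. P d \<in> A d)}"
  then have P: "finite {d. P d \<noteq> 0}" "\<And>d. P d \<in> A d" by auto
  have "P = (\<Sum>d | P d \<noteq> 0. single d (P d))"
  proof
    fix e
    show "P e = (\<Sum>d | P d \<noteq> 0. single d (P d)) e"
      unfolding sum_fun_eval[where x = e] using P(1) by (simp add: single_apply)
  qed
  also have "\<dots> \<in> total AV"
    using P(2) by (intro AV.total_sum AV.piece_total) (auto simp: piece_AV)
  finally show "P \<in> total AV" .
qed

lemma total_AV_component: "P \<in> total AV \<Longrightarrow> P d \<in> A d"
  and total_AV_finite: "P \<in> total AV \<Longrightarrow> finite {d. P d \<noteq> 0}"
  by (auto simp: total_AV)

text \<open>
  As for \<open>decomposition_on\<close>, any finite sets containing the supports can index the sum; additivity of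
  the bracket is then checked over a common index set.
\<close>
lemma brk_AV:
  assumes "P \<in> total AV" "Q \<in> total AV"
    and S: "finite S" "{d. P d \<noteq> 0} \<subseteq> S" and T: "finite T" "{d. Q d \<noteq> 0} \<subseteq> T"
  shows "brk AV P Q d = (\<Sum>(d1, d2)\<in>S \<times> T. if d1 + d2 = d then br d1 (P d1) d2 (Q d2) else 0)"
proof -
  note PQ = total_AV_component[OF assms(1)] total_AV_component[OF assms(2)]
  have "brk AV P Q d = (\<Sum>(d1, d2) | P d1 \<noteq> 0 \<and> Q d2 \<noteq> 0 \<and> d1 + d2 = d. br d1 (P d1) d2 (Q d2))"
    by (simp add: A_alg_def br_def)
  also have "\<dots> = (\<Sum>(d1, d2) | P d1 \<noteq> 0 \<and> Q d2 \<noteq> 0 \<and> d1 + d2 = d.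
      if d1 + d2 = d then br d1 (P d1) d2 (Q d2) else 0)"
    by (intro sum.cong) auto
  also have "\<dots> = (\<Sum>(d1, d2)\<in>S \<times> T. if d1 + d2 = d then br d1 (P d1) d2 (Q d2) else 0)"
    using S T PQ by (intro sum.mono_neutral_left) auto
  finally show ?thesis .
qed

lemma single_total: "K \<in> A d \<Longrightarrow> single d K \<in> total AV"
  by (rule AV.piece_total[of _ d]) (simp add: piece_AV)

lemma brk_single:
  assumes "K \<in> A d" "L \<in> A e"
  shows "brk AV (single d K) (single e L) = single (d + e) (br d K e L)"
proof
  fix f
  have "single d K \<in> total AV" "single e L \<in> total AV"
    using assms by (simp_all add: single_total)
  moreover have "{f. single d K f \<noteq> 0} \<subseteq> {d}" "{f. single e L f \<noteq> 0} \<subseteq> {e}"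
    by (auto simp: single_apply)
  ultimately show "brk AV (single d K) (single e L) f = single (d + e) (br d K e L) f"
    using brk_AV[of "single d K" "single e L" "{d}" "{e}" f] by (simp add: single_apply)
qed

lemma brk_AV_total:
  assumes "P \<in> total AV" "Q \<in> total AV"
  shows "brk AV P Q \<in> total AV"
  unfolding total_AV
proof (intro CollectI conjI allI)
  let ?S = "{d. P d \<noteq> 0}" and ?T = "{d. Q d \<noteq> 0}"
  note eq = brk_AV[OF assms total_AV_finite[OF assms(1)] order_refl total_AV_finite[OF assms(2)] order_refl]
  have "br a (P a) b (Q b) \<in> A (a + b)" for a b
    by (rule br_A[OF total_AV_component[OF assms(1)] total_AV_component[OF assms(2)] refl])
  then show "brk AV P Q d \<in> A d" for d
    unfolding eq by (intro A_sum) auto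
  have "{d. brk AV P Q d \<noteq> 0} \<subseteq> (\<lambda>(d1, d2). d1 + d2) ` (?S \<times> ?T)"
  proof
    fix d assume "d \<in> {d. brk AV P Q d \<noteq> 0}"
    then have "(\<Sum>(d1, d2)\<in>?S \<times> ?T. if d1 + d2 = d then br d1 (P d1) d2 (Q d2) else 0) \<noteq> 0"
      by (simp only: eq mem_Collect_eq not_False_eq_True)
    then obtain y where "y \<in> ?S \<times> ?T"
        "(case y of (d1, d2) \<Rightarrow> if d1 + d2 = d then br d1 (P d1) d2 (Q d2) else 0) \<noteq> 0"
      by (rule sum.not_neutral_contains_not_neutral)
    then show "d \<in> (\<lambda>(d1, d2). d1 + d2) ` (?S \<times> ?T)" by (force split: if_splits)
  qed
  then show "finite {d. brk AV P Q d \<noteq> 0}"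
    using total_AV_finite[OF assms(1)] total_AV_finite[OF assms(2)]
    by (auto intro: finite_subset)
qed

lemma brk_AV_add_left:
  assumes "P \<in> total AV" "P' \<in> total AV" "Q \<in> total AV"
  shows "brk AV (P + P') Q = brk AV P Q + brk AV P' Q"
proof
  fix d
  define S where "S = {d. P d \<noteq> 0} \<union> {d. P' d \<noteq> 0}"
  have S: "finite S" "{d. P d \<noteq> 0} \<subseteq> S" "{d. P' d \<noteq> 0} \<subseteq> S" "{d. (P + P') d \<noteq> 0} \<subseteq> S"
    using assms by (auto simp: S_def total_AV_finite plus_fun_apply[of P])
  note c = total_AV_component[OF assms(1)] total_AV_component[OF assms(2)] total_AV_component[OF assms(3)]
  have P: "P + P' \<in> total AV" using assms by blast
  note Q = total_AV_finite[OF assms(3)] order_refl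
  show "brk AV (P + P') Q d = (brk AV P Q + brk AV P' Q) d"
    unfolding plus_fun_apply[of "brk AV P Q"] brk_AV[OF P assms(3) S(1,4) Q]
      brk_AV[OF assms(1,3) S(1,2) Q] brk_AV[OF assms(2,3) S(1,3) Q] sum.distrib[symmetric]
    by (intro sum.cong) (auto simp: plus_fun_apply[of P] br_add_left c)
qed

lemma brk_AV_add_right:
  assumes "P \<in> total AV" "Q \<in> total AV" "Q' \<in> total AV"
  shows "brk AV P (Q + Q') = brk AV P Q + brk AV P Q'"
proof
  fix d
  define S where "S = {d. Q d \<noteq> 0} \<union> {d. Q' d \<noteq> 0}"
  have S: "finite S" "{d. Q d \<noteq> 0} \<subseteq> S" "{d. Q' d \<noteq> 0} \<subseteq> S" "{d. (Q + Q') d \<noteq> 0} \<subseteq> S"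
    using assms by (auto simp: S_def total_AV_finite plus_fun_apply[of Q])
  note c = total_AV_component[OF assms(1)] total_AV_component[OF assms(2)] total_AV_component[OF assms(3)]
  have Q: "Q + Q' \<in> total AV" using assms by blast
  note P = total_AV_finite[OF assms(1)] order_refl
  show "brk AV P (Q + Q') d = (brk AV P Q + brk AV P Q') d"
    unfolding plus_fun_apply[of "brk AV P Q"] brk_AV[OF assms(1) Q P S(1,4)]
      brk_AV[OF assms(1,2) P S(1,2)] brk_AV[OF assms(1,3) P S(1,3)] sum.distrib[symmetric]
    by (intro sum.cong) (auto simp: plus_fun_apply[of Q] br_add_right c)
qed

lemma scale_sum: "scale c (sum f I) = (\<Sum>i\<in>I. scale c (f i))"
  by (induction I rule: infinite_finite_induct) (auto simp: scale_add)

lemma brk_AV_smul: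
  assumes "P \<in> total AV" "Q \<in> total AV"
  shows "brk AV (smul AV c P) Q = smul AV c (brk AV P Q)"
    and "brk AV P (smul AV c Q) = smul AV c (brk AV P Q)"
proof -
  note c = total_AV_component[OF assms(1)] total_AV_component[OF assms(2)]
  note fin = total_AV_finite[OF assms(1)] total_AV_finite[OF assms(2)]
  have cP: "smul AV c P \<in> total AV" "{d. smul AV c P d \<noteq> 0} \<subseteq> {d. P d \<noteq> 0}"
    and cQ: "smul AV c Q \<in> total AV" "{d. smul AV c Q d \<noteq> 0} \<subseteq> {d. Q d \<noteq> 0}"
    using assms by (auto simp: smul_AV)
  show "brk AV (smul AV c P) Q = smul AV c (brk AV P Q)"
  proof
    fix d
    show "brk AV (smul AV c P) Q d = smul AV c (brk AV P Q) d"
      unfolding smul_AV brk_AV[OF cP(1) assms(2) fin(1) cP(2) fin(2) order_refl]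
        brk_AV[OF assms fin(1) order_refl fin(2) order_refl] scale_sum
      by (intro sum.cong) (auto simp: smul_AV br_scale_left c)
  qed
  show "brk AV P (smul AV c Q) = smul AV c (brk AV P Q)"
  proof
    fix d
    show "brk AV P (smul AV c Q) d = smul AV c (brk AV P Q) d"
      unfolding smul_AV brk_AV[OF assms(1) cQ(1) fin(1) order_refl fin(2) cQ(2)]
        brk_AV[OF assms fin(1) order_refl fin(2) order_refl] scale_sum
      by (intro sum.cong) (auto simp: smul_AV br_scale_right c)
  qed
qed

text \<open>
  Homogeneous elements are concentrated in one degree, so each axiom reduces to the corresponding
  property of \<^const>\<open>br\<close>.
\<close>
lemma graded_lie_algebra_AV: "graded_lie_algebra (Suc n) AV"
  unfolding graded_lie_algebra_def
proof (intro conjI ballI graded_space_AV)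
  fix P assume P: "P \<in> total AV"
  show "linear_total AV AV (brk AV P)" "linear_total AV AV (\<lambda>Q. brk AV Q P)"
    using P by (auto simp: linear_total_def brk_AV_total brk_AV_add_left brk_AV_add_right brk_AV_smul)
next
  fix d e P Q assume "P \<in> piece AV d" "Q \<in> piece AV e"
  then obtain K L where K: "P = single d K" "K \<in> A d" and L: "Q = single e L" "L \<in> A e"
    by (auto simp: piece_AV)
  show "brk AV P Q \<in> piece AV (d + e)"
    using K L by (auto simp: brk_single piece_AV intro!: br_A)
  show "brk AV P Q = - smul AV ((-1) powi ip (Suc n) d e) (brk AV Q P)"
    unfolding AV.smul_sign K(1) L(1) brk_single[OF K(2) L(2)] brk_single[OF L(2) K(2)]
    by (subst br_antisym) (simp add: single_minus single_sg add.commute[of e])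
next
  fix d e f P Q R assume "P \<in> piece AV d" "Q \<in> piece AV e" "R \<in> piece AV f"
  then obtain K L M where K: "P = single d K" "K \<in> A d" and L: "Q = single e L" "L \<in> A e"
    and M: "R = single f M" "M \<in> A f"
    by (auto simp: piece_AV)
  note KL = br_A[OF K(2) L(2) refl] and LM = br_A[OF L(2) M(2) refl] and KM = br_A[OF K(2) M(2) refl]
  have "single (d + (e + f)) (br d K (e + f) (br e L f M)) =
      single (d + e + f) (br (d + e) (br d K e L) f M)
      + sg (ip (Suc n) d e) (single (e + (d + f)) (br e L (d + f) (br d K f M)))"
    unfolding jacobi_all[OF K(2) L(2) M(2), unfolded jacobi_def]
    by (simp add: single_add single_sg ac_simps)
  then show "brk AV P (brk AV Q R) =
      brk AV (brk AV P Q) R + smul AV ((-1) powi ip (Suc n) d e) (brk AV Q (brk AV P R))"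
    unfolding AV.smul_sign K(1) L(1) M(1)
    by (simp only: brk_single K(2) L(2) M(2) KL LM KM)
qed

definition const :: "'v \<Rightarrow> 'v list \<Rightarrow> 'v" where
  "const v = (\<lambda>Xs. if Xs = [] then v else 0)"

lemma A_V: "A (dpair (-1) x) = const ` piece V x"
proof -
  have "multilinear V 0 K \<longleftrightarrow> K [] \<in> total V \<and> K = const (K [])" for K
    by (auto simp: multilinear_0_iff const_def fun_eq_iff)
  then have "A (dpair (-1) x) = {K. K [] \<in> total V \<and> K = const (K []) \<and> K [] \<in> piece V x}"
    by (auto simp: A_Alt Alt_def mlin_def alternating_def)
  also have "\<dots> = const ` piece V x"
    by (auto simp: const_def)
  finally show ?thesis .
qed

lemma const_0 [simp]: "const 0 = 0"
  by (simp add: const_def fun_eq_iff zero_fun_apply)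

lemma emb_AV: "emb AV v d = (if dfst d = -1 then const (hcomp V (dsnd d) v) else 0)"
  by (simp add: A_alg_def const_def fun_eq_iff zero_fun_apply)

lemma emb_AV_piece: "X \<in> piece V x \<Longrightarrow> emb AV X = single (dpair (-1) x) (const X)"
proof
  fix d assume X: "X \<in> piece V x"
  have "dfst d = -1 \<and> dsnd d = x \<longleftrightarrow> d = dpair (-1) x" by (metis dfst_dpair dsnd_dpair dpair_dfst_dsnd)
  then show "emb AV X d = single (dpair (-1) x) (const X) d"
    using X by (auto simp: emb_AV hcomp_homogeneous single_apply)
qed

lemma obj_E_AV: "obj_E n V AV"
  unfolding obj_E_def
proof (intro conjI graded_lie_algebra_AV allI impI ballI)
  fix k :: int and \<kappa> assume "k < -1"
  then show "piece AV (dpair k \<kappa>) = {0}"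
    using A_low[of "dpair k \<kappa>"] by (simp add: piece_AV)
next
  show "linear_total V AV (emb AV)"
    unfolding linear_total_def
  proof (intro conjI ballI allI)
    show "emb AV \<in> total V \<rightarrow> total AV"
    proof
      fix v assume v: "v \<in> total V"
      have "{d. emb AV v d \<noteq> 0} \<subseteq> dpair (-1) ` {x. hcomp V x v \<noteq> 0}"
      proof
        fix d assume "d \<in> {d. emb AV v d \<noteq> 0}"
        then have "dfst d = -1" "hcomp V (dsnd d) v \<noteq> 0" by (auto simp: emb_AV split: if_splits)
        then show "d \<in> dpair (-1) ` {x. hcomp V x v \<noteq> 0}"
          by (intro image_eqI[of _ _ "dsnd d"]) (metis dpair_dfst_dsnd, simp)
      qed
      then have "finite {d. emb AV v d \<noteq> 0}"
        using finite_hcomp[OF v] by (auto intro: finite_subset)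
      moreover have "emb AV v d \<in> A d" for d
      proof (cases "dfst d = -1")
        case True
        then have "d = dpair (-1) (dsnd d)" by (metis dpair_dfst_dsnd)
        then have "A d = const ` piece V (dsnd d)" using A_V by metis
        then show ?thesis using v by (simp add: emb_AV True)
      qed (simp add: emb_AV)
      ultimately show "emb AV v \<in> total AV" by (simp add: total_AV)
    qed
  next
    fix u v assume "u \<in> total V" "v \<in> total V"
    then show "emb AV (u + v) = emb AV u + emb AV v"
      by (auto simp: fun_eq_iff emb_AV plus_fun_apply zero_fun_apply hcomp_add const_def)
  next
    fix c v assume "v \<in> total V"
    then show "emb AV (smul V c v) = smul AV c (emb AV v)"
      by (auto simp: fun_eq_iff emb_AV smul_AV scale_def zero_fun_apply hcomp_smul const_def)
  qed
next
  fix x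
  show "bij_betw (emb AV) (piece V x) (piece AV (dpair (-1) x))"
  proof (rule bij_betw_imageI)
    show "inj_on (emb AV) (piece V x)"
    proof (rule inj_onI)
      fix X Y assume "X \<in> piece V x" "Y \<in> piece V x" "emb AV X = emb AV Y"
      then have "single (dpair (-1) x) (const X) (dpair (-1) x) [] =
          single (dpair (-1) x) (const Y) (dpair (-1) x) []"
        by (simp add: emb_AV_piece)
      then show "X = Y" by (simp add: single_apply const_def)
    qed
    show "emb AV ` piece V x = piece AV (dpair (-1) x)"
      unfolding piece_AV A_V image_image by (rule image_cong) (auto simp: emb_AV_piece)
  qed
qed

end

section \<open>Objects over \<open>V\<close> and iterated brackets with \<open>V\<close>\<close>

locale lie_object = graded_ground n V
  for n :: nat and V :: "('k::field_char_0, 'v::ab_group_add) graded_vs" +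
  fixes E :: "('k, 'v, 'e::ab_group_add) lie_over"
  assumes obj: "obj_E n V E"
begin

lemma lie: "graded_lie_algebra (Suc n) E"
  using obj by (simp add: obj_E_def)

sublocale E: graded "Suc n" E
  using lie by unfold_locales (simp add: graded_lie_algebra_def)

lemma linear_brk:
  "P \<in> total E \<Longrightarrow> linear_total E E (brk E P)"
  "P \<in> total E \<Longrightarrow> linear_total E E (\<lambda>Q. brk E Q P)"
  using lie by (simp_all add: graded_lie_algebra_def)

lemma brk_total: "P \<in> total E \<Longrightarrow> Q \<in> total E \<Longrightarrow> brk E P Q \<in> total E"
  using linear_brk(1)[of P] by (auto simp: linear_total_def)

lemma brk_add:
  assumes "P \<in> total E" "Q \<in> total E" "R \<in> total E"
  shows "brk E (P + Q) R = brk E P R + brk E Q R" "brk E P (Q + R) = brk E P Q + brk E P R"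
  using linear_brk(1)[OF assms(1)] linear_brk(2)[OF assms(3)] assms by (simp_all add: linear_total_def)

lemma brk_smul:
  assumes "P \<in> total E" "Q \<in> total E"
  shows "brk E (smul E c P) Q = smul E c (brk E P Q)" "brk E P (smul E c Q) = smul E c (brk E P Q)"
  using linear_brk(1)[OF assms(1)] linear_brk(2)[OF assms(2)] assms by (simp_all add: linear_total_def)

lemma brk_0: "P \<in> total E \<Longrightarrow> brk E 0 P = 0" "P \<in> total E \<Longrightarrow> brk E P 0 = 0"
  using brk_smul(1)[of 0 P 0] brk_smul(2)[of P 0 0] by simp_all

text \<open>
  The axioms quantify over degrees in \<open>\<int>\<^bsup>n+1\<^esup>\<close>.  In all other degrees the pieces are zero, so that this and
  the two following laws extend to all degrees.
\<close>
lemma brk_piece: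
  assumes "P \<in> piece E d" "Q \<in> piece E e" "f = d + e"
  shows "brk E P Q \<in> piece E f"
proof (cases "d \<in> Zn (Suc n) \<and> e \<in> Zn (Suc n)")
  case True
  then show ?thesis using lie assms by (simp add: graded_lie_algebra_def)
next
  case False
  then have "P = 0 \<or> Q = 0" using assms E.piece_outside by blast
  then have "brk E P Q = 0" using brk_0 assms E.piece_total by blast
  then show ?thesis by simp
qed

lemma brk_antisym:
  assumes "P \<in> piece E d" "Q \<in> piece E e"
  shows "brk E P Q = - sg (ip (Suc n) d e) (brk E Q P)"
proof (cases "d \<in> Zn (Suc n) \<and> e \<in> Zn (Suc n)")
  case True
  then show ?thesis using lie assms by (simp add: graded_lie_algebra_def E.smul_sign)
next
  case False
  then have "P = 0 \<or> Q = 0" using assms E.piece_outside by blast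
  then show ?thesis using brk_0 assms E.piece_total by auto
qed

lemma brk_jacobi:
  assumes "P \<in> piece E d" "Q \<in> piece E e" "R \<in> piece E f"
  shows "brk E P (brk E Q R) = brk E (brk E P Q) R + sg (ip (Suc n) d e) (brk E Q (brk E P R))"
proof (cases "d \<in> Zn (Suc n) \<and> e \<in> Zn (Suc n) \<and> f \<in> Zn (Suc n)")
  case True
  then show ?thesis
    using lie assms unfolding graded_lie_algebra_def E.smul_sign by blast
next
  case False
  note t = E.piece_total[OF assms(1)] E.piece_total[OF assms(2)] E.piece_total[OF assms(3)]
  from False have "P = 0 \<or> Q = 0 \<or> R = 0" using assms E.piece_outside by blast
  then show ?thesis
    using t brk_total[OF t(1,2)] brk_total[OF t(2,3)] brk_total[OF t(1,3)] by (auto simp: brk_0)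
qed

lemma piece_low: "dfst d < -1 \<Longrightarrow> piece E d = {0}"
proof (cases "dsnd d \<in> Zn n")
  case True
  assume "dfst d < -1"
  with True have "piece E (dpair (dfst d) (dsnd d)) = {0}" using obj unfolding obj_E_def by blast
  then show ?thesis by simp
next
  case False
  then show ?thesis using E.piece_outside[of d] by (auto simp: Zn_Suc)
qed

lemma linear_emb: "linear_total V E (emb E)"
  using obj by (simp add: obj_E_def)

lemma emb_add: "X \<in> total V \<Longrightarrow> Y \<in> total V \<Longrightarrow> emb E (X + Y) = emb E X + emb E Y"
  and emb_smul: "X \<in> total V \<Longrightarrow> emb E (smul V c X) = smul E c (emb E X)"
  and emb_total: "X \<in> total V \<Longrightarrow> emb E X \<in> total E"
  using linear_emb by (auto simp: linear_total_def)

lemma emb_0: "emb E 0 = 0"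
  by (rule linear_total_0[OF linear_emb]) (rule vs.vector_space_axioms E.vs.vector_space_axioms)+

lemma bij_emb: "bij_betw (emb E) (piece V x) (piece E (dpair (-1) x))"
proof (cases "x \<in> Zn n")
  case True
  then show ?thesis using obj by (simp add: obj_E_def)
next
  case False
  then have "piece V x = {0}" "piece E (dpair (-1) x) = {0}"
    using piece_outside E.piece_outside[of "dpair (-1) x"] by (auto simp: Zn_Suc)
  then show ?thesis by (simp add: bij_betw_def emb_0)
qed

lemma emb_piece: "X \<in> piece V x \<Longrightarrow> emb E X \<in> piece E (dpair (-1) x)"
  using bij_emb bij_betwE by blast

definition unemb :: "deg \<Rightarrow> 'e \<Rightarrow> 'v" where
  "unemb x = the_inv_into (piece V x) (emb E)"

lemma unemb_emb: "X \<in> piece V x \<Longrightarrow> unemb x (emb E X) = X"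
  using bij_emb[of x] by (simp add: unemb_def the_inv_into_f_f bij_betw_def)

lemma piece_emb_cases:
  assumes "P \<in> piece E (dpair (-1) x)"
  obtains X where "X \<in> piece V x" "P = emb E X"
  using assms bij_betw_imp_surj_on[OF bij_emb[of x]] by blast

definition contract :: "'v \<Rightarrow> 'e \<Rightarrow> 'e" where
  "contract X P = brk E (emb E X) P"

lemma contract_piece:
  "P \<in> piece E d \<Longrightarrow> X \<in> piece V x \<Longrightarrow> e = d + dpair (-1) x \<Longrightarrow> contract X P \<in> piece E e"
  unfolding contract_def by (rule brk_piece[OF emb_piece]) (auto simp: add.commute)

text \<open>
  The bracket \<open>[X, Y]\<close> has degree \<open>(-2, *)\<close> and vanishes, hence the Jacobi identity loses one of
  its terms.
\<close>
lemma contract_swap: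
  assumes "X \<in> piece V x" "Y \<in> piece V y" "P \<in> piece E d"
  shows "contract X (contract Y P) = sg (1 + ip n x y) (contract Y (contract X P))"
proof -
  have "brk E (emb E X) (emb E Y) \<in> piece E (dpair (-1) x + dpair (-1) y)"
    by (rule brk_piece[OF emb_piece[OF assms(1)] emb_piece[OF assms(2)] refl])
  moreover have "dfst (dpair (-1) x + dpair (-1) y) < -1" by simp
  ultimately have "brk E (emb E X) (emb E Y) = 0"
    using piece_low by blast
  then show ?thesis
    using brk_jacobi[OF emb_piece[OF assms(1)] emb_piece[OF assms(2)] assms(3)] assms(3)
    by (simp add: contract_def brk_0 E.piece_total ip_Suc)
qed

text \<open>
  The value of \<open>\<epsilon>(P)\<close> at homogeneous arguments, forced by \<open>[X, \<epsilon>(P)] = \<epsilon>([X, P])\<close> and by \<open>\<epsilon>\<close> being the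
  identity on \<open>V\<close>.  After \<open>k + 1\<close> brackets an element of degree \<open>(k, *)\<close> has arrived in \<open>E\<^bsup>(-1,*)\<^esup> = V\<close>.
\<close>
fun ev :: "deg \<Rightarrow> 'e \<Rightarrow> (deg \<times> 'v) list \<Rightarrow> 'v" where
  "ev d P [] = unemb (dsnd d) P"
| "ev d P ((x, X) # zs) = sg (ip n x (dsnd d)) (ev (d + dpair (-1) x) (contract X P) zs)"

lemma ev_linear:
  assumes "P \<in> piece E d" "Q \<in> piece E d" "dfst d = int m - 1" "zs \<in> homs m"
  shows "ev d (P + smul E c Q) zs = ev d P zs + smul V c (ev d Q zs)"
  using assms
proof (induction m arbitrary: d P Q zs)
  case 0
  then have d: "d = dpair (-1) (dsnd d)" by (metis dpair_dfst_dsnd diff_0 of_nat_0)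
  obtain X Y where X: "X \<in> piece V (dsnd d)" "P = emb E X" and Y: "Y \<in> piece V (dsnd d)" "Q = emb E Y"
    using 0(1,2) piece_emb_cases d by metis
  have "P + smul E c Q = emb E (X + smul V c Y)"
    using X Y by (simp add: emb_add emb_smul piece_total total_scale)
  then show ?case using 0(4) X Y by (simp add: unemb_emb)
next
  case (Suc m)
  obtain x X ys where zs: "zs = (x, X) # ys" "X \<in> piece V x" "ys \<in> homs m"
    using Suc.prems(4) by (auto simp: homs_Suc)
  have "contract X (P + smul E c Q) = contract X P + smul E c (contract X Q)"
    using Suc.prems(1,2) zs(2) unfolding contract_def
    by (simp add: brk_add(2) brk_smul(2) emb_total piece_total E.piece_total E.total_scale)
  moreover have "ev (d + dpair (-1) x) (contract X P + smul E c (contract X Q)) ys =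
      ev (d + dpair (-1) x) (contract X P) ys + smul V c (ev (d + dpair (-1) x) (contract X Q) ys)"
    by (rule Suc.IH) (use Suc.prems zs in \<open>auto intro: contract_piece\<close>)
  ultimately show ?case by (simp add: zs sg_add sg_smul)
qed

lemma ev_sg:
  "P \<in> piece E d \<Longrightarrow> dfst d = int m - 1 \<Longrightarrow> zs \<in> homs m \<Longrightarrow> ev d (sg a P) zs = sg a (ev d P zs)"
  using ev_linear[of 0 d P m zs "(-1) powi a"] ev_linear[of 0 d 0 m zs "-1"]
  by (simp add: E.smul_sign smul_sign)

lemma homlin_ev:
  assumes "P \<in> piece E d" "dfst d = int m - 1"
  shows "homlin m (dsnd d) (ev d P)"
  using assms
proof (induction m arbitrary: d P)
  case 0
  then have d: "d = dpair (-1) (dsnd d)" by (metis dpair_dfst_dsnd diff_0 of_nat_0)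
  obtain X where "X \<in> piece V (dsnd d)" "P = emb E X"
    using 0(1) piece_emb_cases d by metis
  then show ?case by (simp add: unemb_emb)
next
  case (Suc m)
  have deg: "dfst (d + dpair (-1) x) = int m - 1" for x using Suc.prems(2) by simp
  show ?case
    unfolding homlin.simps(2)
  proof (intro conjI allI ballI)
    fix x X assume X: "X \<in> piece V x"
    have "homlin m (dsnd (d + dpair (-1) x)) (ev (d + dpair (-1) x) (contract X P))"
      by (rule Suc.IH[OF contract_piece[OF Suc.prems(1) X refl] deg])
    then show "homlin m (dsnd d + x) (\<lambda>zs. ev d P ((x, X) # zs))"
      by (simp add: homlin_sg)
  next
    fix x c B C zs assume BC: "B \<in> piece V x" "C \<in> piece V x" and zs: "zs \<in> homs m"
    have "contract (B + smul V c C) P = contract B P + smul E c (contract C P)"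
      using BC Suc.prems(1) unfolding contract_def
      by (simp add: emb_add emb_smul piece_total total_scale brk_add(1) brk_smul(1) emb_total
          E.piece_total E.total_scale)
    then show "ev d P ((x, B + smul V c C) # zs) = ev d P ((x, B) # zs) + smul V c (ev d P ((x, C) # zs))"
      using ev_linear[OF contract_piece[OF Suc.prems(1) BC(1) refl] contract_piece[OF Suc.prems(1) BC(2) refl] deg zs]
      by (simp add: sg_add sg_smul)
  qed
qed

text \<open>
  Transposing two neighbouring arguments transposes two successive brackets.
\<close>
lemma alternating_ev:
  assumes "P \<in> piece E d" "dfst d = int m - 1"
  shows "alternating m (ev d P)"
proof -
  have "ev d P (us @ a # b # vs) = sg (1 + ip n (fst a) (fst b)) (ev d P (us @ b # a # vs))"
    if "us @ a # b # vs \<in> homs m" for us a b vs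
    using that assms
  proof (induction us arbitrary: d P m)
    case Nil
    obtain x X y Y where ab: "a = (x, X)" "b = (y, Y)" by (cases a; cases b)
    obtain j where m: "m = Suc (Suc j)" using Nil.prems(1) by (auto simp: homs_def)
    have h: "X \<in> piece V x" "Y \<in> piece V y" "vs \<in> homs j"
      using Nil.prems(1) by (simp_all add: ab m)
    let ?e = "d + dpair (-1) y + dpair (-1) x"
    have e: "d + dpair (-1) x + dpair (-1) y = ?e" by (simp add: ac_simps)
    have "contract X (contract Y P) \<in> piece E ?e"
      by (intro contract_piece[OF contract_piece[OF Nil.prems(2) h(2) refl] h(1) refl])
    moreover have "dfst ?e = int j - 1" using Nil.prems(3) m by simp
    ultimately have "ev ?e (contract Y (contract X P)) vs =
        sg (1 + ip n y x) (ev ?e (contract X (contract Y P)) vs)"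
      unfolding contract_swap[OF h(2,1) Nil.prems(2)] using h(3) by (rule ev_sg)
    then have "ev d P (a # b # vs) = sg (ip n x (dsnd d) + (ip n y (dsnd d) + ip n y x) + (1 + ip n y x))
        (ev ?e (contract X (contract Y P)) vs)"
      by (simp add: ab e sg_sg ip_add_right ac_simps)
    moreover have "ev d P (b # a # vs) = sg (ip n y (dsnd d) + (ip n x (dsnd d) + ip n x y))
        (ev ?e (contract X (contract Y P)) vs)"
      by (simp add: ab sg_sg ip_add_right)
    ultimately show ?case
      by (simp add: ab sg_sg ip_commute[of n y x]) (rule sg_cong, simp)
  next
    case (Cons u us)
    obtain x X where u: "u = (x, X)" by (cases u)
    obtain j where m: "m = Suc j" using Cons.prems(1) by (auto simp: homs_def)
    have h: "X \<in> piece V x" "us @ a # b # vs \<in> homs j" using Cons.prems(1) by (simp_all add: u m)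
    have "ev (d + dpair (-1) x) (contract X P) (us @ a # b # vs) =
        sg (1 + ip n (fst a) (fst b)) (ev (d + dpair (-1) x) (contract X P) (us @ b # a # vs))"
      by (rule Cons.IH[OF h(2) contract_piece[OF Cons.prems(2) h(1) refl]])
        (use Cons.prems(3) m in simp)
    then show ?case by (simp add: u sg_sg add.commute)
  qed
  then show ?thesis unfolding alternating_def by blast
qed

text \<open>
  The homogeneous part of \<open>\<epsilon>\<close> in degree \<open>d\<close>.
\<close>
definition comp :: "deg \<Rightarrow> 'e \<Rightarrow> 'v list \<Rightarrow> 'v" where
  "comp d P = (if dfst d < -1 then 0 else extend (nat (dfst d + 1)) (ev d P))"

lemma comp_A: "P \<in> piece E d \<Longrightarrow> comp d P \<in> A d"
  and comp_tagged: "P \<in> piece E d \<Longrightarrow> -1 \<le> dfst d \<Longrightarrow> zs \<in> homs (nat (dfst d + 1)) \<Longrightarrow>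
    tagged (comp d P) zs = ev d P zs"
proof -
  assume P: "P \<in> piece E d"
  let ?m = "nat (dfst d + 1)"
  have ev: "homlin ?m (dsnd d) (ev d P)" "alternating ?m (ev d P)" if "-1 \<le> dfst d"
    using homlin_ev[OF P, of ?m] alternating_ev[OF P, of ?m] that by simp_all
  show "comp d P \<in> A d"
  proof (cases "dfst d < -1")
    case False
    then have "alternating ?m (tagged (extend ?m (ev d P))) = alternating ?m (ev d P)"
      using ev(1) by (intro alternating_cong extend_tagged) auto
    then show ?thesis
      using ev extend_mlin[OF ev(1)] False by (simp add: comp_def A_Alt Alt_def)
  qed (simp add: comp_def)
  show "-1 \<le> dfst d \<Longrightarrow> zs \<in> homs ?m \<Longrightarrow> tagged (comp d P) zs = ev d P zs"
    using ev extend_tagged by (simp add: comp_def)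
qed

lemma comp_linear:
  assumes "P \<in> piece E d" "Q \<in> piece E d"
  shows "comp d (P + smul E c Q) = comp d P + scale c (comp d Q)"
proof (cases "dfst d < -1")
  case False
  then have d: "-1 \<le> dfst d" "dfst d = int (nat (dfst d + 1)) - 1" by simp_all
  show ?thesis
  proof (rule A_eqI_tagged[OF _ _ d(1)])
    fix zs assume zs: "zs \<in> homs (nat (dfst d + 1))"
    show "tagged (comp d (P + smul E c Q)) zs = tagged (comp d P + scale c (comp d Q)) zs"
      using ev_linear[OF assms d(2) zs] assms d(1) zs
      by (simp add: comp_tagged scale_def plus_fun_apply[of _ _ "map snd zs"])
  qed (use assms comp_A in \<open>auto intro!: A_add A_scale\<close>)
qed (simp add: comp_def)

lemma comp_add: "P \<in> piece E d \<Longrightarrow> Q \<in> piece E d \<Longrightarrow> comp d (P + Q) = comp d P + comp d Q"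
  and comp_smul: "P \<in> piece E d \<Longrightarrow> comp d (smul E c P) = scale c (comp d P)"
  using comp_linear[of P d Q 1] comp_linear[of P d P "c - 1"]
  by (simp_all add: scale_1 scale_minus_1 E.vs.scale_left_diff_distrib)

lemma comp_sg: "P \<in> piece E d \<Longrightarrow> comp d (sg a P) = sg a (comp d P)"
  using comp_smul[of P d "(-1) powi a"] by (simp add: E.smul_sign scale_sign)

lemma comp_0 [simp]: "comp d 0 = 0"
proof -
  have "comp d (smul E 0 0) = scale 0 (comp d 0)" by (rule comp_smul) simp
  then show ?thesis by (simp add: scale_def fun_eq_iff zero_fun_apply)
qed

text \<open>
  The first step of the recursion for \<^const>\<open>ev\<close>: the signs in \<^const>\<open>ad\<close> and in \<^const>\<open>ev\<close> cancel.
\<close>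
lemma ad_comp:
  assumes "P \<in> piece E d" "X \<in> piece V x" "e = dpair (-1) x + d"
  shows "ad x X d (comp d P) = comp e (contract X P)"
proof (cases "dfst d \<le> -1")
  case True
  then show ?thesis using ad_low[OF comp_A[OF assms(1)]] assms(3) by (simp add: comp_def)
next
  case False
  have cP: "contract X P \<in> piece E e"
    using contract_piece[OF assms(1,2)] assms(3) by (simp add: add.commute)
  have e: "-1 \<le> dfst e" and m: "nat (dfst d + 1) = Suc (nat (dfst e + 1))"
    using False assms(3) by simp_all
  show ?thesis
  proof (rule A_eqI_tagged[OF ad_A[OF comp_A[OF assms(1)] assms(2,3)] comp_A[OF cP] e])
    fix zs assume zs: "zs \<in> homs (nat (dfst e + 1))"
    then have "(x, X) # zs \<in> homs (nat (dfst d + 1))" using m assms(2) by simp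
    from comp_tagged[OF assms(1) _ this] False
    have "comp d P (X # map snd zs) = sg (ip n x (dsnd d)) (ev e (contract X P) zs)"
      by (simp add: assms(3) add.commute)
    then show "tagged (ad x X d (comp d P)) zs = tagged (comp e (contract X P)) zs"
      using comp_tagged[OF cP e zs]
      by (simp add: ad_def con_def sg_apply) (simp add: sg_def)
  qed
qed

lemma comp_emb:
  assumes "X \<in> piece V x"
  shows "comp (dpair (-1) x) (emb E X) = const X"
proof (rule A_eqI_tagged)
  show "comp (dpair (-1) x) (emb E X) \<in> A (dpair (-1) x)" by (rule comp_A[OF emb_piece[OF assms]])
  show "const X \<in> A (dpair (-1) x)" using assms by (simp add: A_V)
  fix zs assume zs: "zs \<in> homs (nat (dfst (dpair (-1) x) + 1))"
  show "tagged (comp (dpair (-1) x) (emb E X)) zs = tagged (const X) zs"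
    using comp_tagged[OF emb_piece[OF assms] _ zs] zs assms by (simp add: unemb_emb const_def)
qed simp

text \<open>
  Induction on the total degree.  If \<open>P\<close> or \<open>Q\<close> lies in \<open>V\<close>, the claim is \<open>ad_comp\<close> up to antisymmetry.
  Otherwise both sides are elements of nonnegative degree and may be contracted with \<open>X\<close>; since \<open>[X, _]\<close> is a
  derivation in \<open>E\<close> and in \<open>A(V)\<close>, the contractions agree by the induction hypothesis.
\<close>
lemma comp_brk:
  assumes "P \<in> piece E d" "Q \<in> piece E e"
  shows "comp (d + e) (brk E P Q) = br d (comp d P) e (comp e Q)"
  using assms
proof (induction "nat (dfst d + dfst e + 2)" arbitrary: d e P Q rule: less_induct)
  case less
  note P = less.prems(1) and Q = less.prems(2)
  note PQ = brk_piece[OF P Q refl] and KP = comp_A[OF P] and KQ = comp_A[OF Q]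
  have V: "comp (f + g) (brk E R S) = br f (comp f R) g (comp g S)"
    if R: "R \<in> piece E f" "dfst f = -1" and S: "S \<in> piece E g" for f g R S
  proof -
    have f: "f = dpair (-1) (dsnd f)" using R(2) by (metis dpair_dfst_dsnd)
    then obtain X where X: "X \<in> piece V (dsnd f)" "R = emb E X"
      using R(1) piece_emb_cases by metis
    have cX: "comp f R = const X" using comp_emb[OF X(1)] X(2) f by simp
    have "const X \<in> A (dpair (-1) (dsnd f))" using X(1) by (simp add: A_V)
    from br_V[OF this comp_A[OF S]]
    have "br f (comp f R) g (comp g S) = ad (dsnd f) X g (comp g S)"
      using cX f by (simp add: const_def)
    then show ?thesis
      using ad_comp[OF S X(1), of "f + g"] f by (simp add: contract_def X(2))
  qed
  consider "dfst d < -1" | "dfst e < -1" | "dfst d = -1" | "dfst e = -1"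
    | (nonneg) "0 \<le> dfst d" "0 \<le> dfst e" by linarith
  then show ?case
  proof cases
    case 1
    then have "P = 0" using P piece_low by blast
    then show ?thesis using KQ Q by (simp add: brk_0 E.piece_total)
  next
    case 2
    then have "Q = 0" using Q piece_low by blast
    then show ?thesis using KP P by (simp add: brk_0 E.piece_total)
  next
    case 3
    then show ?thesis using V P Q by blast
  next
    case 4
    have QP: "brk E Q P \<in> piece E (d + e)"
      using brk_piece[OF Q P] by (simp add: add.commute)
    have "comp (d + e) (brk E P Q) = comp (d + e) (sg (1 + ip (Suc n) d e) (brk E Q P))"
      by (subst brk_antisym[OF P Q]) (simp add: sg_def)
    also have "\<dots> = sg (1 + ip (Suc n) d e) (br e (comp e Q) d (comp d P))"
      using comp_sg[OF QP] V[OF Q 4 P] by (simp add: add.commute[of e])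
    also have "\<dots> = br d (comp d P) e (comp e Q)"
      by (subst (2) br_antisym) (simp add: sg_def)
    finally show ?thesis .
  next
    case nonneg
    show ?thesis
    proof (rule A_eqI_ad[OF comp_A[OF PQ] br_A[OF KP KQ refl]])
      fix x X assume X: "X \<in> piece V x"
      define \<xi> where "\<xi> = dpair (-1) x"
      have cP: "contract X P \<in> piece E (\<xi> + d)" and cQ: "contract X Q \<in> piece E (\<xi> + e)"
        using contract_piece[OF P X] contract_piece[OF Q X] by (simp_all add: \<xi>_def add.commute)
      have "contract X (brk E P Q) = brk E (contract X P) Q + sg (ip (Suc n) \<xi> d) (brk E P (contract X Q))"
        unfolding contract_def \<xi>_def by (rule brk_jacobi[OF emb_piece[OF X] P Q])
      moreover have "brk E (contract X P) Q \<in> piece E (\<xi> + (d + e))"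
        "brk E P (contract X Q) \<in> piece E (\<xi> + (d + e))"
        by (rule brk_piece[OF cP Q] brk_piece[OF P cQ]; simp add: ac_simps)+
      ultimately have "comp (\<xi> + (d + e)) (contract X (brk E P Q)) =
          comp (\<xi> + d + e) (brk E (contract X P) Q)
          + sg (ip (Suc n) \<xi> d) (comp (d + (\<xi> + e)) (brk E P (contract X Q)))"
        by (simp add: comp_add comp_sg E.piece_sg ac_simps)
      also have "comp (\<xi> + d + e) (brk E (contract X P) Q) =
          br (\<xi> + d) (comp (\<xi> + d) (contract X P)) e (comp e Q)"
        by (rule less.hyps[OF _ cP Q]) (use nonneg in \<open>simp add: \<xi>_def\<close>)
      also have "comp (d + (\<xi> + e)) (brk E P (contract X Q)) =
          br d (comp d P) (\<xi> + e) (comp (\<xi> + e) (contract X Q))"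
        by (rule less.hyps[OF _ P cQ]) (use nonneg in \<open>simp add: \<xi>_def\<close>)
      finally show "ad x X (d + e) (comp (d + e) (brk E P Q)) =
          ad x X (d + e) (br d (comp d P) e (comp e Q))"
        unfolding ad_br[OF KP KQ X, folded \<xi>_def] ad_comp[OF P X refl, folded \<xi>_def]
          ad_comp[OF Q X refl, folded \<xi>_def] ad_comp[OF PQ X refl, folded \<xi>_def] .
    qed (use nonneg in simp)
  qed
qed

end

context lie_object begin

section \<open>Finality\<close>

definition eps :: "'e \<Rightarrow> 'v multimaps" where
  "eps = restrict (\<lambda>P d. comp d (hcomp E d P)) (total E)"

lemma eps_piece: "P \<in> piece E d \<Longrightarrow> eps P = single d (comp d P)"
  by (rule ext) (simp add: eps_def E.piece_total E.hcomp_homogeneous single_apply)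

lemma eps_total: "P \<in> total E \<Longrightarrow> eps P \<in> total AV"
proof -
  assume P: "P \<in> total E"
  have "{d. eps P d \<noteq> 0} \<subseteq> {d. hcomp E d P \<noteq> 0}"
    using P by (auto simp: eps_def)
  then show ?thesis
    using P E.finite_hcomp[OF P] by (auto simp: total_AV eps_def comp_A intro: finite_subset)
qed

lemma eps_add: "P \<in> total E \<Longrightarrow> Q \<in> total E \<Longrightarrow> eps (P + Q) = eps P + eps Q"
  by (rule ext)
    (simp add: eps_def E.total_add E.hcomp_add comp_add plus_fun_apply[of _ _ "_ :: deg"])

lemma eps_smul: "P \<in> total E \<Longrightarrow> eps (smul E c P) = smul AV c (eps P)"
  by (rule ext) (simp add: eps_def E.total_scale E.hcomp_smul comp_smul smul_AV)

text \<open>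
  Both sides are biadditive, which reduces the claim to homogeneous elements.
\<close>
lemma eps_brk:
  assumes "P \<in> total E" "Q \<in> total E"
  shows "eps (brk E P Q) = brk AV (eps P) (eps Q)"
  using assms(1)
proof (induction rule: E.total_induct)
  case (piece d P)
  from assms(2) show ?case
  proof (induction rule: E.total_induct)
    case (piece e Q)
    show ?case
      using \<open>P \<in> piece E d\<close> piece
      by (simp add: eps_piece brk_single comp_A comp_brk eps_piece[OF brk_piece[OF _ _ refl]])
  next
    case (add Q R)
    then show ?case
      using piece by (simp add: brk_add eps_add brk_AV_add_right eps_total brk_total E.piece_total)
  qed
next
  case (add P R)
  then show ?case
    using assms(2) by (simp add: brk_add eps_add brk_AV_add_left eps_total brk_total)
qed

interpretation AV: lie_object n V AV
  by unfold_locales (rule obj_E_AV)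

lemma eps_emb: "v \<in> total V \<Longrightarrow> eps (emb E v) = emb AV v"
proof (induction rule: total_induct)
  case (piece x X)
  then show ?case by (simp add: eps_piece[OF emb_piece] comp_emb emb_AV_piece)
next
  case (add u v)
  then show ?case by (simp add: emb_add eps_add emb_total AV.emb_add)
qed

lemma mor_eps: "mor_E V E AV eps"
proof -
  have "linear_total E AV eps"
    by (auto simp: linear_total_def eps_total eps_add eps_smul)
  moreover have "eps P \<in> piece AV d" if "P \<in> piece E d" for P d
    using that by (simp add: eps_piece piece_AV comp_A)
  ultimately show ?thesis
    by (auto simp: mor_E_def graded_lie_hom_def eps_brk eps_emb) (simp add: eps_def)
qed

text \<open>
  Induction on \<open>k\<close>: the contractions of \<open>\<phi>(P)\<close> are \<open>[X, \<phi>(P)] = \<phi>([X, P])\<close>, which the induction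
  hypothesis determines.
\<close>
lemma mor_piece:
  assumes "mor_E V E AV \<phi>" "P \<in> piece E d"
  shows "\<phi> P = single d (comp d P)"
  using assms(2)
proof (induction "nat (dfst d + 1)" arbitrary: d P rule: less_induct)
  case less
  note P = less.prems
  have brk: "\<phi> (brk E Q R) = brk AV (\<phi> Q) (\<phi> R)" if "Q \<in> total E" "R \<in> total E" for Q R
    using assms(1) that by (simp add: mor_E_def graded_lie_hom_def)
  have emb: "\<phi> (emb E v) = emb AV v" if "v \<in> total V" for v
    using assms(1) that by (simp add: mor_E_def)
  have "\<phi> P \<in> piece AV d"
    using assms(1) P by (simp add: mor_E_def graded_lie_hom_def)
  then obtain K where K: "\<phi> P = single d K" "K \<in> A d" by (auto simp: piece_AV)
  consider "dfst d < -1" | "dfst d = -1" | "0 \<le> dfst d" by linarith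
  then have "K = comp d P"
  proof cases
    case 1
    then show ?thesis using K(2) A_low by (simp add: comp_def)
  next
    case 2
    then have d: "d = dpair (-1) (dsnd d)" by (metis dpair_dfst_dsnd)
    then obtain X where X: "X \<in> piece V (dsnd d)" "P = emb E X"
      using P piece_emb_cases by metis
    have "single d K = single d (const X)"
      using K(1) X d emb[OF piece_total[OF X(1)]] emb_AV_piece[OF X(1)] by simp
    then have "K = const X" by (metis single_apply)
    then show ?thesis using comp_emb[OF X(1)] X(2) d by simp
  next
    case 3
    show ?thesis
    proof (rule A_eqI_ad[OF K(2) comp_A[OF P] 3])
      fix x X assume X: "X \<in> piece V x"
      define e where "e = dpair (-1) x + d"
      have c: "contract X P \<in> piece E e"
        using contract_piece[OF P X] by (simp add: e_def add.commute)
      have "single e (ad x X d K) = brk AV (emb AV X) (\<phi> P)"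
        using X K by (simp add: emb_AV_piece brk_single A_V br_V e_def) (simp add: const_def)
      also have "\<dots> = \<phi> (contract X P)"
        using X P by (simp add: contract_def brk emb emb_total piece_total E.piece_total)
      also have "\<dots> = single e (comp e (contract X P))"
        by (rule less.hyps[OF _ c]) (use 3 in \<open>simp add: e_def\<close>)
      finally have "ad x X d K = comp e (contract X P)" by (metis single_apply)
      then show "ad x X d K = ad x X d (comp d P)"
        using ad_comp[OF P X e_def] by simp
    qed
  qed
  with K(1) show ?case by simp
qed

lemma mor_unique:
  assumes "mor_E V E AV \<phi>"
  shows "\<phi> = eps"
proof (rule extensionalityI)
  show "\<phi> \<in> extensional (total E)" "eps \<in> extensional (total E)"
    using assms mor_eps by (simp_all add: mor_E_def)
next
  fix P assume "P \<in> total E"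
  then show "\<phi> P = eps P"
  proof (induction rule: E.total_induct)
    case (piece d P)
    then show ?case by (simp add: mor_piece[OF assms] eps_piece)
  next
    case (add P Q)
    moreover have "\<phi> (P + Q) = \<phi> P + \<phi> Q"
      using assms add by (simp add: mor_E_def graded_lie_hom_def linear_total_def)
    ultimately show ?case by (simp add: eps_add)
  qed
qed

end

lemma obj_E_lie_object: "graded_space n V \<Longrightarrow> obj_E n V E \<Longrightarrow> lie_object n V E"
  by (simp add: lie_object_def lie_object_axioms_def graded_ground_def graded_def)

lemma final_A_alg:
  fixes V :: "('k::field_char_0, 'v::ab_group_add) graded_vs"
  assumes "graded_space n V"
  shows "final_E TYPE('e::ab_group_add) n V (A_alg n V)"
proof -
  interpret graded_ground n V using assms by (simp add: graded_ground_def graded_def)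
  have "\<exists>!\<epsilon>. mor_E V E (A_alg n V) \<epsilon>" if "obj_E n V E" for E :: "('k, 'v, 'e) lie_over"
  proof -
    interpret lie_object n V E by (rule obj_E_lie_object[OF assms that])
    show ?thesis using mor_eps mor_unique by blast
  qed
  then show ?thesis using obj_E_AV by (simp add: final_E_def)
qed

lemma mor_E_id:
  fixes V :: "('k::field_char_0, 'v::ab_group_add) graded_vs"
    and E :: "('k, 'v, 'e::ab_group_add) lie_over"
  assumes "graded_space n V" "obj_E n V E"
  shows "mor_E V E E (restrict id (total E))"
proof -
  interpret lie_object n V E by (rule obj_E_lie_object[OF assms])
  show ?thesis
    by (auto simp: mor_E_def graded_lie_hom_def linear_total_def E.total_add E.total_scale
        E.piece_total brk_total emb_total)
qed

lemma mor_E_compose: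
  fixes V :: "('k::field_char_0, 'v::ab_group_add) graded_vs"
    and E :: "('k, 'v, 'e::ab_group_add) lie_over"
    and F :: "('k, 'v, 'f::ab_group_add) lie_over"
    and G :: "('k, 'v, 'g::ab_group_add) lie_over"
  assumes "graded_space n V" "obj_E n V E" "mor_E V E F \<phi>" "mor_E V F G \<psi>"
  shows "mor_E V E G (compose (total E) \<psi> \<phi>)"
proof -
  interpret lie_object n V E by (rule obj_E_lie_object[OF assms(1,2)])
  have "\<phi> P \<in> total F" if "P \<in> total E" for P
    using assms(3) that by (auto simp: mor_E_def graded_lie_hom_def linear_total_def)
  then show ?thesis
    using assms(3,4)
    by (auto simp: mor_E_def graded_lie_hom_def linear_total_def compose_eq Pi_iff
        E.total_add E.total_scale E.piece_total brk_total emb_total)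
qed

text \<open>
  The two morphisms between final objects are mutually inverse, because the composites and the
  identities are endomorphisms of final objects.  Each object is required to be final with respect to both
  ambient types: its own for the uniqueness of the endomorphism, the other one for the existence of
  the morphism.
\<close>
lemma final_E_iso:
  fixes V :: "('k::field_char_0, 'v::ab_group_add) graded_vs"
    and F :: "('k, 'v, 'f::ab_group_add) lie_over"
    and G :: "('k, 'v, 'g::ab_group_add) lie_over"
  assumes V: "graded_space n V"
    and F: "final_E TYPE('f) n V F" "final_E TYPE('g) n V F"
    and G: "final_E TYPE('f) n V G" "final_E TYPE('g) n V G"
  shows "\<exists>\<phi>. iso_E V F G \<phi>"
proof -
  have objs: "obj_E n V F" "obj_E n V G"
    using F G by (simp_all add: final_E_def)
  obtain \<phi> where \<phi>: "mor_E V F G \<phi>" using G(1) objs(1) unfolding final_E_def by blast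
  obtain \<psi> where \<psi>: "mor_E V G F \<psi>" using F(2) objs(2) unfolding final_E_def by blast
  have "\<exists>!\<epsilon>. mor_E V F F \<epsilon>" using F(1) objs(1) unfolding final_E_def by blast
  then have 1: "compose (total F) \<psi> \<phi> = restrict id (total F)"
    using mor_E_compose[OF V objs(1) \<phi> \<psi>] mor_E_id[OF V objs(1)] by blast
  have "\<exists>!\<epsilon>. mor_E V G G \<epsilon>" using G(2) objs(2) unfolding final_E_def by blast
  then have 2: "compose (total G) \<phi> \<psi> = restrict id (total G)"
    using mor_E_compose[OF V objs(2) \<psi> \<phi>] mor_E_id[OF V objs(2)] by blast
  show ?thesis using \<phi> \<psi> 1 2 unfolding iso_E_def by blast
qed

theorem theorem3p4:
  fixes n :: nat
    and V :: "('k::field_char_0, 'v::ab_group_add) graded_vs"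
  assumes "graded_space n V"
  shows "final_E TYPE('e::ab_group_add) n V (A_alg n V) \<and>
    (\<forall>F :: ('k, 'v, 'f::ab_group_add) lie_over.
       final_E TYPE('f) n V F \<and> final_E TYPE('v multimaps) n V F \<longrightarrow>
       (\<exists>\<phi>. iso_E V F (A_alg n V) \<phi>))"
proof (intro conjI allI impI)
  show "final_E TYPE('e) n V (A_alg n V)" by (rule final_A_alg[OF assms])
next
  fix F :: "('k, 'v, 'f) lie_over"
  assume "final_E TYPE('f) n V F \<and> final_E TYPE('v multimaps) n V F"
  then show "\<exists>\<phi>. iso_E V F (A_alg n V) \<phi>"
    by (elim conjE) (rule final_E_iso[OF assms _ _ final_A_alg[OF assms] final_A_alg[OF assms]])
qed

end
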